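(* For all $1\le k\le n$ and any $1<\delta\le 2$, a $\delta$-balanced $(n,k)$-family of perfect hash functions of size $O\!\left(\frac{e^k\sqrt{k}\log n}{(\delta-1)^2}\right)$ can be constructed deterministically in time $\binom{n}{k}\frac{e^k k^{O(1)} n\log n}{(\delta-1)^2}$, where the implied constants are absolute.
   Context: $[n]=\{1,\dots,n\}$ and $\binom{[n]}{k}$ is the family of $k$-element subsets of $[n]$. For $1\le k\le n$ and $\delta\ge 1$, a family (multiset) of functions from $[n]$ to $[k]$ is a $\delta$-balanced $(n,k)$-family of perfect hash functions if there is a real $T>0$ such that for every $S\in\binom{[n]}{k}$ the number of functions in the family that are one-to-one on $S$ lies between $T/\delta$ and $\delta T$. The size of a family is its number of functions; constructing it means outputting the list of all its functions (as value tables).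
   Formalization: At n = 1 the stated bounds vanish although a balanced family is never empty, so log n is read as max(1, log₂ n), which equals log₂ n for all n ≥ 2. *)

theory Defs
  imports Complex_Main "HOL-Library.Multiset" "HOL-Library.FuncSet"
begin

definition balanced_hash_family ::
  "real \<Rightarrow> nat \<Rightarrow> nat \<Rightarrow> (nat \<Rightarrow> nat) multiset \<Rightarrow> bool" where
  "balanced_hash_family \<delta> n k F \<longleftrightarrow>
     (\<forall>f \<in># F. f \<in> {1..n} \<rightarrow>\<^sub>E {1..k}) \<and>
     (\<exists>T::real. T > 0 \<and>
        (\<forall>S. S \<subseteq> {1..n} \<and> card S = k \<longrightarrow>
           T / \<delta> \<le> real (size (filter_mset (\<lambda>f. inj_on f S) F)) \<and>
           real (size (filter_mset (\<lambda>f. inj_on f S) F)) \<le> \<delta> * T))"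

definition value_table :: "nat \<Rightarrow> (nat \<Rightarrow> nat) \<Rightarrow> nat list" where
  "value_table n f = map f [1..<Suc n]"

text \<open>
  The machine model is a deterministic word RAM, presented with structured control flow.
  Memory cells, indexed by natural numbers, hold natural numbers below \<open>2 ^ w\<close>, where \<open>w\<close> is
  the word length.  Programs are fixed finite syntax trees; every constant, memory access,
  arithmetic operation, test and write costs one time unit.  An execution in which a value does
  not fit into a word is stuck, so unit-cost arithmetic on huge numbers is impossible.

  The real parameter \<open>\<delta>\<close> is not a memory word: a program may only ask whether a rational
  number with numerator and denominator that fit into words is at most \<open>\<delta>\<close>.  The result is
  written, one word at a time, onto a write-only output tape.
\<close>

datatype arith_op = Plus | Minus | Times | Divide

datatype expr =
    Const nat
  | Cell expr  \<comment> \<open>indirect addressing: the content of the cell with the computed address\<close>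
  | Op arith_op expr expr

datatype test = Less expr expr | LeDelta expr expr | Neg test

datatype prog =
    Skip
  | Assign expr expr  \<comment> \<open>address, value\<close>
  | Write expr
  | Seq prog prog
  | If test prog prog
  | While test prog

type_synonym memory = "nat \<Rightarrow> nat"

text \<open>Subtraction is truncated at zero, and division is integer division with \<open>x div 0 = 0\<close>.\<close>

fun apply_op :: "arith_op \<Rightarrow> nat \<Rightarrow> nat \<Rightarrow> nat" where
  "apply_op Plus x y = x + y"
| "apply_op Minus x y = x - y"
| "apply_op Times x y = x * y"
| "apply_op Divide x y = x div y"

fun expr_val :: "memory \<Rightarrow> expr \<Rightarrow> nat" where
  "expr_val m (Const c) = c"
| "expr_val m (Cell e) = m (expr_val m e)"
| "expr_val m (Op f e1 e2) = apply_op f (expr_val m e1) (expr_val m e2)"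

fun expr_cost :: "expr \<Rightarrow> nat" where
  "expr_cost (Const c) = 1"
| "expr_cost (Cell e) = expr_cost e + 1"
| "expr_cost (Op f e1 e2) = expr_cost e1 + expr_cost e2 + 1"

fun expr_fits :: "nat \<Rightarrow> memory \<Rightarrow> expr \<Rightarrow> bool" where
  "expr_fits w m (Const c) \<longleftrightarrow> c < 2 ^ w"
| "expr_fits w m (Cell e) \<longleftrightarrow> expr_fits w m e \<and> expr_val m (Cell e) < 2 ^ w"
| "expr_fits w m (Op f e1 e2) \<longleftrightarrow>
     expr_fits w m e1 \<and> expr_fits w m e2 \<and> expr_val m (Op f e1 e2) < 2 ^ w"

text \<open>\<open>LeDelta p q\<close> decides \<open>p / q \<le> \<delta>\<close> for \<open>q > 0\<close>.\<close>

fun test_val :: "real \<Rightarrow> memory \<Rightarrow> test \<Rightarrow> bool" where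
  "test_val \<delta> m (Less e1 e2) \<longleftrightarrow> expr_val m e1 < expr_val m e2"
| "test_val \<delta> m (LeDelta p q) \<longleftrightarrow> real (expr_val m p) \<le> \<delta> * real (expr_val m q)"
| "test_val \<delta> m (Neg b) \<longleftrightarrow> \<not> test_val \<delta> m b"

fun test_cost :: "test \<Rightarrow> nat" where
  "test_cost (Less e1 e2) = expr_cost e1 + expr_cost e2 + 1"
| "test_cost (LeDelta p q) = expr_cost p + expr_cost q + 1"
| "test_cost (Neg b) = test_cost b + 1"

fun test_fits :: "nat \<Rightarrow> memory \<Rightarrow> test \<Rightarrow> bool" where
  "test_fits w m (Less e1 e2) \<longleftrightarrow> expr_fits w m e1 \<and> expr_fits w m e2"
| "test_fits w m (LeDelta p q) \<longleftrightarrow> expr_fits w m p \<and> expr_fits w m q"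
| "test_fits w m (Neg b) \<longleftrightarrow> test_fits w m b"

text \<open>
  \<open>run \<delta> w P (m, out) t (m', out')\<close>: started with memory \<open>m\<close> and output tape \<open>out\<close>, the program
  \<open>P\<close> halts after exactly \<open>t\<close> time units with memory \<open>m'\<close> and output tape \<open>out'\<close>, and no
  value computed on the way exceeds the word length \<open>w\<close>.
\<close>

inductive run ::
  "real \<Rightarrow> nat \<Rightarrow> prog \<Rightarrow> memory \<times> nat list \<Rightarrow> nat \<Rightarrow> memory \<times> nat list \<Rightarrow> bool"
  for \<delta> :: real and w :: nat where
  run_Skip: "run \<delta> w Skip s 1 s"
| run_Assign:
    "\<lbrakk>expr_fits w m a; expr_fits w m e\<rbrakk> \<Longrightarrow>
     run \<delta> w (Assign a e) (m, out) (expr_cost a + expr_cost e + 1)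
       (m(expr_val m a := expr_val m e), out)"
| run_Write:
    "expr_fits w m e \<Longrightarrow>
     run \<delta> w (Write e) (m, out) (expr_cost e + 1) (m, out @ [expr_val m e])"
| run_Seq:
    "\<lbrakk>run \<delta> w P s t1 s'; run \<delta> w Q s' t2 s''\<rbrakk> \<Longrightarrow> run \<delta> w (Seq P Q) s (t1 + t2) s''"
| run_IfTrue:
    "\<lbrakk>test_fits w (fst s) b; test_val \<delta> (fst s) b; run \<delta> w P s t s'\<rbrakk> \<Longrightarrow>
     run \<delta> w (If b P Q) s (test_cost b + t + 1) s'"
| run_IfFalse:
    "\<lbrakk>test_fits w (fst s) b; \<not> test_val \<delta> (fst s) b; run \<delta> w Q s t s'\<rbrakk> \<Longrightarrow>
     run \<delta> w (If b P Q) s (test_cost b + t + 1) s'"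
| run_WhileFalse:
    "\<lbrakk>test_fits w (fst s) b; \<not> test_val \<delta> (fst s) b\<rbrakk> \<Longrightarrow>
     run \<delta> w (While b P) s (test_cost b + 1) s"
| run_WhileTrue:
    "\<lbrakk>test_fits w (fst s) b; test_val \<delta> (fst s) b; run \<delta> w P s t1 s';
      run \<delta> w (While b P) s' t2 s''\<rbrakk> \<Longrightarrow>
     run \<delta> w (While b P) s (test_cost b + 1 + t1 + t2) s''"

inductive_cases run_SkipE: "run \<delta> w Skip s t s'"
inductive_cases run_AssignE: "run \<delta> w (Assign a e) s t s'"
inductive_cases run_WriteE: "run \<delta> w (Write e) s t s'"
inductive_cases run_SeqE: "run \<delta> w (Seq P Q) s t s'"
inductive_cases run_IfE: "run \<delta> w (If b P Q) s t s'"
inductive_cases run_WhileE: "run \<delta> w (While b P) s t s'"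

lemma run_deterministic:
  "run \<delta> w P s t s' \<Longrightarrow> run \<delta> w P s u r \<Longrightarrow> u = t \<and> r = s'"
proof (induction arbitrary: u r rule: run.induct)
  case (run_Seq P s t1 s' Q t2 s'')
  from run_Seq.prems obtain u1 u2 q
    where u: "u = u1 + u2" and P: "run \<delta> w P s u1 q" and Q: "run \<delta> w Q q u2 r"
    by (rule run_SeqE)
  from run_Seq.IH(1)[OF P] have "u1 = t1" "q = s'" by simp_all
  with run_Seq.IH(2) Q u show ?case by metis
next
  case (run_IfTrue s b P t s' Q)
  from run_IfTrue.prems run_IfTrue.hyps(2) obtain u1
    where u: "u = test_cost b + u1 + 1" and P: "run \<delta> w P s u1 r"
    by (elim run_IfE) simp_all
  from run_IfTrue.IH[OF P] u show ?case by metis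
next
  case (run_IfFalse s b Q t s' P)
  from run_IfFalse.prems run_IfFalse.hyps(2) obtain u1
    where u: "u = test_cost b + u1 + 1" and Q: "run \<delta> w Q s u1 r"
    by (elim run_IfE) simp_all
  from run_IfFalse.IH[OF Q] u show ?case by metis
next
  case (run_WhileFalse s b P)
  from run_WhileFalse.prems show ?case
    by (rule run_WhileE) (simp_all add: run_WhileFalse.hyps(2))
next
  case (run_WhileTrue s b P t1 s' t2 s'')
  from run_WhileTrue.prems obtain u1 u2 q
    where u: "u = test_cost b + 1 + u1 + u2"
      and P: "run \<delta> w P s u1 q" and W: "run \<delta> w (While b P) q u2 r"
    by (rule run_WhileE) (simp_all add: run_WhileTrue.hyps(2))
  from run_WhileTrue.IH(1)[OF P] have "u1 = t1" "q = s'" by simp_all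
  with run_WhileTrue.IH(2) W u show ?case by metis
qed (erule run_SkipE run_AssignE run_WriteE; simp)+

text \<open>
  The input is \<open>n\<close> in cell 0 and \<open>k\<close> in cell 1; all other cells are zero and the tape is empty.
\<close>

definition outputs_within ::
  "real \<Rightarrow> nat \<Rightarrow> prog \<Rightarrow> nat \<Rightarrow> nat \<Rightarrow> real \<Rightarrow> nat list \<Rightarrow> bool" where
  "outputs_within \<delta> w P n k bound out \<longleftrightarrow>
     (\<exists>t m. run \<delta> w P ((\<lambda>_. 0)(0 := n, 1 := k), []) t (m, out) \<and> real t \<le> bound)"

text \<open>
  The logarithm with value 1 instead of 0 at \<open>n = 1\<close> (and unchanged for \<open>n \<ge> 2\<close>): a balanced
  family is never empty, so a bound that vanishes at \<open>n = 1\<close> could not hold.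
\<close>

definition log_pos :: "nat \<Rightarrow> real" where
  "log_pos n = max 1 (log 2 (real n))"

text \<open>
  Word lengths of order \<open>k log n + log (1 / (\<delta> - 1))\<close>: what is needed to address one cell per
  \<open>k\<close>-subset of \<open>{1..n}\<close> and to resolve \<open>\<delta>\<close>.  Simulating such a word by \<open>k\<close> words of order
  \<open>log n + log (1 / (\<delta> - 1))\<close> only affects the factor \<open>k ^ O(1)\<close> of a running time.
\<close>

definition admissible_word_length :: "real \<Rightarrow> nat \<Rightarrow> nat \<Rightarrow> real \<Rightarrow> nat \<Rightarrow> bool" where
  "admissible_word_length D n k \<delta> w \<longleftrightarrow>
     real w \<le> D * (1 + real k * log 2 (real n) + log 2 (1 / (\<delta> - 1)))"

end

theory Submission imports Defs begin

text \<open>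
  The family is built greedily.  Every \<open>k\<close>-subset \<open>S\<close> carries two weights, one growing by a factor
  of about \<open>1 + \<epsilon>(Y - p)\<close> and one by about \<open>1 - \<epsilon>(Y - p)\<close> in each round, where \<open>Y\<close> indicates that the
  new function is one-to-one on \<open>S\<close>, \<open>p = k! / k\<^sup>k\<close> is the probability of this event for a random
  function, and \<open>\<epsilon> = 1 / E\<close> is of order \<open>\<delta> - 1\<close>.  The values of the new function are fixed one after
  the other by the method of conditional expectations, so that the sum of all weights does not
  increase.  Hence after \<open>M\<close> rounds no weight exceeds a constant times \<open>(n choose k)\<close> times its initial
  value, which forces the number of functions that are one-to-one on \<open>S\<close> to be within a factor
  \<open>1 \<plusminus> O(\<epsilon>)\<close> of \<open>pM\<close> as soon as \<open>pM \<ge> \<epsilon>\<^sup>-\<^sup>2 ln (4 (n choose k))\<close>.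

  The weights are integers starting at \<open>M\<close>.  Rounding an update upwards preserves the lower bounds on
  the weights, and over all \<open>M\<close> rounds it adds at most as much as the initial total.
\<close>

section \<open>Time and word length of structured programs\<close>

text \<open>The size bound arises as a product. The reciprocal 1 / p = k^k / k! is at most e^k /
  sqrt k, and treating all subsets at once costs ln (4 (n choose k)), which is O(k log n). The
  factor sqrt k therefore relies on Stirling's saving; the crude k! >= (k / e)^k would leave k. To
  pay 1 / p and not 1 / p^2, the second-order error of a round must be charged to Y + p, whose sum
  is of the order of p M, and not to 1. The machine has bounded integers only and can merely compare
  fractions with \<delta>. Hence conditional probabilities are scaled by k^k, which makes them
  integers, growth factors share the denominator k^k E, the value of E is searched for, and the
  logarithm is replaced by the integer 2 + k a with n < 2^a. No data structure supports the
  conditional expectations: the sum over all subsets is recomputed for every candidate value, in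
  time of order (n choose k) k. With k candidates, n positions and M rounds this is M n (n choose k)
  k^2, and only the power of k is affected.\<close>

fun small_consts :: "expr \<Rightarrow> bool" where
  "small_consts (Const c) \<longleftrightarrow> c \<le> 64"
| "small_consts (Cell e) \<longleftrightarrow> small_consts e"
| "small_consts (Op f e1 e2) \<longleftrightarrow> small_consts e1 \<and> small_consts e2"

text \<open>Both limits mirror the word length: constants do not exceed the lower bound 64 on
  \<open>V\<close>, and cost 64 keeps all intermediate values within \<open>V ^ 64\<close>.\<close>

definition expr_ok :: "expr \<Rightarrow> bool" where
  "expr_ok e \<longleftrightarrow> small_consts e \<and> expr_cost e \<le> 64"

fun test_ok :: "test \<Rightarrow> bool" where
  "test_ok (Less e1 e2) \<longleftrightarrow> expr_ok e1 \<and> expr_ok e2"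
| "test_ok (LeDelta e1 e2) \<longleftrightarrow> expr_ok e1 \<and> expr_ok e2"
| "test_ok (Neg b) \<longleftrightarrow> test_ok b"

abbreviation Var :: "nat \<Rightarrow> expr" where
  "Var x \<equiv> Cell (Const x)"

text \<open>Eight arrays are interleaved, so that none of them needs a size known in advance.\<close>

definition arr :: "nat \<Rightarrow> nat \<Rightarrow> nat" where
  "arr r j = 32 + r + 8 * j"

definition Arr :: "nat \<Rightarrow> expr \<Rightarrow> expr" where
  "Arr r e = Op Plus (Const (32 + r)) (Op Times (Const 8) e)"

lemma arr_eq [simp]: "r < 8 \<Longrightarrow> r' < 8 \<Longrightarrow> arr r j = arr r' j' \<longleftrightarrow> r = r' \<and> j = j'"
proof
  assume "r < 8" "r' < 8" "arr r j = arr r' j'"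
  then have e: "r + 8 * j = r' + 8 * j'" by (simp add: arr_def)
  have "(r + 8 * j) mod 8 = r" "(r' + 8 * j') mod 8 = r'"
    using \<open>r < 8\<close> \<open>r' < 8\<close> by simp_all
  with e show "r = r' \<and> j = j'" by simp
qed simp

lemma arr_neq [simp]: "x < 32 \<Longrightarrow> arr r j \<noteq> x" "x < 32 \<Longrightarrow> x \<noteq> arr r j"
  unfolding arr_def by auto

lemma arr_not_le [simp]: "x < 32 \<Longrightarrow> \<not> arr r j \<le> x"
  unfolding arr_def by auto

lemma Arr_simps [simp]:
  "expr_val m (Arr r e) = arr r (expr_val m e)"
  "expr_cost (Arr r e) = expr_cost e + 4"
  "small_consts (Arr r e) \<longleftrightarrow> r \<le> 32 \<and> small_consts e"
  by (auto simp: Arr_def arr_def)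

abbreviation loop :: "nat \<Rightarrow> nat \<Rightarrow> prog \<Rightarrow> prog" where
  "loop x y c \<equiv> While (Less (Var x) (Var y)) c"

text \<open>
  If every cell holds at most \<open>V\<close>, then so small an expression fits into a word as soon as
  \<open>V ^ 64 < 2 ^ w\<close>.  It therefore suffices to bound the values that are assigned.
\<close>

locale machine =
  fixes \<delta> :: real and w V :: nat
  assumes V_ge: "64 \<le> V" and V_w: "V ^ 64 < 2 ^ w"
begin

definition bounded_by :: "memory \<Rightarrow> bool" where
  "bounded_by m \<longleftrightarrow> (\<forall>a. m a \<le> V)"

lemma bounded_by_upd: "bounded_by m \<Longrightarrow> v \<le> V \<Longrightarrow> bounded_by (m(a := v))"
  by (auto simp: bounded_by_def)

text \<open>Each unit of cost pays for one factor \<open>V\<close>. A product multiplies the bounds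
  of its operands; a sum is at most twice their product, and the unit charged for the operator
  covers the 2.\<close>

lemma expr_val_le:
  assumes "bounded_by m" "small_consts e"
  shows "expr_val m e \<le> V ^ expr_cost e"
  using assms(2)
proof (induction e)
  case (Const c)
  then show ?case using V_ge by simp
next
  case (Cell e)
  have "m (expr_val m e) \<le> V ^ 1" using assms(1) by (simp add: bounded_by_def)
  also have "\<dots> \<le> V ^ expr_cost (Cell e)"
    using V_ge by (intro power_increasing) auto
  finally show ?case by simp
next
  case (Op f e1 e2)
  let ?a = "expr_val m e1" and ?b = "expr_val m e2"
  let ?A = "V ^ expr_cost e1" and ?B = "V ^ expr_cost e2"
  have a: "?a \<le> ?A" and b: "?b \<le> ?B" using Op by auto
  have pos: "1 \<le> ?A" "1 \<le> ?B" using V_ge by auto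
  have "?A + ?B \<le> 2 * (?A * ?B)"
  proof -
    have "?A * 1 \<le> ?A * ?B" "1 * ?B \<le> ?A * ?B" using pos by (intro mult_le_mono; simp)+
    then show ?thesis by linarith
  qed
  also have "\<dots> \<le> ?A * ?B * V" using V_ge by simp
  finally have AB: "?A + ?B \<le> ?A * ?B * V" .
  have AB': "?A * ?B \<le> ?A * ?B * V" using V_ge by simp
  have "apply_op f ?a ?b \<le> ?A * ?B * V"
  proof (cases f)
    case Plus
    have "?a + ?b \<le> ?A * ?B * V" using a b AB by linarith
    then show ?thesis using Plus by simp
  next
    case Minus
    have "?a - ?b \<le> ?A * ?B * V" using a AB by linarith
    then show ?thesis using Minus by simp
  next
    case Times
    then show ?thesis using le_trans[OF mult_le_mono[OF a b] AB'] by simp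
  next
    case Divide
    have "?a div ?b \<le> ?a" by simp
    also have "\<dots> \<le> ?A * ?B * V" using a AB by linarith
    finally show ?thesis using Divide by simp
  qed
  then show ?case by (simp add: power_add mult_ac)
qed

lemma expr_fitsI: "bounded_by m \<Longrightarrow> expr_ok e \<Longrightarrow> expr_fits w m e"
proof (induction e)
  case (Const c)
  have "c \<le> V ^ 1" using Const V_ge by (simp add: expr_ok_def)
  also have "\<dots> \<le> V ^ 64" using V_ge by (intro power_increasing) auto
  finally show ?case using V_w by simp
next
  case (Cell e)
  have "expr_val m (Cell e) \<le> V ^ expr_cost (Cell e)"
    using Cell by (intro expr_val_le) (auto simp: expr_ok_def)
  also have "\<dots> \<le> V ^ 64"
    using Cell V_ge by (intro power_increasing) (auto simp: expr_ok_def)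
  finally show ?case using V_w Cell by (simp add: expr_ok_def)
next
  case (Op f e1 e2)
  have "expr_val m (Op f e1 e2) \<le> V ^ expr_cost (Op f e1 e2)"
    using Op by (intro expr_val_le) (auto simp: expr_ok_def)
  also have "\<dots> \<le> V ^ 64"
    using Op V_ge by (intro power_increasing) (auto simp: expr_ok_def)
  finally show ?case using V_w Op by (simp add: expr_ok_def)
qed

lemma test_fitsI: "bounded_by m \<Longrightarrow> test_ok b \<Longrightarrow> test_fits w m b"
  by (induction b) (auto intro: expr_fitsI)

text \<open>A timed weakest precondition for total correctness: demanding a run excludes divergence
  and stuck execution alike. Boundedness of the memory is assumed on entry and guaranteed on exit,
  so that postconditions need not mention it.\<close>

definition wp ::
  "nat \<Rightarrow> prog \<Rightarrow> (memory \<Rightarrow> nat list \<Rightarrow> bool) \<Rightarrow> memory \<Rightarrow> nat list \<Rightarrow> bool" where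
  "wp t c Q m out \<longleftrightarrow> (bounded_by m \<longrightarrow>
     (\<exists>t' m' out'. t' \<le> t \<and> run \<delta> w c (m, out) t' (m', out') \<and> bounded_by m' \<and> Q m' out'))"

lemma wp_weaken:
  assumes "wp t c Q m out" "t \<le> t'" "\<And>m' out'. Q m' out' \<Longrightarrow> Q' m' out'"
  shows "wp t' c Q' m out"
  using assms unfolding wp_def by (meson le_trans)

lemma wp_time: "wp t c Q m out \<Longrightarrow> t \<le> t' \<Longrightarrow> wp t' c Q m out"
  by (rule wp_weaken)

lemma wp_bounded: "(bounded_by m \<Longrightarrow> wp t c Q m out) \<Longrightarrow> wp t c Q m out"
  unfolding wp_def by blast

lemma wp_Skip: "Q m out \<Longrightarrow> wp 1 Skip Q m out"
  unfolding wp_def using run_Skip by blast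

lemma wp_Assign:
  assumes "expr_ok a" "expr_ok e" "expr_val m e \<le> V"
    "Q (m(expr_val m a := expr_val m e)) out"
  shows "wp (expr_cost a + expr_cost e + 1) (Assign a e) Q m out"
  unfolding wp_def
proof
  assume m: "bounded_by m"
  show "\<exists>t' m' out'. t' \<le> expr_cost a + expr_cost e + 1 \<and>
    run \<delta> w (Assign a e) (m, out) t' (m', out') \<and> bounded_by m' \<and> Q m' out'"
    using run_Assign[OF expr_fitsI[OF m assms(1)] expr_fitsI[OF m assms(2)], of \<delta> out]
      bounded_by_upd[OF m assms(3)] assms(4) by blast
qed

lemma wp_Write:
  assumes "expr_ok e" "Q m (out @ [expr_val m e])"
  shows "wp (expr_cost e + 1) (Write e) Q m out"
  unfolding wp_def using run_Write[OF expr_fitsI[OF _ assms(1)]] assms(2) by blast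

lemma wp_Seq:
  assumes "wp t1 c1 (wp t2 c2 Q) m out"
  shows "wp (t1 + t2) (Seq c1 c2) Q m out"
  unfolding wp_def
proof
  assume m: "bounded_by m"
  from assms m obtain u1 m1 out1 where 1: "u1 \<le> t1" "run \<delta> w c1 (m, out) u1 (m1, out1)"
    "bounded_by m1" "wp t2 c2 Q m1 out1" unfolding wp_def by blast
  from 1(3,4) obtain u2 m2 out2 where 2: "u2 \<le> t2" "run \<delta> w c2 (m1, out1) u2 (m2, out2)"
    "bounded_by m2" "Q m2 out2" unfolding wp_def by blast
  from run_Seq[OF 1(2) 2(2)] 1(1) 2(1,3,4)
  show "\<exists>t' m' out'. t' \<le> t1 + t2 \<and> run \<delta> w (Seq c1 c2) (m, out) t' (m', out') \<and>
    bounded_by m' \<and> Q m' out'" by (meson add_mono)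
qed

text \<open>The sum of the branch times replaces their maximum. This costs only a constant, since
  the program branches only between loop-free pieces.\<close>

lemma wp_If:
  assumes "test_ok b" "test_val \<delta> m b \<Longrightarrow> wp t1 c1 Q m out"
    "\<not> test_val \<delta> m b \<Longrightarrow> wp t2 c2 Q m out"
  shows "wp (test_cost b + (t1 + t2) + 1) (If b c1 c2) Q m out"
  unfolding wp_def
proof
  assume m: "bounded_by m"
  have f: "test_fits w (fst (m, out)) b" using test_fitsI[OF m assms(1)] by simp
  show "\<exists>t' m' out'. t' \<le> test_cost b + (t1 + t2) + 1 \<and>
    run \<delta> w (If b c1 c2) (m, out) t' (m', out') \<and> bounded_by m' \<and> Q m' out'"
  proof (cases "test_val \<delta> m b")
    case True
    from assms(2)[OF True] m obtain u m1 out1 where 1: "u \<le> t1"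
      "run \<delta> w c1 (m, out) u (m1, out1)" "bounded_by m1" "Q m1 out1" unfolding wp_def by blast
    have "run \<delta> w (If b c1 c2) (m, out) (test_cost b + u + 1) (m1, out1)"
      using run_IfTrue[OF f _ 1(2)] True by simp
    moreover have "test_cost b + u + 1 \<le> test_cost b + (t1 + t2) + 1" using 1(1) by simp
    ultimately show ?thesis using 1 by blast
  next
    case False
    from assms(3)[OF False] m obtain u m1 out1 where 1: "u \<le> t2"
      "run \<delta> w c2 (m, out) u (m1, out1)" "bounded_by m1" "Q m1 out1" unfolding wp_def by blast
    have "run \<delta> w (If b c1 c2) (m, out) (test_cost b + u + 1) (m1, out1)"
      using run_IfFalse[OF f _ 1(2)] False by simp
    moreover have "test_cost b + u + 1 \<le> test_cost b + (t1 + t2) + 1" using 1(1) by simp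
    ultimately show ?thesis using 1 by blast
  qed
qed

lemma wp_conseq:
  "wp t c Q m out \<Longrightarrow> (\<And>m' out'. Q m' out' \<Longrightarrow> Q' m' out') \<Longrightarrow> wp t c Q' m out"
  using wp_weaken[OF _ le_refl] by blast

text \<open>The number \<open>p\<close> is a variant carried by the invariant; \<open>K\<close>
  bounds its initial value and thereby the number of iterations. The last summands pay for the
  final, failing test.\<close>

lemma wp_While:
  assumes "I p m out" "p \<le> K" "test_ok b"
    and body: "\<And>p m out. I p m out \<Longrightarrow> bounded_by m \<Longrightarrow> test_val \<delta> m b \<Longrightarrow>
      wp t c (\<lambda>m' out'. \<exists>p' < p. I p' m' out') m out"
    and exit: "\<And>p m out. I p m out \<Longrightarrow> \<not> test_val \<delta> m b \<Longrightarrow> Q m out"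
  shows "wp (K * (t + test_cost b + 1) + test_cost b + 1) (While b c) Q m out"
  using assms(1,2)
proof (induction K arbitrary: p m out)
  case (0 p m out)
  have "\<not> test_val \<delta> m b" if "bounded_by m"
    using body[OF 0(1) that] 0(2) that unfolding wp_def by auto
  moreover have "run \<delta> w (While b c) (m, out) (test_cost b + 1) (m, out)"
    if "bounded_by m" "\<not> test_val \<delta> m b"
    using run_WhileFalse[of w "(m, out)" b \<delta> c] test_fitsI[OF that(1) assms(3)] that(2) by simp
  ultimately show ?case
    unfolding wp_def using exit[OF 0(1)] by auto
next
  case (Suc K p m out)
  show ?case unfolding wp_def
  proof
    assume m: "bounded_by m"
    have f: "test_fits w (fst (m, out)) b" using test_fitsI[OF m assms(3)] by simp
    show "\<exists>t' m' out'. t' \<le> Suc K * (t + test_cost b + 1) + test_cost b + 1 \<and>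
      run \<delta> w (While b c) (m, out) t' (m', out') \<and> bounded_by m' \<and> Q m' out'"
    proof (cases "test_val \<delta> m b")
      case True
      from body[OF Suc.prems(1) m True] m obtain u m1 out1 p1 where 1: "u \<le> t"
        "run \<delta> w c (m, out) u (m1, out1)" "bounded_by m1" "I p1 m1 out1" "p1 < p"
        unfolding wp_def by blast
      from 1(5) Suc.prems(2) have "p1 \<le> K" by simp
      from Suc.IH[OF 1(4) this] 1(3) obtain u2 m2 out2 where
        2: "u2 \<le> K * (t + test_cost b + 1) + test_cost b + 1"
        "run \<delta> w (While b c) (m1, out1) u2 (m2, out2)" "bounded_by m2" "Q m2 out2"
        unfolding wp_def by blast
      have "run \<delta> w (While b c) (m, out) (test_cost b + 1 + u + u2) (m2, out2)"
        using run_WhileTrue[OF f _ 1(2) 2(2)] True by simp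
      moreover have "test_cost b + 1 + u + u2 \<le> Suc K * (t + test_cost b + 1) + test_cost b + 1"
        using 1(1) 2(1) by (simp add: algebra_simps)
      ultimately show ?thesis using 2(3,4) by blast
    next
      case False
      have "run \<delta> w (While b c) (m, out) (test_cost b + 1) (m, out)"
        using run_WhileFalse[OF f] False by simp
      moreover have "test_cost b + 1 \<le> Suc K * (t + test_cost b + 1) + test_cost b + 1" by simp
      ultimately show ?thesis using m exit[OF Suc.prems(1) False] by blast
    qed
  qed
qed

text \<open>Programs without loops are executed symbolically by rewriting with \<open>exec_ok\<close>.\<close>

fun max_cost :: "prog \<Rightarrow> nat" where
  "max_cost Skip = 1"
| "max_cost (Assign a e) = expr_cost a + expr_cost e + 1"
| "max_cost (Write e) = expr_cost e + 1"
| "max_cost (Seq c1 c2) = max_cost c1 + max_cost c2"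
| "max_cost (If b c1 c2) = test_cost b + (max_cost c1 + max_cost c2) + 1"
| "max_cost (While b c) = 0"

fun exec_ok :: "prog \<Rightarrow> (memory \<Rightarrow> nat list \<Rightarrow> bool) \<Rightarrow> memory \<Rightarrow> nat list \<Rightarrow> bool" where
  "exec_ok Skip Q m out \<longleftrightarrow> Q m out"
| "exec_ok (Assign a e) Q m out \<longleftrightarrow> expr_ok a \<and> expr_ok e \<and> expr_val m e \<le> V \<and>
     Q (m(expr_val m a := expr_val m e)) out"
| "exec_ok (Write e) Q m out \<longleftrightarrow> expr_ok e \<and> Q m (out @ [expr_val m e])"
| "exec_ok (Seq c1 c2) Q m out \<longleftrightarrow> exec_ok c1 (exec_ok c2 Q) m out"
| "exec_ok (If b c1 c2) Q m out \<longleftrightarrow> test_ok b \<and>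
     (if test_val \<delta> m b then exec_ok c1 Q m out else exec_ok c2 Q m out)"
| "exec_ok (While b c) Q m out \<longleftrightarrow> False"

lemma wp_exec_aux: "exec_ok c Q m out \<Longrightarrow> wp (max_cost c) c Q m out"
proof (induction c arbitrary: Q m out)
  case (Seq c1 c2)
  from Seq.prems have "exec_ok c1 (exec_ok c2 Q) m out" by simp
  from Seq.IH(1)[OF this] have "wp (max_cost c1) c1 (wp (max_cost c2) c2 Q) m out"
    by (rule wp_conseq) (rule Seq.IH(2))
  then show ?case unfolding max_cost.simps by (rule wp_Seq)
next
  case (If b c1 c2)
  then show ?case unfolding max_cost.simps by (intro wp_If) (auto split: if_splits)
qed (unfold max_cost.simps, auto intro: wp_Skip wp_Assign wp_Write simp del: One_nat_def add_Suc_right Suc_eq_plus1[symmetric])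

lemma wp_exec: "exec_ok c Q m out \<Longrightarrow> max_cost c \<le> t \<Longrightarrow> wp t c Q m out"
  using wp_exec_aux wp_time by blast

lemma wp_Seq_exec:
  "exec_ok c1 (wp t c2 Q) m out \<Longrightarrow> wp (max_cost c1 + t) (Seq c1 c2) Q m out"
  by (intro wp_Seq wp_exec order_refl)

text \<open>The counter itself indexes the invariant. Comparing two cells costs 5 and the branch 1,
  whence the 6 per iteration and the final 6.\<close>

lemma wp_loop:
  assumes "m x = 0" "m y = K" "I 0 m out" "x \<le> 64" "y \<le> 64"
    and body: "\<And>j m out. I j m out \<Longrightarrow> m x = j \<Longrightarrow> m y = K \<Longrightarrow> j < K \<Longrightarrow> bounded_by m \<Longrightarrow>
      wp t c (\<lambda>m' out'. I (Suc j) m' out' \<and> m' x = Suc j \<and> m' y = K) m out"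
    and exit: "\<And>m out. I K m out \<Longrightarrow> m x = K \<Longrightarrow> m y = K \<Longrightarrow> Q m out"
  shows "wp (K * (t + 6) + 6) (loop x y c) Q m out"
proof -
  let ?b = "Less (Var x) (Var y)"
  have "wp (K * (t + test_cost ?b + 1) + test_cost ?b + 1) (loop x y c) Q m out"
  proof (rule wp_While[where p = K and
      I = "\<lambda>p m out. I (m x) m out \<and> m x \<le> K \<and> m y = K \<and> p = K - m x"])
    fix p m out
    assume I: "I (m x) m out \<and> m x \<le> K \<and> m y = K \<and> p = K - m x"
      and b: "bounded_by m" and t: "test_val \<delta> m ?b"
    from I t have "wp t c (\<lambda>m' out'. I (Suc (m x)) m' out' \<and> m' x = Suc (m x) \<and> m' y = K) m out"
      by (intro body[OF _ _ _ _ b]) auto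
    then show "wp t c (\<lambda>m' out'. \<exists>p' < p. I (m' x) m' out' \<and> m' x \<le> K \<and> m' y = K \<and>
      p' = K - m' x) m out"
      by (rule wp_conseq) (use I t in auto)
  qed (use assms in \<open>auto simp: expr_ok_def\<close>)
  moreover have "K * (t + test_cost ?b + 1) + test_cost ?b + 1 = K * (t + 6) + 6"
    by (simp add: algebra_simps)
  ultimately show ?thesis by (simp only:)
qed

end

section \<open>Enumeration of subsets\<close>

text \<open>
  Sets are represented by decreasing lists, and these by numbers whose digits in base \<open>b\<close> are the
  elements.  No digit is zero, so the size of the set can be read off the magnitude of its code.
\<close>

fun code :: "nat \<Rightarrow> nat list \<Rightarrow> nat" where
  "code b [] = 0"
| "code b (x # xs) = code b xs * b + x"

lemma code_less: "set xs \<subseteq> {1..<b} \<Longrightarrow> code b xs < b ^ length xs"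
proof (induction xs)
  case (Cons x xs)
  then have "code b xs + 1 \<le> b ^ length xs" by simp
  then have "(code b xs + 1) * b \<le> b ^ length xs * b" by (rule mult_le_mono1)
  moreover have "x < b" using Cons.prems by simp
  ultimately show ?case by (simp add: mult.commute)
qed simp

text \<open>The last list element is the most significant digit, and it is at least 1.\<close>

lemma code_ge: "set xs \<subseteq> {1..<b} \<Longrightarrow> xs \<noteq> [] \<Longrightarrow> b ^ (length xs - 1) \<le> code b xs"
proof (induction xs)
  case (Cons x xs)
  show ?case
  proof (cases "xs = []")
    case False
    with Cons have *: "b ^ (length xs - 1) * b \<le> code b xs * b" by (intro mult_le_mono1) auto
    have "b ^ (length xs - 1) * b = b ^ length xs"
      using False by (cases xs) auto
    then have "b ^ length xs \<le> code b xs * b" using * by simp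
    then show ?thesis by simp
  qed (use Cons in auto)
qed simp

text \<open>Lets the program decide by one comparison whether a list may still grow, without storing
  lengths.\<close>

lemma code_less_iff:
  assumes "set xs \<subseteq> {1..<b}" "xs \<noteq> []" "1 < b" "1 \<le> k"
  shows "code b xs < b ^ (k - 1) \<longleftrightarrow> length xs < k"
proof
  assume "code b xs < b ^ (k - 1)"
  then have "b ^ (length xs - 1) < b ^ (k - 1)" using code_ge[OF assms(1,2)] by linarith
  then have "length xs - 1 < k - 1" using assms(3) by (simp add: power_strict_increasing_iff)
  then show "length xs < k" by simp
next
  assume "length xs < k"
  then have "b ^ length xs \<le> b ^ (k - 1)" using assms(3) by (intro power_increasing) auto
  then show "code b xs < b ^ (k - 1)" using code_less[OF assms(1)] by linarith
qed

text \<open>The order models the program's array as well: treating \<open>Suc x\<close> appends all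
  extensions behind the older entries. Lists that reach length \<open>k\<close> cannot grow any more
  and go to \<open>leaves\<close> instead.\<close>

fun ents :: "nat \<Rightarrow> nat \<Rightarrow> nat list list" where
  "ents k 0 = [[]]"
| "ents k (Suc x) =
     ents k x @ map ((#) (Suc x)) (filter (\<lambda>xs. Suc (length xs) < k) (ents k x))"

fun leaves :: "nat \<Rightarrow> nat \<Rightarrow> nat list list" where
  "leaves k 0 = []"
| "leaves k (Suc x) =
     leaves k x @ map ((#) (Suc x)) (filter (\<lambda>xs. \<not> Suc (length xs) < k) (ents k x))"

abbreviation decreasing :: "nat \<Rightarrow> nat list \<Rightarrow> bool" where
  "decreasing x xs \<equiv> sorted_wrt (>) xs \<and> set xs \<subseteq> {1..x}"

lemma decreasing_Suc:
  "decreasing (Suc x) xs \<longleftrightarrow>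
    decreasing x xs \<or> (\<exists>ys. xs = Suc x # ys \<and> decreasing x ys)"
proof (cases xs)
  case (Cons y ys)
  show ?thesis
  proof (cases "y = Suc x")
    case True
    then show ?thesis using Cons by fastforce
  next
    case False
    then show ?thesis using Cons by fastforce
  qed
qed simp

lemma set_ents:
  assumes "1 \<le> k"
  shows "set (ents k x) = {xs. decreasing x xs \<and> length xs < k}"
proof (induction x)
  case (Suc x)
  show ?case
    unfolding decreasing_Suc ents.simps set_append set_map set_filter Suc by auto
qed (use assms in auto)

lemma set_leaves:
  assumes "1 \<le> k"
  shows "set (leaves k x) = {xs. decreasing x xs \<and> length xs = k}"
proof (induction x)
  case (Suc x)
  show ?case
    unfolding decreasing_Suc leaves.simps set_append set_map set_filter Suc set_ents[OF assms]
    by auto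
qed (use assms in auto)

lemma distinct_ents:
  assumes "1 \<le> k"
  shows "distinct (ents k x)"
proof (induction x)
  case (Suc x)
  then show ?case by (auto simp: distinct_map set_ents[OF assms])
qed simp

lemma distinct_leaves:
  assumes "1 \<le> k"
  shows "distinct (leaves k x)"
proof (induction x)
  case (Suc x)
  then show ?case
    using distinct_ents[OF assms, of x] by (auto simp: distinct_map set_leaves[OF assms])
qed simp

lemma inj_on_set_decreasing: "inj_on set {xs. decreasing x xs \<and> R xs}"
proof (rule inj_onI)
  fix xs ys
  assume "xs \<in> {xs. decreasing x xs \<and> R xs}" "ys \<in> {xs. decreasing x xs \<and> R xs}"
    and "set xs = set ys"
  then have "rev xs = rev ys"
    by (intro strict_sorted_equal) (auto simp: sorted_wrt_rev)
  then show "xs = ys" by simp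
qed

lemma decreasing_distinct: "sorted_wrt (>) xs \<Longrightarrow> distinct (xs :: nat list)"
  by (induction xs) auto

lemma ex_decreasing:
  assumes "S \<subseteq> {1..x}"
  shows "\<exists>xs. decreasing x xs \<and> set xs = S"
proof -
  have "finite S" using assms finite_subset by auto
  then have "decreasing x (rev (sorted_list_of_set S)) \<and> set (rev (sorted_list_of_set S)) = S"
    using assms by (simp add: sorted_wrt_rev)
  then show ?thesis by blast
qed

lemma set_image_decreasing:
  "set ` {xs. decreasing x xs \<and> R (length xs)} = {S. S \<subseteq> {1..x} \<and> R (card S)}" (is "?A = ?B")
proof
  show "?A \<subseteq> ?B" by (auto simp: distinct_card decreasing_distinct)
  show "?B \<subseteq> ?A"
  proof
    fix S assume S: "S \<in> ?B"
    then obtain xs where "decreasing x xs" "set xs = S" using ex_decreasing by blast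
    moreover from this have "card S = length xs"
      using decreasing_distinct distinct_card by blast
    ultimately show "S \<in> ?A" using S by auto
  qed
qed

lemma length_leaves:
  assumes "1 \<le> k"
  shows "length (leaves k x) = x choose k"
proof -
  have "length (leaves k x) = card (set (leaves k x))"
    using distinct_leaves[OF assms] by (simp add: distinct_card)
  also have "\<dots> = card (set ` set (leaves k x))"
    unfolding set_leaves[OF assms] by (intro card_image[symmetric] inj_on_set_decreasing)
  also have "set ` set (leaves k x) = {S. S \<subseteq> {1..x} \<and> card S = k}"
    unfolding set_leaves[OF assms] by (rule set_image_decreasing[where R = "\<lambda>c. c = k"])
  finally show ?thesis by (simp add: n_subsets)
qed

text \<open>Count the pairs of an \<open>r\<close>-set inside a \<open>k\<close>-set: each
  \<open>r\<close>-set extends to at least one \<open>k\<close>-set.\<close>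

lemma choose_le_choose:
  assumes "r \<le> k" "k \<le> n"
  shows "n choose r \<le> (n choose k) * (k choose r)"
proof -
  have "(n choose k) * (k choose r) = (n choose r) * ((n - r) choose (k - r))"
    using choose_mult[OF assms] .
  moreover have "(n - r) choose (k - r) \<ge> 1" using assms by (simp add: Suc_le_eq zero_less_binomial_iff)
  ultimately show ?thesis by simp
qed

text \<open>Summing over the sizes below \<open>k\<close> produces a row of Pascal's triangle.
  Storing all short lists thus costs only a factor \<open>2 ^ k\<close>, which the e^k of the time
  bound covers.\<close>

lemma length_ents_le:
  assumes "1 \<le> k" "k \<le> n"
  shows "length (ents k n) \<le> 2 ^ k * (n choose k)"
proof -
  have "length (ents k n) = card (set (ents k n))"
    using distinct_ents[OF assms(1)] by (simp add: distinct_card)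
  also have "\<dots> = card (set ` set (ents k n))"
    unfolding set_ents[OF assms(1)] by (intro card_image[symmetric] inj_on_set_decreasing)
  also have "set ` set (ents k n) = {S. S \<subseteq> {1..n} \<and> card S < k}"
    unfolding set_ents[OF assms(1)] by (rule set_image_decreasing[where R = "\<lambda>c. c < k"])
  also have "\<dots> = (\<Union>r<k. {S. S \<subseteq> {1..n} \<and> card S = r})" by auto
  also have "card \<dots> \<le> (\<Sum>r<k. card {S. S \<subseteq> {1..n} \<and> card S = r})"
    by (rule card_UN_le) simp
  also have "\<dots> = (\<Sum>r<k. n choose r)" by (simp add: n_subsets)
  also have "\<dots> \<le> (\<Sum>r<k. (n choose k) * (k choose r))"
    using assms by (intro sum_mono choose_le_choose) auto
  also have "\<dots> \<le> (\<Sum>r\<le>k. (n choose k) * (k choose r))"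
    by (intro sum_mono2) auto
  also have "\<dots> = (n choose k) * 2 ^ k"
    by (simp add: sum_distrib_left[symmetric] choose_row_sum)
  finally show ?thesis by (simp add: mult.commute)
qed

lemma ents_mono: "x \<le> y \<Longrightarrow> length (ents k x) \<le> length (ents k y)"
  by (induction y rule: dec_induct) auto

lemma leaves_mono: "x \<le> y \<Longrightarrow> length (leaves k x) \<le> length (leaves k y)"
  by (induction y rule: dec_induct) auto

text \<open>
  If the values of a uniformly random extension of \<open>f\<close> are already fixed on \<open>A \<subseteq> S\<close> with
  \<open>card S = k\<close>, then \<open>hits k f A / k ^ k\<close> is the conditional probability that it is one-to-one
  on \<open>S\<close>.
\<close>

definition hits :: "nat \<Rightarrow> (nat \<Rightarrow> nat) \<Rightarrow> nat set \<Rightarrow> nat" where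
  "hits k f A = (if inj_on f A then fact (k - card A) * k ^ card A else 0)"

lemma hits_empty [simp]: "hits k f {} = fact k"
  by (simp add: hits_def)

lemma hits_cong: "(\<And>x. x \<in> A \<Longrightarrow> f x = g x) \<Longrightarrow> hits k f A = hits k g A"
  unfolding hits_def by (simp cong: inj_on_cong)

lemma hits_full: "card S = k \<Longrightarrow> hits k f S = (if inj_on f S then k ^ k else 0)"
  by (simp add: hits_def)

lemma fact_mult_power_le: "r \<le> k \<Longrightarrow> fact (k - r) * k ^ r \<le> (k ^ k :: nat)"
proof -
  assume r: "r \<le> k"
  have "fact (k - r) \<le> ((k - r) ^ (k - r) :: nat)" using fact_le_power[of "k - r", where 'a = nat] by simp
  also have "\<dots> \<le> k ^ (k - r)" by (intro power_mono) auto
  finally have "fact (k - r) * k ^ r \<le> k ^ (k - r) * k ^ r" by (rule mult_le_mono1)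
  then show ?thesis using r by (simp add: power_add[symmetric])
qed

lemma hits_le: "card A \<le> k \<Longrightarrow> hits k f A \<le> k ^ k"
  unfolding hits_def using fact_mult_power_le by simp

text \<open>A still random value at \<open>x\<close> is new with probability (k - card A) / k, and
  conditioning on a new value divides by this. The division is exact because
  \<open>k - card A\<close> divides its own factorial. The case distinction is the one that the
  program makes.\<close>

lemma hits_insert_step:
  assumes "finite A" "x \<notin> A" "card A < k"
  shows "hits k f (insert x A) =
    (if f x \<in> f ` A then 0 else if inj_on f A then hits k f A * k div (k - card A) else 0)"
proof (cases "inj_on f A \<and> f x \<notin> f ` A")
  case True
  have "k - card A = Suc (k - Suc (card A))" using assms(3) by simp
  then have "fact (k - card A) = (k - card A) * fact (k - Suc (card A))"
    by (metis fact_Suc of_nat_id)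
  then have "hits k f A * k = (k - card A) * (fact (k - Suc (card A)) * k ^ Suc (card A))"
    using True by (simp add: hits_def mult_ac)
  then have "hits k f A * k div (k - card A) = fact (k - Suc (card A)) * k ^ Suc (card A)"
    using assms(3) by simp
  moreover have "hits k f (insert x A) = fact (k - Suc (card A)) * k ^ Suc (card A)"
    using True assms by (auto simp: hits_def)
  ultimately show ?thesis using True by simp
next
  case False
  have "\<not> inj_on f (insert x A)" using False assms(2) by (auto simp: inj_on_insert)
  then have "hits k f (insert x A) = 0" by (simp only: hits_def if_False)
  then show ?thesis using False by auto
qed

text \<open>The law of total probability: if \<open>f\<close> is one-to-one on \<open>A\<close>,
  exactly k - card A of the k values are new, and each of them raises the probability by the factor
  k / (k - card A).\<close>

lemma sum_hits_insert:
  assumes "finite A" "x \<notin> A" "card A < k" "f ` A \<subseteq> {1..k}"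
  shows "(\<Sum>v=1..k. hits k (f(x := v)) (insert x A)) = k * hits k f A"
proof -
  have same: "(f(x := v)) ` A = f ` A" "inj_on (f(x := v)) A = inj_on f A"
    "hits k (f(x := v)) A = hits k f A" for v
    using assms(2) by (auto intro!: image_cong inj_on_cong hits_cong)
  show ?thesis
  proof (cases "inj_on f A")
    case False
    then have "hits k (f(x := v)) (insert x A) = 0" for v
      using assms by (simp add: hits_insert_step same)
    then show ?thesis using False by (simp add: hits_def)
  next
    case True
    have e: "A \<inter> {y. y \<noteq> x} = A" using assms(2) by auto
    have c: "card ({1..k} - f ` A) = k - card A"
      using assms card_image[OF True] by (subst card_Diff_subset) auto
    have d: "k - card A dvd hits k f A * k"
    proof -
      have "k - card A dvd (fact (k - card A) :: nat)" using assms(3) by (intro dvd_fact) auto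
      then show ?thesis using True by (auto simp: hits_def intro!: dvd_mult2)
    qed
    have "(\<Sum>v=1..k. hits k (f(x := v)) (insert x A)) =
      (\<Sum>v=1..k. if v \<in> {1..k} - f ` A then hits k f A * k div (k - card A) else 0)"
      by (intro sum.cong refl) (use True assms e in \<open>auto simp: hits_insert_step same\<close>)
    also have "\<dots> = (\<Sum>v\<in>{1..k} - f ` A. hits k f A * k div (k - card A))"
      by (intro sum.mono_neutral_cong_right) auto
    also have "\<dots> = (k - card A) * (hits k f A * k div (k - card A))" using c by simp
    also have "\<dots> = hits k f A * k" using d by simp
    finally show ?thesis by (simp add: mult.commute)
  qed
qed

text \<open>As positions are treated in increasing order, this is the part of \<open>S\<close> whose
  values are fixed after position \<open>i\<close>.\<close>

definition below :: "nat set \<Rightarrow> nat \<Rightarrow> nat set" where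
  "below S i = {x \<in> S. x \<le> i}"

lemma below_Suc: "below S (Suc i) = (if Suc i \<in> S then insert (Suc i) (below S i) else below S i)"
  by (auto simp: below_def le_Suc_eq)

text \<open>A position outside \<open>S\<close> does not influence the probability, so only a member
  of \<open>S\<close> needs the averaging argument.\<close>

lemma sum_hits_below:
  assumes "finite S" "card S \<le> k" "\<And>x. x \<in> below S i \<Longrightarrow> f x \<in> {1..k}"
  shows "(\<Sum>v=1..k. hits k (f(Suc i := v)) (below S (Suc i))) = k * hits k f (below S i)"
proof (cases "Suc i \<in> S")
  case True
  have "below S i \<subset> S" using True unfolding below_def by force
  then have "card (below S i) < k" using assms psubset_card_mono[of S "below S i"] by simp
  moreover have "finite (below S i)" using assms(1) by (simp add: below_def)
  ultimately have "(\<Sum>v=1..k. hits k (f(Suc i := v)) (insert (Suc i) (below S i))) =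
      k * hits k f (below S i)"
    using assms(3) by (intro sum_hits_insert) (auto simp: below_def)
  then show ?thesis using True by (simp add: below_Suc)
next
  case False
  then have "hits k (f(Suc i := v)) (below S i) = hits k f (below S i)" for v
    by (intro hits_cong) (auto simp: below_def)
  then have "hits k (f(Suc i := v)) (below S (Suc i)) = hits k f (below S i)" for v
    using False by (simp add: below_Suc)
  then show ?thesis by simp
qed

section \<open>Multiplicative weights\<close>

text \<open>
  Up to a positive factor and an additive constant, \<open>score\<close> is the negated conditional expectation
  of the total weight after the current round, given the values of \<open>f\<close> on \<open>{1..i}\<close>.  It is written
  without negative terms and has to be maximised.
\<close>

definition score ::
  "nat \<Rightarrow> nat list list \<Rightarrow> (nat \<Rightarrow> nat) \<Rightarrow> (nat \<Rightarrow> nat) \<Rightarrow> (nat \<Rightarrow> nat) \<Rightarrow> nat \<Rightarrow> nat" where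
  "score k Ls u l f i = (\<Sum>j<length Ls.
     u j * (k ^ k - hits k f (below (set (Ls ! j)) i)) + l j * hits k f (below (set (Ls ! j)) i))"

text \<open>Serves the case i = 0, where no value is fixed yet and all functions have the same
  score. The lists must avoid 0 because functions are compared from position 1 on only.\<close>

lemma score_cong: "(\<And>x. 1 \<le> x \<Longrightarrow> x \<le> i \<Longrightarrow> f x = g x) \<Longrightarrow> (\<And>xs. xs \<in> set Ls \<Longrightarrow> 0 \<notin> set xs) \<Longrightarrow>
  score k Ls u l f i = score k Ls u l g i"
  unfolding score_def
proof (intro sum.cong refl, goal_cases)
  case (1 j)
  then have "0 \<notin> set (Ls ! j)" by simp
  then have "\<And>x. x \<in> below (set (Ls ! j)) i \<Longrightarrow> f x = g x"
    using 1(1) by (auto simp: below_def) (metis One_nat_def Suc_leI gr0I)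
  then have "hits k f (below (set (Ls ! j)) i) = hits k g (below (set (Ls ! j)) i)"
    by (rule hits_cong)
  then show ?case by simp
qed

lemma card_below_le: "finite S \<Longrightarrow> card (below S i) \<le> card S"
  by (intro card_mono) (auto simp: below_def)

text \<open>The score is affine in the numbers \<open>hits\<close> and inherits their averaging
  property. As \<open>hits\<close> never exceeds \<open>k ^ k\<close>, the truncated subtraction is
  exact.\<close>

lemma sum_score:
  assumes "\<And>xs. xs \<in> set Ls \<Longrightarrow> length xs = k"
    and "\<And>xs. xs \<in> set Ls \<Longrightarrow> 0 \<notin> set xs"
    and "\<And>x. 1 \<le> x \<Longrightarrow> x \<le> i \<Longrightarrow> f x \<in> {1..k}"
  shows "(\<Sum>v=1..k. score k Ls u l (f(Suc i := v)) (Suc i)) = k * score k Ls u l f i"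
proof -
  have "(\<Sum>v=1..k. u j * (k ^ k - hits k (f(Suc i := v)) (below (set (Ls ! j)) (Suc i))) +
      l j * hits k (f(Suc i := v)) (below (set (Ls ! j)) (Suc i))) =
    k * (u j * (k ^ k - hits k f (below (set (Ls ! j)) i)) + l j * hits k f (below (set (Ls ! j)) i))"
    if "j < length Ls" for j
  proof -
    let ?S = "set (Ls ! j)"
    let ?h = "\<lambda>v. hits k (f(Suc i := v)) (below ?S (Suc i))"
    have mem: "Ls ! j \<in> set Ls" using that by simp
    have c: "card ?S \<le> k" using assms(1)[OF mem] card_length[of "Ls ! j"] by simp
    have "f x \<in> {1..k}" if "x \<in> below ?S i" for x
      using that assms(2)[OF mem] assms(3)[of x] by (cases "x = 0") (auto simp: below_def)
    then have s: "(\<Sum>v=1..k. ?h v) = k * hits k f (below ?S i)"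
      using c by (intro sum_hits_below) auto
    have le: "?h v \<le> k ^ k" for v
      using card_below_le[of ?S "Suc i"] c by (intro hits_le) auto
    have "(\<Sum>v=1..k. k ^ k - ?h v) = (\<Sum>v=1..k. k ^ k) - (\<Sum>v=1..k. ?h v)"
      by (rule sum_subtractf_nat) (rule le)
    also have "\<dots> = k * (k ^ k - hits k f (below ?S i))"
      unfolding s by (simp add: diff_mult_distrib2)
    finally show ?thesis
      unfolding sum.distrib sum_distrib_left[symmetric] s by (simp add: algebra_simps)
  qed
  then show ?thesis
    unfolding score_def by (subst sum.swap) (simp add: sum_distrib_left)
qed

text \<open>The step of the method of conditional expectations: the current score is the average
  over the k possible next values, so it cannot exceed a bound on all of them.\<close>

lemma score_le_max:
  assumes "\<And>xs. xs \<in> set Ls \<Longrightarrow> length xs = k"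
    and "\<And>xs. xs \<in> set Ls \<Longrightarrow> 0 \<notin> set xs"
    and "\<And>x. 1 \<le> x \<Longrightarrow> x \<le> i \<Longrightarrow> f x \<in> {1..k}" and "1 \<le> k"
    and max: "\<And>v. 1 \<le> v \<Longrightarrow> v \<le> k \<Longrightarrow> score k Ls u l (f(Suc i := v)) (Suc i) \<le> best"
  shows "score k Ls u l f i \<le> best"
proof -
  have "k * score k Ls u l f i = (\<Sum>v=1..k. score k Ls u l (f(Suc i := v)) (Suc i))"
    using sum_score[OF assms(1-3)] by simp
  also have "\<dots> \<le> (\<Sum>v=1..k. best)" by (intro sum_mono max) auto
  also have "\<dots> = k * best" by simp
  finally show ?thesis using assms(4) by simp
qed

lemma score_le:
  assumes "\<And>xs. xs \<in> set Ls \<Longrightarrow> length xs = k"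
  shows "score k Ls u l f i \<le> k ^ k * (\<Sum>j<length Ls. u j + l j)"
  unfolding score_def sum_distrib_left
proof (rule sum_mono)
  fix j assume "j \<in> {..<length Ls}"
  then have "card (set (Ls ! j)) \<le> k" using assms card_length[of "Ls ! j"] by auto
  then have "hits k f (below (set (Ls ! j)) i) \<le> k ^ k" (is "?h \<le> _")
    using card_below_le[of "set (Ls ! j)" i] by (intro hits_le) auto
  then have "u j * (k ^ k - ?h) + l j * ?h \<le> u j * k ^ k + l j * k ^ k"
    by (intro add_mono mult_le_mono) auto
  then show "u j * (k ^ k - ?h) + l j * ?h \<le> k ^ k * (u j + l j)" by (simp add: algebra_simps)
qed

text \<open>Floor plus one rounds upwards with a single division and exceeds the exact value
  \<open>u * d / D\<close> by at most 1.\<close>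

definition next_weight :: "nat \<Rightarrow> nat \<Rightarrow> nat \<Rightarrow> nat" where
  "next_weight D d u = u * d div D + 1"

lemma next_weight_bounds:
  assumes "0 < D"
  shows "real u * real d / real D \<le> real (next_weight D d u)"
    "real (next_weight D d u) \<le> real u * real d / real D + 1"
proof -
  have "real (u * d) / real D < real (u * d div D) + 1"
  proof -
    have "u * d < D + D * (u * d div D)" using assms by (rule dividend_less_times_div)
    then have "real (u * d) < real (D + D * (u * d div D))" by (simp only: of_nat_less_iff)
    then show ?thesis using assms by (simp add: field_simps)
  qed
  then show "real u * real d / real D \<le> real (next_weight D d u)"
    by (simp add: next_weight_def)
  show "real (next_weight D d u) \<le> real u * real d / real D + 1"
    using of_nat_div_le_of_nat[of "u * d" D, where 'a = real] by (simp add: next_weight_def)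
qed

text \<open>Here \<open>h j / q\<close> is the outcome Y and \<open>P / q\<close> the probability p.
  Without rounding, the total changes by the sum of (u j - l j) (h j - P), divided by q E. This sum
  is the left side of the last hypothesis minus its right side, so it is not positive. The two
  roundings per index add at most 2 N.\<close>

lemma sum_next_weight_le:
  fixes u l h :: "nat \<Rightarrow> nat" and q E P N :: nat
  assumes "0 < q" "1 \<le> E" "P \<le> q" "\<And>j. j < N \<Longrightarrow> h j \<le> q"
    and le: "(\<Sum>j<N. u j * (q - P) + l j * P) \<le> (\<Sum>j<N. u j * (q - h j) + l j * h j)"
  shows "(\<Sum>j<N. next_weight (q * E) (q * E + h j - P) (u j) +
      next_weight (q * E) (q * E + P - h j) (l j)) \<le> (\<Sum>j<N. u j + l j) + 2 * N"
proof -
  have qE: "q \<le> q * E" using assms(2) by simp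
  let ?D = "real (q * E)"
  have D: "0 < ?D" using assms(1,2) by simp
  have step: "real (next_weight (q * E) (q * E + h j - P) (u j) +
      next_weight (q * E) (q * E + P - h j) (l j)) \<le>
    real (u j + l j) + 2 + ((real (u j) - real (l j)) * (real (h j) - real P)) / ?D"
    if "j < N" for j
  proof -
    have "real (q * E + h j - P) = ?D + real (h j) - real P"
      "real (q * E + P - h j) = ?D + real P - real (h j)"
    proof -
      have "P \<le> q * E + h j" "h j \<le> q * E + P" using qE assms(3) assms(4)[OF that] by linarith+
      then show "real (q * E + h j - P) = ?D + real (h j) - real P"
        "real (q * E + P - h j) = ?D + real P - real (h j)" by (simp_all add: of_nat_diff)
    qed
    then have "real (next_weight (q * E) (q * E + h j - P) (u j)) \<le>
        real (u j) * (?D + real (h j) - real P) / ?D + 1"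
      "real (next_weight (q * E) (q * E + P - h j) (l j)) \<le>
        real (l j) * (?D + real P - real (h j)) / ?D + 1"
      using next_weight_bounds(2)[of "q * E"] D by (metis of_nat_0_less_iff)+
    moreover have "real (u j) * (?D + real (h j) - real P) / ?D +
        real (l j) * (?D + real P - real (h j)) / ?D =
      real (u j + l j) + ((real (u j) - real (l j)) * (real (h j) - real P)) / ?D"
    proof -
      have "real (u j) * (?D + real (h j) - real P) + real (l j) * (?D + real P - real (h j)) =
        real (u j + l j) * ?D + (real (u j) - real (l j)) * (real (h j) - real P)"
        by (simp add: algebra_simps)
      moreover have D0: "?D \<noteq> 0" using D by linarith
      ultimately show ?thesis
        by (simp only: add_divide_distrib[symmetric])
          (simp only: add_divide_distrib nonzero_mult_div_cancel_right[OF D0])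
    qed
    ultimately show ?thesis by simp
  qed
  have "(\<Sum>j<N. (real (u j) - real (l j)) * (real (h j) - real P)) =
    real (\<Sum>j<N. u j * (q - P) + l j * P) - real (\<Sum>j<N. u j * (q - h j) + l j * h j)"
    unfolding of_nat_sum sum_subtractf[symmetric]
  proof (intro sum.cong refl)
    fix j assume "j \<in> {..<N}"
    then have "real (q - P) = real q - real P" "real (q - h j) = real q - real (h j)"
      using assms(3,4) by (simp_all add: of_nat_diff)
    then show "(real (u j) - real (l j)) * (real (h j) - real P) =
        real (u j * (q - P) + l j * P) - real (u j * (q - h j) + l j * h j)"
      unfolding of_nat_add of_nat_mult by (simp add: algebra_simps)
  qed
  then have neg: "(\<Sum>j<N. (real (u j) - real (l j)) * (real (h j) - real P)) \<le> 0"
    using le by (simp only: of_nat_le_iff diff_le_0_iff_le)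
  have "real (\<Sum>j<N. next_weight (q * E) (q * E + h j - P) (u j) +
      next_weight (q * E) (q * E + P - h j) (l j)) \<le>
    (\<Sum>j<N. real (u j + l j) + 2 + ((real (u j) - real (l j)) * (real (h j) - real P)) / ?D)"
    unfolding of_nat_sum by (intro sum_mono step) simp
  also have "\<dots> = real ((\<Sum>j<N. u j + l j) + 2 * N) +
      (\<Sum>j<N. (real (u j) - real (l j)) * (real (h j) - real P)) / ?D"
    by (simp add: sum.distrib sum_divide_distrib)
  also have "\<dots> \<le> real ((\<Sum>j<N. u j + l j) + 2 * N)"
    using neg D by (simp add: divide_nonpos_pos)
  finally show ?thesis by (simp only: of_nat_le_iff)
qed

section \<open>Concentration of the number of one-to-one functions from bounded weights\<close>

definition trend :: "real \<Rightarrow> real \<Rightarrow> nat set \<Rightarrow> (nat \<Rightarrow> nat) list \<Rightarrow> real" where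
  "trend \<epsilon> p S fs = (\<Prod>f\<leftarrow>fs. 1 + \<epsilon> * ((if inj_on f S then 1 else 0) - p))"

lemma trend_simps [simp]:
  "trend \<epsilon> p S [] = 1"
  "trend \<epsilon> p S (fs @ [f]) = trend \<epsilon> p S fs * (1 + \<epsilon> * ((if inj_on f S then 1 else 0) - p))"
  by (simp_all add: trend_def)

lemma exp_le_one_plus:
  fixes z :: real
  assumes "\<bar>z\<bar> \<le> 1 / 2"
  shows "exp (z - 2 * z\<^sup>2) \<le> 1 + z"
proof -
  have "z - 2 * z\<^sup>2 \<le> ln (1 + z)"
    using abs_ln_one_plus_x_minus_x_bound[OF assms] by linarith
  then show ?thesis using assms by (subst (asm) ln_ge_iff) auto
qed

text \<open>\<open>trend\<close> is the growth of a weight without rounding, where a negative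
  \<epsilon> belongs to the low weight. Each factor 1 + z with z = \<epsilon> (Y - p) is at least
  exp (z - 2 z^2), and (Y - p)^2 <= Y + p because Y is 0 or 1. Summed up, Y + p gives the count plus
  its expectation, which is much less than the number of rounds when p is small.\<close>

lemma trend_ge:
  fixes p :: real and S :: "nat set"
  assumes "\<bar>\<epsilon>\<bar> \<le> 1 / 2" "0 \<le> p" "p \<le> 1"
  defines "X fs \<equiv> real (length (filter (\<lambda>f. inj_on f S) fs))"
  shows "exp (\<epsilon> * (X fs - p * length fs) - 2 * \<epsilon>\<^sup>2 * (X fs + p * length fs)) \<le> trend \<epsilon> p S fs"
proof (induction fs rule: rev_induct)
  case (snoc f fs)
  define Y :: real where "Y = (if inj_on f S then 1 else 0)"
  have Y: "(Y - p)\<^sup>2 \<le> Y + p"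
  proof -
    have "p * p \<le> p" using assms(2,3) mult_left_le by blast
    moreover from this have "0 \<le> 3 * p - p * p" using assms(2) by linarith
    ultimately show ?thesis by (auto simp: Y_def power2_eq_square algebra_simps)
  qed
  have "\<bar>\<epsilon> * (Y - p)\<bar> \<le> 1 / 2 * 1"
    unfolding abs_mult using assms(1-3) by (intro mult_mono) (auto simp: Y_def)
  then have "exp (\<epsilon> * (Y - p) - 2 * (\<epsilon> * (Y - p))\<^sup>2) \<le> 1 + \<epsilon> * (Y - p)"
    by (intro exp_le_one_plus) simp
  moreover have "\<epsilon> * (Y - p) - 2 * \<epsilon>\<^sup>2 * (Y + p) \<le> \<epsilon> * (Y - p) - 2 * (\<epsilon> * (Y - p))\<^sup>2"
    using mult_left_mono[OF Y, of "2 * \<epsilon>\<^sup>2"] by (simp add: power_mult_distrib)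
  ultimately have step: "exp (\<epsilon> * (Y - p) - 2 * \<epsilon>\<^sup>2 * (Y + p)) \<le> 1 + \<epsilon> * (Y - p)"
    by (meson exp_le_cancel_iff order_trans)
  have X: "X (fs @ [f]) = X fs + Y" by (simp add: X_def Y_def)
  have "exp (\<epsilon> * (X (fs @ [f]) - p * length (fs @ [f])) -
      2 * \<epsilon>\<^sup>2 * (X (fs @ [f]) + p * length (fs @ [f]))) =
    exp (\<epsilon> * (X fs - p * length fs) - 2 * \<epsilon>\<^sup>2 * (X fs + p * length fs)) *
    exp (\<epsilon> * (Y - p) - 2 * \<epsilon>\<^sup>2 * (Y + p))"
    unfolding X exp_add[symmetric] by (simp add: algebra_simps)
  also have "\<dots> \<le> trend \<epsilon> p S fs * (1 + \<epsilon> * (Y - p))"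
    using snoc step by (intro mult_mono) (auto intro: order_trans[OF exp_ge_zero])
  finally show ?case by (simp add: Y_def)
qed (simp add: X_def)

text \<open>With e = 1 / E and T = p * \<open>length fs\<close>, logarithms of the two hypotheses on
  \<open>trend\<close> give X (1 - 2 e) <= T (1 + 3 e) and T (1 - 3 e) <= X (1 + 2 e). For e <= 1 /
  8 both quotients are at most 1 + 8 e, the second with equality at e = 1 / 8. This is the origin of
  both occurrences of 8 in the hypotheses.\<close>

lemma trend_bounded_imp_balanced:
  fixes E :: nat and \<delta> p R :: real and S :: "nat set"
  assumes "8 \<le> E" "real E + 8 \<le> \<delta> * real E" "0 \<le> p" "p \<le> 1" "1 \<le> R"
    and T: "(real E)\<^sup>2 * ln R \<le> p * length fs"
    and up: "trend (1 / real E) p S fs \<le> R" and low: "trend (- 1 / real E) p S fs \<le> R"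
  defines "X \<equiv> real (length (filter (\<lambda>f. inj_on f S) fs))"
  shows "p * length fs / \<delta> \<le> X" "X \<le> \<delta> * (p * length fs)"
proof -
  define \<epsilon> where "\<epsilon> = 1 / real E"
  define T where "T = p * length fs"
  have E: "0 < real E" using assms(1) by simp
  have \<epsilon>: "0 < \<epsilon>" "\<epsilon> \<le> 1 / 8" using assms(1) by (auto simp: \<epsilon>_def field_simps)
  have \<delta>: "1 + 8 * \<epsilon> \<le> \<delta>" using assms(2) E by (simp add: \<epsilon>_def field_simps)
  have T0: "0 \<le> T" using assms(3) by (simp add: T_def)
  have X0: "0 \<le> X" by (simp add: X_def)
  have lnR: "ln R \<le> \<epsilon>\<^sup>2 * T"
  proof -
    have "\<epsilon>\<^sup>2 * ((real E)\<^sup>2 * ln R) \<le> \<epsilon>\<^sup>2 * T" using T by (intro mult_left_mono) (auto simp: T_def)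
    moreover have "\<epsilon>\<^sup>2 * ((real E)\<^sup>2 * ln R) = ln R" using E by (simp add: \<epsilon>_def power2_eq_square)
    ultimately show ?thesis by simp
  qed
  have key: "e * (X - T) - 2 * e\<^sup>2 * (X + T) \<le> \<epsilon>\<^sup>2 * T"
    if "trend e p S fs \<le> R" "\<bar>e\<bar> \<le> 1 / 2" for e
  proof -
    have "exp (e * (X - T) - 2 * e\<^sup>2 * (X + T)) \<le> R"
      using trend_ge[OF that(2) assms(3,4), where fs = fs and S = S] that(1) unfolding X_def T_def by simp
    then have "e * (X - T) - 2 * e\<^sup>2 * (X + T) \<le> ln R" using assms(5) by (simp add: ln_ge_iff)
    then show ?thesis using lnR by simp
  qed
  have "\<epsilon> * ((X - T) - 2 * \<epsilon> * (X + T)) \<le> \<epsilon> * (\<epsilon> * T)"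
    using key[of \<epsilon>] up \<epsilon> by (simp add: \<epsilon>_def[symmetric] power2_eq_square algebra_simps)
  then have "(X - T) - 2 * \<epsilon> * (X + T) \<le> \<epsilon> * T" using \<epsilon>(1) by (simp only: mult_le_cancel_left_pos)
  then have "X * (1 - 2 * \<epsilon>) \<le> T * (1 + 3 * \<epsilon>)" by (simp add: algebra_simps)
  also have "\<dots> \<le> T * ((1 - 2 * \<epsilon>) * (1 + 8 * \<epsilon>))"
  proof (rule mult_left_mono[OF _ T0])
    have "\<epsilon> * (16 * \<epsilon>) \<le> \<epsilon> * 3" using \<epsilon> by (intro mult_left_mono) auto
    then show "1 + 3 * \<epsilon> \<le> (1 - 2 * \<epsilon>) * (1 + 8 * \<epsilon>)" by (simp add: algebra_simps)
  qed
  also have "\<dots> = T * (1 + 8 * \<epsilon>) * (1 - 2 * \<epsilon>)" by simp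
  finally have "X \<le> T * (1 + 8 * \<epsilon>)" using \<epsilon> by (simp add: mult_le_cancel_right)
  also have "\<dots> \<le> \<delta> * T" using \<delta> T0 by (simp add: mult.commute mult_left_mono)
  finally show "X \<le> \<delta> * (p * length fs)" by (simp add: T_def)
  have "\<epsilon> * ((T - X) - 2 * \<epsilon> * (X + T)) \<le> \<epsilon> * (\<epsilon> * T)"
    using key[of "- \<epsilon>"] low \<epsilon> by (simp add: \<epsilon>_def[symmetric] power2_eq_square algebra_simps)
  then have "(T - X) - 2 * \<epsilon> * (X + T) \<le> \<epsilon> * T" using \<epsilon>(1) by (simp only: mult_le_cancel_left_pos)
  then have "T * (1 - 3 * \<epsilon>) \<le> X * (1 + 2 * \<epsilon>)" by (simp add: algebra_simps)
  also have "\<dots> \<le> X * ((1 - 3 * \<epsilon>) * (1 + 8 * \<epsilon>))"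
  proof (rule mult_left_mono[OF _ X0])
    have "\<epsilon> * (24 * \<epsilon>) \<le> \<epsilon> * 3" using \<epsilon> by (intro mult_left_mono) auto
    then show "1 + 2 * \<epsilon> \<le> (1 - 3 * \<epsilon>) * (1 + 8 * \<epsilon>)" by (simp add: algebra_simps)
  qed
  also have "\<dots> = X * (1 + 8 * \<epsilon>) * (1 - 3 * \<epsilon>)" by simp
  finally have "T \<le> X * (1 + 8 * \<epsilon>)" using \<epsilon> by (simp add: mult_le_cancel_right)
  also have "\<dots> \<le> X * \<delta>" using \<delta> X0 by (simp add: mult_left_mono)
  finally show "p * length fs / \<delta> \<le> X" using \<delta> \<epsilon> by (simp add: T_def divide_le_eq)
qed

section \<open>A lower bound for the factorial of Stirling type\<close>

lemma ln_one_plus_le: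
  fixes x :: real
  assumes "0 \<le> x"
  shows "ln (1 + x) \<le> (1 + x) / 2 - inverse (1 + x) / 2"
proof -
  \<comment> \<open>With s = 1 + x the claim reads ln s <= (s - 1 / s) / 2. The difference of the
    two sides vanishes at s = 1 and has the derivative (1 - 1 / s)^2 / 2.\<close>
  define g :: "real \<Rightarrow> real" where "g = (\<lambda>y. (1 + y) / 2 - inverse (1 + y) / 2 - ln (1 + y))"
  have sq: "1 / 2 - (- (z * 1 * z)) / 2 - z * 1 = (1 - z)\<^sup>2 / 2" for z :: real
    by (simp add: power2_eq_square algebra_simps)
  have "g 0 \<le> g x"
  proof (rule DERIV_nonneg_imp_nondecreasing[where f = g])
    fix y assume y: "0 \<le> y" "y \<le> x"
    have "(g has_real_derivative
        1 / 2 - (- (inverse (1 + y) * 1 * inverse (1 + y))) / 2 - 1 / (1 + y) * 1) (at y)"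
      unfolding g_def
      using y(1) by (intro derivative_intros) (auto intro!: derivative_eq_intros)
    then have "(g has_real_derivative (1 - inverse (1 + y))\<^sup>2 / 2) (at y)"
      using sq[of "inverse (1 + y)"] by (simp only: inverse_eq_divide)
    then show "\<exists>d. (g has_real_derivative d) (at y) \<and> 0 \<le> d" by fastforce
  qed (use assms in simp)
  then show ?thesis by (simp add: g_def)
qed

text \<open>The correction term \<open>1 / (4 * k)\<close> makes the induction go through.\<close>

lemma ln_fact_ge:
  assumes "1 \<le> k"
  shows "(real k + 1 / 2) * ln (real k) - real k + 3 / 4 + 1 / (4 * real k) \<le> ln (fact k)"
  using assms
\<comment> \<open>Both sides vanish at k = 1, which fixes the constant 3 / 4.\<close>
proof (induction k rule: dec_induct)
  case (step k)
  then have k: "0 < real k" by simp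
  define x where "x = 1 / real k"
  have x: "0 < x" using k by (simp add: x_def)
  have lnx: "ln (1 + x) \<le> x * (x + 2) / (2 * (x + 1))"
    using ln_one_plus_le[of x] x by (simp add: field_simps)
  have "(real k + 1 / 2) * ln (1 + x) \<le> (real k + 1 / 2) * (x * (x + 2) / (2 * (x + 1)))"
    using lnx by (intro mult_left_mono) auto
  \<comment> \<open>For x = 1 / k the excess over 1 is exactly the decrease of the correction term
    from k to k + 1.\<close>
  also have "\<dots> = 1 + (1 / (4 * real k) - 1 / (4 * (real k + 1)))"
  proof -
    have "(K + 1 / 2) * (1 / K * (1 / K + 2) / (2 * (1 / K + 1))) =
        1 + (1 / (4 * K) - 1 / (4 * (K + 1)))" if K: "0 < K" for K :: real
    proof -
      have "1 / K * (1 / K + 2) / (2 * (1 / K + 1)) = (2 * K + 1) / (2 * K * (K + 1))"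
        using K by (simp add: divide_simps) (simp add: algebra_simps)
      then show ?thesis using K by (simp add: divide_simps) (simp add: algebra_simps)
    qed
    from this[OF k] show ?thesis by (simp only: x_def)
  qed
  finally have d: "(real k + 1 / 2) * ln (1 + x) + 1 / (4 * (real k + 1)) \<le> 1 + 1 / (4 * real k)"
    by simp
  have "ln (real (Suc k)) = ln (real k) + ln (1 + x)"
  proof -
    have "real (Suc k) = real k * (1 + x)" using k by (simp add: x_def field_simps)
    then show ?thesis using k x by (simp add: ln_mult)
  qed
  then have "(real k + 1 / 2) * ln (real (Suc k)) = (real k + 1 / 2) * ln (real k) + (real k + 1 / 2) * ln (1 + x)"
    by (simp add: algebra_simps)
  moreover have "ln (fact (Suc k) :: real) = ln (real (Suc k)) + ln (fact k)"
    unfolding fact_Suc by (subst ln_mult) auto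
  ultimately show ?case using step.IH d by (simp add: algebra_simps)
qed simp

text \<open>Stirling's formula up to a constant factor, read as an upper bound on 1 / p. The
  positive constants of \<open>ln_fact_ge\<close> are dropped.\<close>

lemma power_div_fact_le:
  assumes "1 \<le> k"
  shows "real k ^ k / fact k \<le> exp (real k) / sqrt (real k)"
proof -
  have k: "0 < real k" using assms by simp
  have "ln (real k ^ k * sqrt (real k)) = (real k + 1 / 2) * ln (real k)"
    using k by (simp add: ln_mult ln_realpow ln_sqrt algebra_simps)
  also have "\<dots> \<le> ln (fact k) + real k" 
    using ln_fact_ge[OF assms] k by (smt (verit) divide_nonneg_pos)
  also have "\<dots> = ln (fact k * exp (real k))" by (simp add: ln_mult)
  finally have "real k ^ k * sqrt (real k) \<le> fact k * exp (real k)"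
    using k by (subst (asm) ln_le_cancel_iff) auto
  then show ?thesis using k by (simp add: field_simps)
qed

section \<open>The program\<close>

definition frame :: "nat set \<Rightarrow> memory \<Rightarrow> memory \<Rightarrow> bool" where
  "frame X m m' \<longleftrightarrow> (\<forall>a. a \<notin> X \<longrightarrow> m' a = m a)"

lemma frameD: "frame X m m' \<Longrightarrow> a \<notin> X \<Longrightarrow> m' a = m a"
  by (simp add: frame_def)

lemma frame_refl [simp]: "frame X m m"
  by (simp add: frame_def)

lemma frame_trans: "frame X m m' \<Longrightarrow> frame Y m' m'' \<Longrightarrow> X \<subseteq> Z \<Longrightarrow> Y \<subseteq> Z \<Longrightarrow> frame Z m m''"
  unfolding frame_def by (metis subsetD)

lemma frame_upd: "frame X m m' \<Longrightarrow> a \<in> X \<Longrightarrow> frame X m (m'(a := v))"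
  by (auto simp: frame_def)

lemma arr_mem_range [simp]:
  "r < 8 \<Longrightarrow> r' < 8 \<Longrightarrow> arr r j \<in> range (arr r') \<longleftrightarrow> r = r'"
  by auto

lemma scalar_notin_range [simp]: "x < 32 \<Longrightarrow> x \<notin> range (arr r)"
  by (auto simp: image_iff)

text \<open>
  The cells 20 to 31 hold parameters that no longer change once the subsets have been enumerated;
  the cells 2 to 14 are working storage.
\<close>

abbreviation (input) vt :: nat where "vt \<equiv> 2"
abbreviation (input) vi :: nat where "vi \<equiv> 3"
abbreviation (input) vv :: nat where "vv \<equiv> 4"
abbreviation (input) vj :: nat where "vj \<equiv> 5"
abbreviation (input) vc :: nat where "vc \<equiv> 6"
abbreviation (input) vh :: nat where "vh \<equiv> 7"
abbreviation (input) vr :: nat where "vr \<equiv> 8"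
abbreviation (input) vx :: nat where "vx \<equiv> 9"
abbreviation (input) vy :: nat where "vy \<equiv> 10"
abbreviation (input) vacc :: nat where "vacc \<equiv> 11"
abbreviation (input) vbest :: nat where "vbest \<equiv> 12"
abbreviation (input) varg :: nat where "varg \<equiv> 13"
abbreviation (input) vcnt0 :: nat where "vcnt0 \<equiv> 14"
abbreviation (input) vn :: nat where "vn \<equiv> 20"
abbreviation (input) vk :: nat where "vk \<equiv> 21"
abbreviation (input) vb :: nat where "vb \<equiv> 22"
abbreviation (input) vE :: nat where "vE \<equiv> 23"
abbreviation (input) vP :: nat where "vP \<equiv> 24"
abbreviation (input) vq :: nat where "vq \<equiv> 25"
abbreviation (input) vM :: nat where "vM \<equiv> 26"
abbreviation (input) vN :: nat where "vN \<equiv> 27"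
abbreviation (input) vB :: nat where "vB \<equiv> 28"
abbreviation (input) vcnt :: nat where "vcnt \<equiv> 29"
abbreviation (input) vD :: nat where "vD \<equiv> 30"
abbreviation (input) vl :: nat where "vl \<equiv> 31"

abbreviation (input) aent :: nat where "aent \<equiv> 0"
abbreviation (input) aleaf :: nat where "aleaf \<equiv> 1"
abbreviation (input) aup :: nat where "aup \<equiv> 2"
abbreviation (input) alow :: nat where "alow \<equiv> 3"
abbreviation (input) afun :: nat where "afun \<equiv> 4"
abbreviation (input) aseen :: nat where "aseen \<equiv> 5"

abbreviation set_var :: "nat \<Rightarrow> expr \<Rightarrow> prog" where
  "set_var x e \<equiv> Assign (Const x) e"

abbreviation incr :: "nat \<Rightarrow> prog" where
  "incr x \<equiv> set_var x (Op Plus (Var x) (Const 1))"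

abbreviation get :: "nat \<Rightarrow> nat \<Rightarrow> expr" where
  "get r x \<equiv> Cell (Arr r (Var x))"

abbreviation seq :: "prog \<Rightarrow> prog \<Rightarrow> prog" (infixr ";;" 55) where
  "c1 ;; c2 \<equiv> Seq c1 c2"

text \<open>The cell \<open>vr\<close> holds the number of values not yet taken on the subset being decoded.\<close>

definition digit_prog :: prog where
  "digit_prog =
     set_var vx (Op Minus (Var vc) (Op Times (Op Divide (Var vc) (Var vb)) (Var vb))) ;;
     set_var vc (Op Divide (Var vc) (Var vb)) ;;
     If (Less (Var vi) (Var vx)) Skip
      (If (Less (Const 0) (Cell (Arr aseen (get afun vx))))
        (set_var vh (Const 0))
        (set_var vh (Op Divide (Op Times (Var vh) (Var vk)) (Var vr)) ;;
         set_var vr (Op Minus (Var vr) (Const 1))) ;;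
       Assign (Arr aseen (get afun vx)) (Const 1))"

text \<open>The code itself controls the loop: as no digit is zero, it becomes 0 only after all
  elements have been split off. The flags are cleared anew for each subset, and \<open>vh\<close>
  starts with k!, the value of \<open>hits\<close> on the empty set.\<close>

definition hits_prog :: prog where
  "hits_prog =
     set_var vy (Const 0) ;;
     While (Less (Var vy) (Var vk)) (incr vy ;; Assign (Arr aseen (Var vy)) (Const 0)) ;;
     (set_var vc (get aleaf vj) ;; set_var vr (Var vk) ;; set_var vh (Var vP)) ;;
     While (Less (Const 0) (Var vc)) digit_prog"

definition score_prog :: prog where
  "score_prog =
     (set_var vacc (Const 0) ;; set_var vj (Const 0)) ;;
     loop vj vN
       (hits_prog ;;
        set_var vacc (Op Plus (Var vacc)
          (Op Plus (Op Times (get aup vj) (Op Minus (Var vq) (Var vh)))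
             (Op Times (get alow vj) (Var vh)))) ;;
        incr vj)"

text \<open>Candidates are tried in place in the function table. A tie replaces the best value found
  so far; in particular the first candidate always replaces the initial 0, so that
  \<open>varg\<close> is set in any case.\<close>

definition choose_prog :: prog where
  "choose_prog =
     (incr vi ;; set_var vbest (Const 0) ;; set_var vv (Const 0)) ;;
     loop vv vk
       ((incr vv ;; Assign (Arr afun (Var vi)) (Var vv)) ;;
        score_prog ;;
        If (Less (Var vacc) (Var vbest)) Skip
          (set_var vbest (Var vacc) ;; set_var varg (Var vv))) ;;
     Assign (Arr afun (Var vi)) (Var varg) ;;
     Write (Var varg)"

text \<open>\<open>hits_prog\<close> takes the number of fixed positions from \<open>vi\<close>,
  which still equals n after the last choice. Hence \<open>vh\<close> becomes \<open>k ^ k\<close>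
  or 0 according to the outcome of the round.\<close>

definition update_prog :: prog where
  "update_prog =
     set_var vj (Const 0) ;;
     loop vj vN
       (hits_prog ;;
        Assign (Arr aup (Var vj)) (Op Plus (Op Divide
          (Op Times (get aup vj) (Op Minus (Op Plus (Var vD) (Var vh)) (Var vP))) (Var vD)) (Const 1)) ;;
        Assign (Arr alow (Var vj)) (Op Plus (Op Divide
          (Op Times (get alow vj) (Op Minus (Op Plus (Var vD) (Var vP)) (Var vh))) (Var vD)) (Const 1)) ;;
        incr vj)"

definition rounds_prog :: prog where
  "rounds_prog =
     set_var vt (Const 0) ;;
     loop vt vM
       (set_var vi (Const 0) ;; loop vi vn choose_prog ;; update_prog ;; incr vt)"

definition gen_step :: prog where
  "gen_step =
     set_var vx (Op Plus (Op Times (get aent vj) (Var vb)) (Var vi)) ;;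
     If (Less (Var vx) (Var vB))
       (Assign (Arr aent (Var vcnt)) (Var vx) ;; incr vcnt)
       (Assign (Arr aleaf (Var vN)) (Var vx) ;; Assign (Arr aup (Var vN)) (Var vM) ;;
        Assign (Arr alow (Var vN)) (Var vM) ;; incr vN) ;;
     incr vj"

text \<open>\<open>vcnt0\<close> freezes the number of entries at the beginning of a round, so that
  lists created with the current element are not extended by it once more.\<close>

definition gen_prog :: prog where
  "gen_prog =
     (Assign (Arr aent (Const 0)) (Const 0) ;; set_var vcnt (Const 1) ;; set_var vN (Const 0) ;;
      set_var vi (Const 0)) ;;
     loop vi vn
       ((incr vi ;; set_var vcnt0 (Var vcnt) ;; set_var vj (Const 0)) ;; loop vj vcnt0 gen_step)"

text \<open>The linear search for E takes O(1 / (\<delta> - 1)) steps, well within the time bound.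
  The doubling loop leaves in \<open>vl\<close> the number 2 + k a, an upper bound for the binary
  logarithm of 4 (n choose k).\<close>

definition setup_prog :: prog where
  "setup_prog =
     (set_var vn (Var 0) ;; set_var vk (Var 1) ;; set_var vb (Op Plus (Var 0) (Const 1)) ;;
      set_var vE (Const 8)) ;;
     While (Neg (LeDelta (Op Plus (Var vE) (Const 8)) (Var vE))) (incr vE) ;;
     (set_var vP (Const 1) ;; set_var vq (Const 1) ;; set_var vB (Const 1) ;; set_var vj (Const 0)) ;;
     loop vj vk
       (incr vj ;; set_var vP (Op Times (Var vP) (Var vj)) ;;
        set_var vq (Op Times (Var vq) (Var vk)) ;; set_var vB (Op Times (Var vB) (Var vb))) ;;
     (set_var vB (Op Divide (Var vB) (Var vb)) ;; set_var vx (Const 1) ;; set_var vl (Const 2)) ;;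
     While (Neg (Less (Var vn) (Var vx)))
       (set_var vx (Op Times (Const 2) (Var vx)) ;; set_var vl (Op Plus (Var vl) (Var vk))) ;;
     set_var vD (Op Times (Var vq) (Var vE)) ;;
     set_var vM (Op Plus (Op Divide (Op Times (Op Times (Var vD) (Var vE)) (Var vl)) (Var vP)) (Const 1))"

definition balanced_prog :: prog where
  "balanced_prog = setup_prog ;; gen_prog ;; rounds_prog"

locale hashing = machine +
  fixes n k E M :: nat
  assumes k1: "1 \<le> k" and kn: "k \<le> n" and E8: "8 \<le> E" and M1: "1 \<le> M"
    and V_pow: "(n + 1) ^ k \<le> V" and V_E: "k ^ k * E \<le> V"
    and V_weight: "4 * (n choose k) * M * k ^ k \<le> V" and V_ents: "2 ^ k * (n choose k) \<le> V"
begin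

definition base :: nat where
  "base = n + 1"

definition Ls :: "nat list list" where
  "Ls = leaves k n"

lemma length_Ls: "length Ls = n choose k"
  using k1 by (simp add: Ls_def length_leaves)

lemma length_Ls_pos: "1 \<le> length Ls"
  using kn by (simp add: length_Ls Suc_le_eq zero_less_binomial_iff)

lemma set_Ls: "set Ls = {xs. decreasing n xs \<and> length xs = k}"
  unfolding Ls_def using k1 by (rule set_leaves)

lemma n_less_V: "n + 1 \<le> V"
proof -
  have "(n + 1) ^ 1 \<le> (n + 1) ^ k" using k1 by (intro power_increasing) auto
  then show ?thesis using V_pow by simp
qed

lemma k_pow_V: "k ^ k \<le> V"
proof -
  have "k ^ k * 1 \<le> k ^ k * E" using E8 by (intro mult_le_mono) auto
  then show ?thesis using V_E by linarith
qed

definition par :: "memory \<Rightarrow> bool" where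
  "par m \<longleftrightarrow> m vn = n \<and> m vk = k \<and> m vb = base \<and> m vP = fact k \<and> m vq = k ^ k \<and>
    m vM = M \<and> m vN = length Ls \<and> m vD = k ^ k * E \<and>
    (\<forall>j < length Ls. m (arr aleaf j) = code base (Ls ! j))"

lemma par_frame: "par m \<Longrightarrow> frame X m m' \<Longrightarrow> {20..31} \<union> range (arr aleaf) \<subseteq> - X \<Longrightarrow> par m'"
proof -
  assume p: "par m" and f: "frame X m m'" and X: "{20..31} \<union> range (arr aleaf) \<subseteq> - X"
  have "m' a = m a" if "a \<in> {20..31} \<union> range (arr aleaf)" for a
    using f X that by (intro frameD[OF f]) blast
  then show "par m'" using p by (simp add: par_def)
qed

definition fun_on :: "nat \<Rightarrow> (nat \<Rightarrow> nat) \<Rightarrow> memory \<Rightarrow> bool" where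
  "fun_on i f m \<longleftrightarrow> (\<forall>x. 1 \<le> x \<longrightarrow> x \<le> i \<longrightarrow> m (arr afun x) = f x \<and> f x \<in> {1..k})"

lemma wp_hits_decode:
  assumes par: "par m" and j: "j < length Ls" and mi: "m vi = i" and f: "fun_on i f m"
    and mc: "m vc = code base (Ls ! j)" and mr: "m vr = k" and mh: "m vh = fact k"
    and seen: "\<forall>v. 1 \<le> v \<longrightarrow> v \<le> k \<longrightarrow> m (arr aseen v) = 0"
  shows "wp (k * 100 + 10) (While (Less (Const 0) (Var vc)) digit_prog)
    (\<lambda>m' out'. out' = out \<and> m' vh = hits k f (below (set (Ls ! j)) i) \<and>
       frame ({vc, vh, vr, vx} \<union> range (arr aseen)) m m') m out"
proof -
  let ?X = "{vc, vh, vr, vx} \<union> range (arr aseen)"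
  have "Ls ! j \<in> set Ls" using j by simp
  then have L: "decreasing n (Ls ! j)" "length (Ls ! j) = k" by (auto simp: set_Ls)
  \<comment> \<open>The elements \<open>ys\<close> are decoded, \<open>zs\<close> are still in the
    code. \<open>vr\<close> is specified only as long as no collision has occurred; afterwards
    \<open>vh\<close> is 0 and stays 0, whatever \<open>vr\<close> holds.\<close>
  define I where "I p m' out' \<longleftrightarrow> (\<exists>ys zs. Ls ! j = ys @ zs \<and> p = length zs \<and>
      m' vc = code base zs \<and>
      (\<forall>v. 1 \<le> v \<longrightarrow> v \<le> k \<longrightarrow> (0 < m' (arr aseen v) \<longleftrightarrow> v \<in> f ` below (set ys) i)) \<and>
      m' vh = hits k f (below (set ys) i) \<and>
      (inj_on f (below (set ys) i) \<longrightarrow> m' vr = k - card (below (set ys) i)) \<and>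
      frame ?X m m' \<and> out' = out)" for p m' out'
  show ?thesis
  proof (rule wp_time, rule wp_While[where I = I and p = k and K = k])
    show "I k m out"
      unfolding I_def using mc mr mh seen L
      by (intro exI[of _ "[]"] exI[of _ "Ls ! j"]) (auto simp: below_def)
  next
    fix p m' out'
    assume "I p m' out'" and ex: "\<not> test_val \<delta> m' (Less (Const 0) (Var vc))"
    then obtain ys zs where yz: "Ls ! j = ys @ zs" "m' vc = code base zs"
      and h: "m' vh = hits k f (below (set ys) i)" "frame ?X m m'" "out' = out"
      by (auto simp: I_def)
    have "zs = []"
    proof (cases zs)
      case (Cons x xs)
      then show ?thesis using yz ex L by auto
    qed
    then show "out' = out \<and> m' vh = hits k f (below (set (Ls ! j)) i) \<and> frame ?X m m'"
      using yz h by simp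
  next
    fix p m' out'
    assume "I p m' out'" and b: "bounded_by m'" and t: "test_val \<delta> m' (Less (Const 0) (Var vc))"
    then obtain ys zs where yz: "Ls ! j = ys @ zs" "p = length zs" "m' vc = code base zs"
      and seen: "\<And>v. 1 \<le> v \<Longrightarrow> v \<le> k \<Longrightarrow> 0 < m' (arr aseen v) \<longleftrightarrow> v \<in> f ` below (set ys) i"
      and h: "m' vh = hits k f (below (set ys) i)"
      and r: "inj_on f (below (set ys) i) \<Longrightarrow> m' vr = k - card (below (set ys) i)"
      and fr: "frame ?X m m'" and out: "out' = out"
      by (auto simp: I_def)
    from t yz(3) obtain x xs where zs: "zs = x # xs" by (cases zs) auto
    define c where "c = code base xs"
    have x: "1 \<le> x" "x \<le> n" using L yz zs by auto
    have mc: "m' vc = c * base + x" using yz zs by (simp add: c_def)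
    have cV: "c * base + x \<le> V" using b mc by (metis bounded_by_def)
    have xb: "x < base" using x by (simp add: base_def)
    have dv: "(c * base + x) div base = c" using xb by simp
    have cV': "c \<le> V" using cV xb by (cases base) auto
    have p': "m' vk = k" "m' vb = base" "m' vi = i"
      using par mi fr by (auto simp: par_def frameD)
    have fx: "m' (arr afun y) = f y" "1 \<le> f y" "f y \<le> k" if "1 \<le> y" "y \<le> i" for y
      using f fr that by (auto simp: fun_on_def frameD)
    have kV: "k \<le> V" using kn n_less_V by simp
    have dist: "x \<notin> set ys" "length ys < k" "distinct ys"
      using L decreasing_distinct[of "Ls ! j"] yz zs by auto
    define A where "A = below (set ys) i"
    have A: "finite A" "x \<notin> A" "card A < k"
    proof -
      show "finite A" "x \<notin> A" using dist by (auto simp: A_def below_def)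
      have "card A \<le> length ys" unfolding A_def using card_below_le[of "set ys" i] card_length[of ys] by simp
      then show "card A < k" using dist by simp
    qed
    have below_snoc: "below (insert x (set ys)) i = (if i < x then A else insert x A)"
      by (auto simp: A_def below_def)
    have hV: "hits k f (insert x A) \<le> V"
      using A hits_le[of "insert x A" k f] k_pow_V by (simp add: le_trans)
    have I_next: "\<exists>p' < p. I p' m'' out'" if "m'' vc = c" "frame ?X m m''"
      "\<And>v. 1 \<le> v \<Longrightarrow> v \<le> k \<Longrightarrow> 0 < m'' (arr aseen v) \<longleftrightarrow> v \<in> f ` below (insert x (set ys)) i"
      "m'' vh = hits k f (below (insert x (set ys)) i)"
      "inj_on f (below (insert x (set ys)) i) \<Longrightarrow> m'' vr = k - card (below (insert x (set ys)) i)" for m''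
      unfolding I_def using that yz zs out
      by (intro exI[of _ "length xs"] conjI exI[of _ "ys @ [x]"] exI[of _ xs]) (auto simp: c_def)
    show "wp 80 digit_prog
      (\<lambda>m'' out''. \<exists>p' < p. I p' m'' out'') m' out'"
    proof (rule wp_exec)
      have V1: "x \<le> V" "m' vr \<le> V" "1 \<le> V" "m' vr - 1 \<le> V"
        using x n_less_V b by (auto simp: bounded_by_def intro: order_trans[OF diff_le_self])
      note simps = digit_prog_def expr_ok_def mc p' dv cV cV' fx h V1 A_def[symmetric]
      show "exec_ok digit_prog (\<lambda>m'' out''. \<exists>p' < p. I p' m'' out'') m' out'"
      proof (cases "i < x")
        case True
        have "\<exists>p' < p. I p' (m'(vx := x, vc := c)) out'"
          by (rule I_next) (use True seen h r fr in \<open>auto simp: below_snoc A_def intro!: frame_upd\<close>)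
        with True show ?thesis by (simp add: simps)
      next
        case False
        then have fx': "m' (arr afun x) = f x" "1 \<le> f x" "f x \<le> k" using fx[of x] x by auto
        have seen': "0 < m' (arr aseen (f x)) \<longleftrightarrow> f x \<in> f ` A"
          using seen[of "f x"] fx' by (simp add: A_def)
        show ?thesis
        proof (cases "f x \<in> f ` A")
          case True
          have "\<not> inj_on f (insert x A)" using True A(2) by auto
          moreover from this have "hits k f (insert x A) = 0" by (simp only: hits_def if_False)
          ultimately have "\<exists>p' < p. I p' (m'(vx := x, vc := c, vh := 0, arr aseen (f x) := 1)) out'"
            by (intro I_next)
              (use False seen fr in \<open>auto simp: below_snoc A_def[symmetric] intro!: frame_upd\<close>)
          with False True seen' fx' show ?thesis using V1(3) by (simp add: simps)
        next
          case new: False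
          have h': "hits k f A * k div m' vr = hits k f (insert x A)"
          proof (cases "inj_on f A")
            case True
            then show ?thesis
              using hits_insert_step[OF A, of f] new r by (simp add: A_def[symmetric])
          next
            case False
            then have "hits k f A = 0" by (simp add: hits_def)
            with False show ?thesis using hits_insert_step[OF A, of f] new by simp
          qed
          have "m' vr - 1 = k - card (insert x A)" if "inj_on f (insert x A)"
            using r that A by (simp add: A_def[symmetric])
          then have "\<exists>p' < p. I p' (m'(vx := x, vc := c, vh := hits k f (insert x A),
              vr := m' vr - 1, arr aseen (f x) := 1)) out'"
            by (intro I_next)
              (use False seen fr in \<open>auto simp: below_snoc A_def[symmetric] intro!: frame_upd\<close>)
          with False new seen' fx' h' hV show ?thesis
            using V1(2-4) by (simp add: simps)
        qed
      qed
    qed (simp add: digit_prog_def)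
  qed (auto simp: expr_ok_def)
qed

lemma wp_hits:
  assumes par: "par m" and j: "j < length Ls" and mj: "m vj = j" and mi: "m vi = i"
    and f: "fun_on i f m"
  shows "wp (k * 130 + 100) hits_prog
    (\<lambda>m' out'. out' = out \<and> m' vh = hits k f (below (set (Ls ! j)) i) \<and>
       frame ({vc, vh, vr, vx, vy} \<union> range (arr aseen)) m m') m out"
proof (rule wp_bounded)
  assume bd: "bounded_by m"
  let ?X = "{vc, vh, vr, vx, vy} \<union> range (arr aseen)"
  have kV: "k \<le> V" using kn n_less_V by simp
  have factV: "fact k \<le> V" using fact_mult_power_le[of 0 k] k_pow_V by simp
  have codeV: "code base (Ls ! j) \<le> V" using par j bd by (metis par_def bounded_by_def)
  let ?c = "incr vy ;; Assign (Arr aseen (Var vy)) (Const 0)"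
  let ?I = "\<lambda>y m' out'. out' = out \<and> frame ?X m m' \<and>
    (\<forall>v. 1 \<le> v \<longrightarrow> v \<le> y \<longrightarrow> m' (arr aseen v) = 0)"
  have clear: "wp (k * (20 + 6) + 6) (loop vy vk ?c) (?I k) (m(vy := 0)) out"
  proof (rule wp_loop[where I = ?I])
    fix y m' out'
    assume "?I y m' out'" "m' vy = y" "m' vk = k" "y < k"
    then show "wp 20 ?c (\<lambda>m'' out''. ?I (Suc y) m'' out'' \<and> m'' vy = Suc y \<and> m'' vk = k) m' out'"
      using kV by (intro wp_exec) (auto simp: expr_ok_def le_Suc_eq intro!: frame_upd)
  qed (use par in \<open>auto simp: par_def intro!: frame_upd\<close>)
  have decode: "wp (k * 100 + 10) (While (Less (Const 0) (Var vc)) digit_prog)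
      (\<lambda>m' out'. out' = out \<and> m' vh = hits k f (below (set (Ls ! j)) i) \<and> frame ?X m m')
      (m'(vc := code base (Ls ! j), vr := k, vh := fact k)) out" (is "wp _ _ _ ?m out")
    if I: "?I k m' out'" for m' out'
  proof (rule wp_conseq[OF wp_hits_decode[OF _ j]])
    have fr: "frame ?X m ?m" using I by (auto intro!: frame_upd)
    show "par ?m" using par fr by (rule par_frame) auto
    show "?m vi = i" using I mi by (auto simp: frameD)
    show "fun_on i f ?m" using f I by (auto simp: fun_on_def frameD)
    fix m'' out''
    assume *: "out'' = out \<and> m'' vh = hits k f (below (set (Ls ! j)) i) \<and>
      frame ({vc, vh, vr, vx} \<union> range (arr aseen)) ?m m''"
    then have "frame ?X m m''" by (intro frame_trans[OF fr]) auto
    with * show "out'' = out \<and> m'' vh = hits k f (below (set (Ls ! j)) i) \<and> frame ?X m m''"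
      by simp
  qed (use I in auto)
  have rest: "wp (k * 100 + 50) ((set_var vc (get aleaf vj) ;; set_var vr (Var vk) ;;
      set_var vh (Var vP)) ;; While (Less (Const 0) (Var vc)) digit_prog)
      (\<lambda>m' out'. out' = out \<and> m' vh = hits k f (below (set (Ls ! j)) i) \<and> frame ?X m m') m' out'"
    if I: "?I k m' out'" for m' out'
  proof -
    have p: "m' vj = j" "m' vk = k" "m' vP = fact k" "m' (arr aleaf j) = code base (Ls ! j)"
      using I par mj j by (auto simp: par_def frameD)
    have exec: "exec_ok (set_var vc (get aleaf vj) ;; set_var vr (Var vk) ;; set_var vh (Var vP))
        (wp (k * 100 + 10) (While (Less (Const 0) (Var vc)) digit_prog)
          (\<lambda>m' out'. out' = out \<and> m' vh = hits k f (below (set (Ls ! j)) i) \<and> frame ?X m m'))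
        m' out'"
      using decode[OF I] I p kV factV codeV by (simp add: expr_ok_def)
    show ?thesis
      by (rule wp_time[OF wp_Seq_exec[OF exec]]) simp
  qed
  show ?thesis
    unfolding hits_prog_def
    by (rule wp_time, rule wp_Seq_exec, unfold exec_ok.simps expr_val.simps, intro conjI)
      (rule wp_Seq[OF wp_conseq[OF clear rest]] | simp add: expr_ok_def)+
qed

definition weights :: "(nat \<Rightarrow> nat) \<Rightarrow> (nat \<Rightarrow> nat) \<Rightarrow> memory \<Rightarrow> bool" where
  "weights u l m \<longleftrightarrow> (\<forall>j < length Ls. m (arr aup j) = u j \<and> m (arr alow j) = l j)"

definition total :: "(nat \<Rightarrow> nat) \<Rightarrow> (nat \<Rightarrow> nat) \<Rightarrow> nat" where
  "total u l = (\<Sum>j<length Ls. u j + l j)"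

lemma weights_frame:
  "weights u l m \<Longrightarrow> frame X m m' \<Longrightarrow> range (arr aup) \<union> range (arr alow) \<subseteq> - X \<Longrightarrow> weights u l m'"
proof -
  assume w: "weights u l m" and f: "frame X m m'" and X: "range (arr aup) \<union> range (arr alow) \<subseteq> - X"
  have "m' (arr aup j) = m (arr aup j)" "m' (arr alow j) = m (arr alow j)" for j
    using X by (intro frameD[OF f]; blast)+
  then show "weights u l m'" using w by (simp add: weights_def)
qed

lemma fun_on_frame: "fun_on i f m \<Longrightarrow> frame X m m' \<Longrightarrow> range (arr afun) \<subseteq> - X \<Longrightarrow> fun_on i f m'"
proof -
  assume g: "fun_on i f m" and f: "frame X m m'" and X: "range (arr afun) \<subseteq> - X"
  have "m' (arr afun j) = m (arr afun j)" for j
    using X by (intro frameD[OF f]) blast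
  then show "fun_on i f m'" using g by (simp add: fun_on_def)
qed

lemma Ls_elem:
  assumes "xs \<in> set Ls"
  shows "length xs = k" "0 \<notin> set xs" "distinct xs" "set xs \<subseteq> {1..n}"
proof -
  from assms have xs: "sorted_wrt (>) xs" "set xs \<subseteq> {1..n}" "length xs = k" by (simp_all add: set_Ls)
  then show "length xs = k" "set xs \<subseteq> {1..n}" "distinct xs" by (simp_all add: decreasing_distinct)
  from xs(2) show "0 \<notin> set xs" by auto
qed

lemma length_Ls_V: "length Ls \<le> V"
proof -
  have "1 * length Ls \<le> 2 ^ k * length Ls" by (intro mult_le_mono) auto
  then show ?thesis using V_ents unfolding length_Ls by linarith
qed

lemma card_Ls: "j < length Ls \<Longrightarrow> card (set (Ls ! j)) = k"
  using Ls_elem[of "Ls ! j"] by (simp add: distinct_card)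

lemma score_le_V: "total u l * k ^ k \<le> V \<Longrightarrow> score k Ls u l f i \<le> V"
  using score_le[of Ls k u l f i] Ls_elem(1) by (simp add: total_def mult.commute)

lemma wp_score:
  assumes par: "par m" and mi: "m vi = i" and f: "fun_on i f m" and w: "weights u l m"
    and tot: "total u l * k ^ k \<le> V"
  shows "wp (400 * (length Ls * k)) score_prog
    (\<lambda>m' out'. out' = out \<and> m' vacc = score k Ls u l f i \<and>
       frame ({vacc, vj, vc, vh, vr, vx, vy} \<union> range (arr aseen)) m m') m out"
proof -
  let ?X = "{vacc, vj, vc, vh, vr, vx, vy} \<union> range (arr aseen)"
  let ?N = "length Ls"
  define H where "H j = hits k f (below (set (Ls ! j)) i)" for j
  define contrib where "contrib j = u j * (k ^ k - H j) + l j * H j" for j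
  have score: "score k Ls u l f i = (\<Sum>j<?N. contrib j)"
    by (simp add: score_def contrib_def H_def)
  let ?I = "\<lambda>j m' out'. out' = out \<and> frame ?X m m' \<and> m' vacc = (\<Sum>j'<j. contrib j')"
  let ?c1 = "set_var vacc (Op Plus (Var vacc)
          (Op Plus (Op Times (get aup vj) (Op Minus (Var vq) (Var vh)))
             (Op Times (get alow vj) (Var vh)))) ;; incr vj"
  have loop: "wp (?N * ((k * 130 + 150) + 6) + 6) (loop vj vN (hits_prog ;; ?c1))
      (\<lambda>m' out'. out' = out \<and> m' vacc = score k Ls u l f i \<and> frame ?X m m')
      (m(vacc := 0, vj := 0)) out"
  proof (rule wp_loop[where I = ?I])
    fix j m' out'
    assume I: "?I j m' out'" and j: "m' vj = j" "m' vN = ?N" "j < ?N"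
    have fI: "frame ?X m m'" using I by simp
    have par': "par m'" by (rule par_frame[OF par, of ?X]) (use I in auto)
    have f': "fun_on i f m'" by (rule fun_on_frame[OF f, of ?X]) (use I in auto)
    have w': "weights u l m'" by (rule weights_frame[OF w, of ?X]) (use I in auto)
    have mi': "m' vi = i" using mi fI by (simp add: frameD)
    \<comment> \<open>All contributions are natural numbers, so the accumulator never exceeds the
      final score, which fits.\<close>
    have "(\<Sum>j'<Suc j. contrib j') \<le> (\<Sum>j'<?N. contrib j')"
      using j by (intro sum_mono2) auto
    then have V: "(\<Sum>j'<j. contrib j') + contrib j \<le> V"
      using score_le_V[OF tot, of f i] score by simp
    have jV: "Suc j \<le> V"
      using j(3) length_Ls_V by simp
    show "wp (k * 130 + 150) (hits_prog ;; ?c1)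
      (\<lambda>m'' out''. ?I (Suc j) m'' out'' \<and> m'' vj = Suc j \<and> m'' vN = ?N) m' out'"
    proof (rule wp_time, rule wp_Seq, rule wp_conseq, rule wp_hits[OF par' j(3,1) mi' f'])
      fix m'' out''
      assume h: "out'' = out' \<and> m'' vh = hits k f (below (set (Ls ! j)) i) \<and>
         frame ({vc, vh, vr, vx, vy} \<union> range (arr aseen)) m' m''"
      have fr: "frame ?X m m''"
        by (rule frame_trans[OF conjunct1[OF conjunct2[OF I]] conjunct2[OF conjunct2[OF h]]]) auto
      note hf = h[THEN conjunct2, THEN conjunct2]
      have eqs: "m'' vj = j" "m'' vN = ?N" "m'' vq = k ^ k" "m'' (arr aup j) = u j"
        "m'' (arr alow j) = l j" "m'' vh = H j" "m'' vacc = (\<Sum>j'<j. contrib j')"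
        using h I j par' w' by (simp_all add: par_def weights_def H_def frameD[OF hf])
      show "wp 50 ?c1 (\<lambda>m'' out''. ?I (Suc j) m'' out'' \<and> m'' vj = Suc j \<and> m'' vN = ?N) m'' out''"
        by (rule wp_exec) (use h I fr eqs V jV in \<open>auto simp: expr_ok_def contrib_def intro!: frame_upd\<close>)
    qed simp
  next
    show "(m(vacc := 0, vj := 0)) vN = ?N" using par by (simp add: par_def)
  qed (simp_all add: score frame_upd)
  have time: "max_cost (set_var vacc (Const 0) ;; set_var vj (Const 0)) +
      (?N * ((k * 130 + 150) + 6) + 6) \<le> 400 * (?N * k)"
  proof -
    have "?N \<le> ?N * k" "1 \<le> ?N * k" using k1 length_Ls_pos by simp_all
    moreover have "?N * ((k * 130 + 150) + 6) + 6 = 130 * (?N * k) + 156 * ?N + 6"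
      by (simp add: algebra_simps)
    moreover have "max_cost (set_var vacc (Const 0) ;; set_var vj (Const 0)) \<le> 20" by simp
    ultimately show ?thesis by linarith
  qed
  show ?thesis
    unfolding score_prog_def
    by (rule wp_time[OF wp_Seq_exec time]) (use loop in \<open>simp add: expr_ok_def\<close>)
qed

lemma Nk_mono: "length Ls \<le> length Ls * k" "length Ls * k \<le> length Ls * k * k"
  "k \<le> length Ls * k" "1 \<le> length Ls * k" "1 \<le> n"
  using k1 kn length_Ls_pos by simp_all

lemma k_le_V: "k \<le> V"
  using kn n_less_V by simp

lemma wp_choose:
  assumes par: "par m" and mi: "m vi = i" "i < n" and f: "fun_on i f m" and w: "weights u l m"
    and tot: "total u l * k ^ k \<le> V"
  defines "X \<equiv> {vi, vv, vj, vc, vh, vr, vx, vy, vacc, vbest, varg} \<union> range (arr aseen) \<union> range (arr afun)"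
  shows "wp (700 * (length Ls * k * k)) choose_prog
    (\<lambda>m' out'. \<exists>b. out' = out @ [b] \<and> fun_on (Suc i) (f(Suc i := b)) m' \<and>
       score k Ls u l f i \<le> score k Ls u l (f(Suc i := b)) (Suc i) \<and>
       m' vi = Suc i \<and> frame X m m') m out"
proof -
  let ?N = "length Ls"
  define sc where "sc v = score k Ls u l (f(Suc i := v)) (Suc i)" for v
  \<comment> \<open>Only the first \<open>i\<close> values are fixed, since table cell i + 1 holds
    the candidate on trial. \<open>vbest\<close> is the maximum over the candidates so far, attained
    at \<open>varg\<close>; the clause for v = 0 covers the first comparison.\<close>
  let ?I = "\<lambda>v m' out'. out' = out \<and> frame X m m' \<and> m' vi = Suc i \<and> fun_on i f m' \<and>
    (\<forall>v'. 1 \<le> v' \<longrightarrow> v' \<le> v \<longrightarrow> sc v' \<le> m' vbest) \<and> (v = 0 \<longrightarrow> m' vbest = 0) \<and>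
    (1 \<le> v \<longrightarrow> 1 \<le> m' varg \<and> m' varg \<le> v \<and> m' vbest = sc (m' varg))"
  let ?Q = "\<lambda>m' out'. \<exists>b. out' = out @ [b] \<and> fun_on (Suc i) (f(Suc i := b)) m' \<and>
       score k Ls u l f i \<le> score k Ls u l (f(Suc i := b)) (Suc i) \<and>
       m' vi = Suc i \<and> frame X m m'"
  let ?c1 = "incr vv ;; Assign (Arr afun (Var vi)) (Var vv)"
  let ?c2 = "If (Less (Var vacc) (Var vbest)) Skip
    (set_var vbest (Var vacc) ;; set_var varg (Var vv))"
  let ?c3 = "Assign (Arr afun (Var vi)) (Var varg) ;; Write (Var varg)"
  let ?m0 = "m(vi := Suc i, vbest := 0, vv := 0)"
  have upd: "fun_on (Suc i) (f(Suc i := v)) (m'(arr afun (Suc i) := v))"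
    if "fun_on i f m'" "1 \<le> v" "v \<le> k" for m' v
    using that by (auto simp: fun_on_def le_Suc_eq)
  have iV: "Suc i \<le> V" using mi(2) n_less_V by simp
  have loop: "wp (k * ((400 * (?N * k) + 50) + 6) + 6) (loop vv vk (?c1 ;; score_prog ;; ?c2))
      (\<lambda>m' out'. ?I k m' out') ?m0 out"
  proof (rule wp_loop[where I = ?I])
    fix v m' out'
    assume I: "?I v m' out'" and v: "m' vv = v" "m' vk = k" "v < k"
    have fI: "frame X m m'" using I by simp
    let ?m1 = "m'(vv := Suc v, arr afun (Suc i) := Suc v)"
    have fr1: "frame X m ?m1" using fI by (auto simp: X_def intro!: frame_upd)
    have par1: "par ?m1" by (rule par_frame[OF par fr1]) (auto simp: X_def)
    have w1: "weights u l ?m1" by (rule weights_frame[OF w fr1]) (auto simp: X_def)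
    have f1: "fun_on (Suc i) (f(Suc i := Suc v)) ?m1"
      using I v by (intro upd) (auto simp: fun_on_def)
    have mi1: "?m1 vi = Suc i" using I by simp
    have vV: "Suc v \<le> V" using v k_le_V by simp
    have step: "wp (400 * (?N * k) + 30) (score_prog ;; ?c2)
      (\<lambda>m'' out''. ?I (Suc v) m'' out'' \<and> m'' vv = Suc v \<and> m'' vk = k) ?m1 out"
    proof (rule wp_time, rule wp_Seq, rule wp_conseq, rule wp_score[OF par1 mi1 f1 w1 tot])
      fix m2 out2
      assume h: "out2 = out \<and> m2 vacc = score k Ls u l (f(Suc i := Suc v)) (Suc i) \<and>
         frame ({vacc, vj, vc, vh, vr, vx, vy} \<union> range (arr aseen)) ?m1 m2"
      have fr: "frame ({vacc, vj, vc, vh, vr, vx, vy} \<union> range (arr aseen)) ?m1 m2" using h by simp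
      have fr2: "frame X m m2" by (rule frame_trans[OF fr1 fr]) (auto simp: X_def)
      have eqs: "m2 vv = Suc v" "m2 vk = k" "m2 vi = Suc i" "m2 vbest = m' vbest"
        "m2 varg = m' varg" "m2 vacc = sc (Suc v)" "out2 = out"
        using h I v by (simp_all add: frameD[OF fr] sc_def)
      have f2: "fun_on i f m2"
      proof -
        have "fun_on i f ?m1" using I by (auto simp: fun_on_def)
        then show ?thesis by (rule fun_on_frame[OF _ fr]) auto
      qed
      have scV: "sc (Suc v) \<le> V" unfolding sc_def using tot by (rule score_le_V)
      have frX: "frame X m (m2(vbest := a, varg := b))" for a b
        using fr2 by (auto simp: X_def intro!: frame_upd)
      have fX: "fun_on i f (m2(vbest := a, varg := b))" for a b
        using f2 by (auto simp: fun_on_def)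
      \<comment> \<open>No score lies below the initial 0, so a candidate can be rejected only after
        an earlier one has been recorded.\<close>
      have "1 \<le> v" if "sc (Suc v) < m' vbest" using that I by (cases v) auto
      then show "wp 30 ?c2 (\<lambda>m'' out''. ?I (Suc v) m'' out'' \<and> m'' vv = Suc v \<and> m'' vk = k) m2 out2"
        by (intro wp_exec) (use I eqs f2 fr2 scV vV frX fX in \<open>auto simp: expr_ok_def le_Suc_eq\<close>)
    qed simp
    show "wp (400 * (?N * k) + 50) (?c1 ;; score_prog ;; ?c2)
      (\<lambda>m'' out''. ?I (Suc v) m'' out'' \<and> m'' vv = Suc v \<and> m'' vk = k) m' out'"
      by (rule wp_time[OF wp_Seq_exec[of _ "400 * (?N * k) + 30"]])
        (use step I v vV in \<open>simp_all add: expr_ok_def\<close>)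
  qed (use par f in \<open>auto simp: par_def X_def fun_on_def intro!: frame_upd\<close>)
  have last: "wp 20 ?c3 ?Q m' out'" if I: "?I k m' out'" for m' out'
  proof (rule wp_exec)
    define b where "b = m' varg"
    have b: "1 \<le> b" "b \<le> k" "m' vbest = sc b" using I k1 by (auto simp: b_def)
    have best: "score k Ls u l f i \<le> sc b"
    proof (rule score_le_max)
      show "score k Ls u l (f(Suc i := v)) (Suc i) \<le> sc b" if "1 \<le> v" "v \<le> k" for v
      proof -
        have "sc v \<le> m' vbest" using I that by blast
        then show ?thesis unfolding b(3) by (simp only: sc_def)
      qed
      show "f x \<in> {1..k}" if "1 \<le> x" "x \<le> i" for x using f that by (simp add: fun_on_def)
    qed (use Ls_elem k1 in auto)
    have "fun_on (Suc i) (f(Suc i := b)) (m'(arr afun (Suc i) := b))"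
      using I b by (intro upd) auto
    moreover have "frame X m (m'(arr afun (Suc i) := b))"
      using I by (auto simp: X_def intro!: frame_upd)
    ultimately have "?Q (m'(arr afun (Suc i) := b)) (out @ [b])"
      using best I by (intro exI[of _ b]) (simp add: sc_def)
    then show "exec_ok ?c3 ?Q m' out'"
      using I b k_le_V by (simp add: expr_ok_def b_def[symmetric])
  qed simp
  have tail: "wp (k * (400 * (?N * k) + 56) + 26)
      (loop vv vk (?c1 ;; score_prog ;; ?c2) ;; ?c3) ?Q ?m0 out"
  proof (rule wp_time)
    show "wp (k * ((400 * (?N * k) + 50) + 6) + 6 + 20)
        (loop vv vk (?c1 ;; score_prog ;; ?c2) ;; ?c3) ?Q ?m0 out"
      by (rule wp_Seq, rule wp_conseq[OF loop], rule last)
  qed simp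
  have time: "max_cost (incr vi ;; set_var vbest (Const 0) ;; set_var vv (Const 0)) +
      (k * (400 * (?N * k) + 56) + 26) \<le> 700 * (?N * k * k)"
  proof -
    have "k * (400 * (?N * k) + 56) + 26 = 400 * (?N * k * k) + 56 * k + 26"
      by (simp add: algebra_simps)
    moreover have "max_cost (incr vi ;; set_var vbest (Const 0) ;; set_var vv (Const 0)) \<le> 20" by simp
    ultimately show ?thesis using Nk_mono by linarith
  qed
  show ?thesis
    unfolding choose_prog_def
    by (rule wp_time[OF wp_Seq_exec time]) (use tail mi iV in \<open>simp add: expr_ok_def\<close>)
qed

lemma wp_positions:
  assumes par: "par m" and mi: "m vi = 0" and w: "weights u l m" and tot: "total u l * k ^ k \<le> V"
  defines "X \<equiv> {vi, vv, vj, vc, vh, vr, vx, vy, vacc, vbest, varg} \<union> range (arr aseen) \<union> range (arr afun)"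
  shows "wp (800 * (n * (length Ls * k * k))) (loop vi vn choose_prog)
    (\<lambda>m' out'. \<exists>f. out' = out @ map f [1..<Suc n] \<and> fun_on n f m' \<and>
       score k Ls u l f 0 \<le> score k Ls u l f n \<and> m' vi = n \<and> frame X m m') m out"
proof -
  let ?N = "length Ls"
  \<comment> \<open>Hence the inequalities of the single positions chain up with the final function
    on both sides, although \<open>f\<close> changes from position to position.\<close>
  have score0: "score k Ls u l f 0 = score k Ls u l g 0" for f g
    using Ls_elem(2) by (intro score_cong) auto
  let ?I = "\<lambda>i m' out'. \<exists>f. out' = out @ map f [1..<Suc i] \<and> fun_on i f m' \<and>
    score k Ls u l f 0 \<le> score k Ls u l f i \<and> frame X m m'"
  have time: "n * (700 * (?N * k * k) + 6) + 6 \<le> 800 * (n * (?N * k * k))"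
  proof -
    have "n * (700 * (?N * k * k) + 6) + 6 = 700 * (n * (?N * k * k)) + 6 * n + 6"
      by (simp add: algebra_simps)
    moreover have "n * 1 \<le> n * (?N * k * k)" by (rule mult_le_mono2) (use Nk_mono in linarith)
    ultimately show ?thesis using Nk_mono(5) by linarith
  qed
  show ?thesis
  proof (rule wp_time[OF _ time], rule wp_loop[where I = ?I])
    fix i m' out'
    assume I: "?I i m' out'" and i: "m' vi = i" "m' vn = n" "i < n"
    then obtain f where f: "out' = out @ map f [1..<Suc i]" "fun_on i f m'"
      "score k Ls u l f 0 \<le> score k Ls u l f i" and fr: "frame X m m'" by blast
    have par': "par m'" by (rule par_frame[OF par fr]) (auto simp: X_def)
    have w': "weights u l m'" by (rule weights_frame[OF w fr]) (auto simp: X_def)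
    show "wp (700 * (?N * k * k)) choose_prog
      (\<lambda>m'' out''. ?I (Suc i) m'' out'' \<and> m'' vi = Suc i \<and> m'' vn = n) m' out'"
    proof (rule wp_conseq[OF wp_choose[OF par' i(1,3) f(2) w' tot]], fold X_def)
      fix m'' out''
      assume "\<exists>b. out'' = out' @ [b] \<and> fun_on (Suc i) (f(Suc i := b)) m'' \<and>
        score k Ls u l f i \<le> score k Ls u l (f(Suc i := b)) (Suc i) \<and>
        m'' vi = Suc i \<and> frame X m' m''"
      then obtain b where b: "out'' = out' @ [b]" "fun_on (Suc i) (f(Suc i := b)) m''"
        "score k Ls u l f i \<le> score k Ls u l (f(Suc i := b)) (Suc i)" "m'' vi = Suc i"
        "frame X m' m''" by blast
      have "out'' = out @ map (f(Suc i := b)) [1..<Suc (Suc i)]"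
        using b(1) f(1) by simp
      moreover have "score k Ls u l (f(Suc i := b)) 0 \<le> score k Ls u l (f(Suc i := b)) (Suc i)"
        using b(3) f(3) score0[of "f(Suc i := b)" f] by linarith
      moreover have "frame X m m''" by (rule frame_trans[OF fr b(5)]) auto
      moreover have "m'' vn = n" using frameD[OF b(5), of vn] i(2) by (auto simp: X_def)
      ultimately show "?I (Suc i) m'' out'' \<and> m'' vi = Suc i \<and> m'' vn = n"
        using b(2,4) by blast
    qed
  next
    show "m vn = n" using par by (simp add: par_def)
    show "?I 0 m out" by (auto simp: fun_on_def)
  qed (use mi in auto)
qed

definition new_up :: "(nat \<Rightarrow> nat) \<Rightarrow> (nat \<Rightarrow> nat) \<Rightarrow> nat \<Rightarrow> nat" where
  "new_up f u j = next_weight (k ^ k * E) (k ^ k * E + hits k f (set (Ls ! j)) - fact k) (u j)"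

definition new_low :: "(nat \<Rightarrow> nat) \<Rightarrow> (nat \<Rightarrow> nat) \<Rightarrow> nat \<Rightarrow> nat" where
  "new_low f l j = next_weight (k ^ k * E) (k ^ k * E + fact k - hits k f (set (Ls ! j))) (l j)"

lemma below_n: "j < length Ls \<Longrightarrow> below (set (Ls ! j)) n = set (Ls ! j)"
  using Ls_elem(4)[of "Ls ! j"] by (auto simp: below_def)

lemma wp_update:
  assumes par: "par m" and mi: "m vi = n" and f: "fun_on n f m" and w: "weights u l m"
    and tot: "total (new_up f u) (new_low f l) \<le> V"
  defines "X \<equiv> {vj, vc, vh, vr, vx, vy} \<union> range (arr aseen) \<union> range (arr aup) \<union> range (arr alow)"
  shows "wp (500 * (length Ls * k)) update_prog
    (\<lambda>m' out'. out' = out \<and> weights (new_up f u) (new_low f l) m' \<and> frame X m m') m out"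
proof -
  let ?N = "length Ls"
  let ?I = "\<lambda>j m' out'. out' = out \<and> frame X m m' \<and>
    weights (\<lambda>j'. if j' < j then new_up f u j' else u j')
      (\<lambda>j'. if j' < j then new_low f l j' else l j') m'"
  let ?c1 = "Assign (Arr aup (Var vj)) (Op Plus (Op Divide
      (Op Times (get aup vj) (Op Minus (Op Plus (Var vD) (Var vh)) (Var vP))) (Var vD)) (Const 1)) ;;
    Assign (Arr alow (Var vj)) (Op Plus (Op Divide
      (Op Times (get alow vj) (Op Minus (Op Plus (Var vD) (Var vP)) (Var vh))) (Var vD)) (Const 1)) ;;
    incr vj"
  have loop: "wp (?N * ((k * 130 + 200) + 6) + 6) (loop vj vN (hits_prog ;; ?c1))
    (\<lambda>m' out'. out' = out \<and> weights (new_up f u) (new_low f l) m' \<and> frame X m m')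
    (m(vj := 0)) out"
  proof (rule wp_loop[where I = ?I])
    fix j m' out'
    assume I: "?I j m' out'" and j: "m' vj = j" "m' vN = ?N" "j < ?N"
    have fI: "frame X m m'" using I by simp
    have par': "par m'" by (rule par_frame[OF par fI]) (auto simp: X_def)
    have f': "fun_on n f m'" by (rule fun_on_frame[OF f fI]) (auto simp: X_def)
    have mi': "m' vi = n" using mi frameD[OF fI, of vi] by (auto simp: X_def)
    have V: "new_up f u j \<le> V" "new_low f l j \<le> V"
    proof -
      have "new_up f u j + new_low f l j \<le> total (new_up f u) (new_low f l)"
        unfolding total_def by (rule member_le_sum) (use j in auto)
      then show "new_up f u j \<le> V" "new_low f l j \<le> V" using tot by simp_all
    qed
    have jV: "Suc j \<le> V" using j(3) length_Ls_V by simp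
    show "wp (k * 130 + 200) (hits_prog ;; ?c1)
      (\<lambda>m'' out''. ?I (Suc j) m'' out'' \<and> m'' vj = Suc j \<and> m'' vN = ?N) m' out'"
    proof (rule wp_time, rule wp_Seq, rule wp_conseq, rule wp_hits[OF par' j(3,1) mi' f'])
      fix m2 out2
      assume h: "out2 = out' \<and> m2 vh = hits k f (below (set (Ls ! j)) n) \<and>
         frame ({vc, vh, vr, vx, vy} \<union> range (arr aseen)) m' m2"
      then have fr: "frame ({vc, vh, vr, vx, vy} \<union> range (arr aseen)) m' m2" by simp
      have fr2: "frame X m m2" by (rule frame_trans[OF fI fr]) (auto simp: X_def)
      have w2: "weights (\<lambda>j'. if j' < j then new_up f u j' else u j')
          (\<lambda>j'. if j' < j then new_low f l j' else l j') m2"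
        by (rule weights_frame[OF _ fr]) (use I in auto)
      have eqs: "m2 vj = j" "m2 vN = ?N" "m2 vD = k ^ k * E" "m2 vP = fact k"
        "m2 vh = hits k f (set (Ls ! j))" "out2 = out"
        using h I j par' by (simp_all add: frameD[OF fr] par_def below_n)
      have ul: "m2 (arr aup j) = u j" "m2 (arr alow j) = l j"
        using w2 j(3) by (auto simp: weights_def)
      let ?m3 = "m2(arr aup j := new_up f u j, arr alow j := new_low f l j, vj := Suc j)"
      have "frame X m ?m3" using fr2 by (auto simp: X_def intro!: frame_upd)
      moreover have "weights (\<lambda>j'. if j' < Suc j then new_up f u j' else u j')
          (\<lambda>j'. if j' < Suc j then new_low f l j' else l j') ?m3"
        using w2 by (auto simp: weights_def less_Suc_eq)
      ultimately have post: "?I (Suc j) ?m3 out2 \<and> ?m3 vj = Suc j \<and> ?m3 vN = ?N"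
        using eqs by simp
      have new: "Suc (u j * (k ^ k * E + hits k f (set (Ls ! j)) - fact k) div (k ^ k * E)) = new_up f u j"
        "Suc (l j * (k ^ k * E + fact k - hits k f (set (Ls ! j))) div (k ^ k * E)) = new_low f l j"
        by (simp_all add: new_up_def new_low_def next_weight_def)
      show "wp 100 ?c1 (\<lambda>m'' out''. ?I (Suc j) m'' out'' \<and> m'' vj = Suc j \<and> m'' vN = ?N) m2 out2"
        by (rule wp_exec)
          (use post V jV in \<open>simp_all add: expr_ok_def eqs ul new\<close>)
    qed simp
  next
    show "(m(vj := 0)) vN = ?N" using par by (simp add: par_def)
    show "?I 0 (m(vj := 0)) out" using w by (auto simp: X_def weights_def intro!: frame_upd)
    show "out' = out \<and> weights (new_up f u) (new_low f l) m' \<and> frame X m m'"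
      if "?I ?N m' out'" for m' out' using that by (auto simp: weights_def)
  qed auto
  have time: "max_cost (set_var vj (Const 0)) + (?N * ((k * 130 + 200) + 6) + 6) \<le> 500 * (?N * k)"
  proof -
    have "?N * ((k * 130 + 200) + 6) + 6 = 130 * (?N * k) + 206 * ?N + 6" by (simp add: algebra_simps)
    moreover have "max_cost (set_var vj (Const 0)) \<le> 20" by simp
    ultimately show ?thesis using Nk_mono by linarith
  qed
  show ?thesis
    unfolding update_prog_def
    by (rule wp_time[OF wp_Seq_exec time]) (use loop in \<open>simp add: expr_ok_def\<close>)
qed

section \<open>The invariant of the rounds\<close>

definition p :: real where
  "p = fact k / real k ^ k"

lemma p_bounds: "0 < p" "p \<le> 1"
proof -
  have "(fact k :: nat) \<le> k ^ k" using fact_mult_power_le[of 0 k] by simp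
  then have "real (fact k) \<le> real (k ^ k)" by (simp only: of_nat_le_iff)
  then show "0 < p" "p \<le> 1" using k1 by (simp_all add: p_def)
qed

text \<open>The exact growth is only a lower bound for the integer weights, which exceed it through
  rounding. The bound on the total allows 2 per subset and round for this, on top of the initial
  weights \<open>M\<close>.\<close>

definition invar :: "nat \<Rightarrow> (nat \<Rightarrow> nat) list \<Rightarrow> (nat \<Rightarrow> nat) \<Rightarrow> (nat \<Rightarrow> nat) \<Rightarrow> bool" where
  "invar t fs u l \<longleftrightarrow> length fs = t \<and> set fs \<subseteq> {1..n} \<rightarrow>\<^sub>E {1..k} \<and>
     total u l \<le> 2 * length Ls * M + 2 * length Ls * t \<and>
     (\<forall>j < length Ls. real M * trend (1 / real E) p (set (Ls ! j)) fs \<le> real (u j) \<and>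
        real M * trend (- 1 / real E) p (set (Ls ! j)) fs \<le> real (l j))"

text \<open>Two initial weights \<open>M\<close> per subset account for one half of the 4 and the
  accumulated rounding for the other. The same 4 reappears in the logarithm that determines
  \<open>M\<close>.\<close>

lemma invar_total_le:
  assumes "invar t fs u l" "t \<le> M"
  shows "total u l \<le> 4 * (n choose k) * M"
proof -
  have "length Ls * t \<le> length Ls * M" using assms(2) by simp
  moreover have "total u l \<le> 2 * length Ls * M + 2 * length Ls * t"
    using assms(1) by (simp add: invar_def)
  ultimately have "total u l \<le> 4 * length Ls * M" by linarith
  then show ?thesis by (simp add: length_Ls)
qed

lemma invar_next:
  assumes inv: "invar t fs u l" and f: "\<And>x. 1 \<le> x \<Longrightarrow> x \<le> n \<Longrightarrow> f x \<in> {1..k}"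
    and score: "score k Ls u l f 0 \<le> score k Ls u l f n"
  shows "invar (Suc t) (fs @ [restrict f {1..n}]) (new_up f u) (new_low f l)"
  unfolding invar_def
proof (intro conjI allI impI)
  let ?N = "length Ls"
  let ?g = "restrict f {1..n}"
  define H where "H j = hits k f (set (Ls ! j))" for j
  have fact_le: "fact k \<le> k ^ k" using fact_mult_power_le[of 0 k] by simp
  have H_le: "H j \<le> k ^ k" if "j < ?N" for j
    unfolding H_def using card_Ls[OF that] by (intro hits_le) simp
  have kpos: "0 < k ^ k" using k1 by simp
  show "length (fs @ [?g]) = Suc t" using inv by (simp add: invar_def)
  have "?g \<in> {1..n} \<rightarrow>\<^sub>E {1..k}" using f by auto
  then show "set (fs @ [?g]) \<subseteq> {1..n} \<rightarrow>\<^sub>E {1..k}" using inv by (simp add: invar_def)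
  have "below (set (Ls ! j)) 0 = {}" if "j < ?N" for j
    using Ls_elem(2)[of "Ls ! j"] that by (auto simp: below_def)
  then have "score k Ls u l f 0 = (\<Sum>j<?N. u j * (k ^ k - fact k) + l j * fact k)"
    by (simp add: score_def)
  moreover have "score k Ls u l f n = (\<Sum>j<?N. u j * (k ^ k - H j) + l j * H j)"
    by (simp add: score_def below_n H_def)
  ultimately have "total (new_up f u) (new_low f l) \<le> total u l + 2 * ?N"
    using score sum_next_weight_le[where q = "k ^ k" and E = E and P = "fact k" and N = ?N and
        h = H and u = u and l = l] kpos fact_le H_le E8
    by (simp add: total_def new_up_def new_low_def H_def)
  then show "total (new_up f u) (new_low f l) \<le> 2 * ?N * M + 2 * ?N * Suc t"
    using inv by (simp add: invar_def)
  fix j assume j: "j < ?N"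
  let ?S = "set (Ls ! j)"
  let ?Y = "(if inj_on f ?S then 1 else 0) :: real"
  have inj: "inj_on ?g ?S \<longleftrightarrow> inj_on f ?S"
    using Ls_elem(4)[of "Ls ! j"] j by (intro inj_on_cong) auto
  have HY: "real (H j) = real (k ^ k) * ?Y"
    using card_Ls[OF j] by (simp add: H_def hits_full)
  have D: "0 < k ^ k * E" using k1 E8 by simp
  have DE: "real (k ^ k * E) * (1 / real E) = real (k ^ k)" "real (k ^ k) * p = fact k"
    using k1 E8 by (simp_all add: p_def)
  have le: "fact k \<le> k ^ k * E + H j" "H j \<le> k ^ k * E + fact k"
  proof -
    have "k ^ k * 1 \<le> k ^ k * E" using E8 by (intro mult_le_mono2) simp
    then show "fact k \<le> k ^ k * E + H j" "H j \<le> k ^ k * E + fact k"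
      using fact_le H_le[OF j] by linarith+
  qed
  \<comment> \<open>A completed function has \<open>H j\<close> equal to 0 or \<open>k ^ k\<close>,
    so the integer quotients are exactly the factors of \<open>trend\<close>.\<close>
  have ratio: "real (k ^ k * E + H j - fact k) / real (k ^ k * E) = 1 + 1 / real E * (?Y - p)"
    "real (k ^ k * E + fact k - H j) / real (k ^ k * E) = 1 + - 1 / real E * (?Y - p)"
    using D DE le HY k1 E8 by (simp_all add: of_nat_diff p_def field_simps)
  \<comment> \<open>By \<open>ratio\<close> these are quotients of natural numbers.\<close>
  have factor: "0 \<le> 1 + 1 / real E * (?Y - p)" "0 \<le> 1 + - 1 / real E * (?Y - p)"
    unfolding ratio[symmetric] by simp_all
  from inv j have old: "real M * trend (1 / real E) p ?S fs \<le> real (u j)"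
    "real M * trend (- 1 / real E) p ?S fs \<le> real (l j)" by (simp_all add: invar_def)
  have "real M * trend (1 / real E) p ?S (fs @ [?g]) =
      (real M * trend (1 / real E) p ?S fs) * (1 + 1 / real E * (?Y - p))"
    by (simp only: trend_simps inj mult.assoc)
  also have "\<dots> \<le> real (u j) * (1 + 1 / real E * (?Y - p))"
    by (rule mult_right_mono[OF old(1) factor(1)])
  also have "\<dots> = real (u j) * real (k ^ k * E + H j - fact k) / real (k ^ k * E)"
    unfolding ratio[symmetric] by simp
  also have "\<dots> \<le> real (new_up f u j)"
    unfolding new_up_def H_def by (rule next_weight_bounds(1)[OF D])
  finally show "real M * trend (1 / real E) p ?S (fs @ [?g]) \<le> real (new_up f u j)" .
  have "real M * trend (- 1 / real E) p ?S (fs @ [?g]) =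
      (real M * trend (- 1 / real E) p ?S fs) * (1 + - 1 / real E * (?Y - p))"
    by (simp only: trend_simps inj mult.assoc)
  also have "\<dots> \<le> real (l j) * (1 + - 1 / real E * (?Y - p))"
    by (rule mult_right_mono[OF old(2) factor(2)])
  also have "\<dots> = real (l j) * real (k ^ k * E + fact k - H j) / real (k ^ k * E)"
    unfolding ratio[symmetric] by simp
  also have "\<dots> \<le> real (new_low f l j)"
    unfolding new_low_def H_def by (rule next_weight_bounds(1)[OF D])
  finally show "real M * trend (- 1 / real E) p ?S (fs @ [?g]) \<le> real (new_low f l j)" .
qed


lemma MV: "M \<le> V"
proof -
  have "1 * M * 1 \<le> 4 * length Ls * M * k ^ k"
    using length_Ls_pos k1 by (intro mult_le_mono) auto
  then show ?thesis using V_weight unfolding length_Ls by linarith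
qed

definition family_ok :: "(nat \<Rightarrow> nat) list \<Rightarrow> bool" where
  "family_ok fs \<longleftrightarrow> (\<exists>u l. invar M fs u l)"

text \<open>The bound on the total weight in \<open>invar\<close> does double duty: it feeds the
  concentration argument, and it keeps all weights and scores within a word during the run.\<close>

lemma wp_rounds:
  assumes par: "par m" and w: "weights (\<lambda>_. M) (\<lambda>_. M) m"
  shows "wp (1500 * (M * (n * (length Ls * k * k)))) rounds_prog
    (\<lambda>m' out'. \<exists>fs. out' = out @ concat (map (value_table n) fs) \<and> family_ok fs) m out"
proof -
  let ?N = "length Ls"
  let ?I = "\<lambda>t m' out'. \<exists>fs u l. out' = out @ concat (map (value_table n) fs) \<and> par m' \<and>
    weights u l m' \<and> invar t fs u l"
  let ?c = "set_var vi (Const 0) ;; loop vi vn choose_prog ;; update_prog ;; incr vt"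
  let ?z = "n * (?N * k * k)"
  let ?X = "{vi, vv, vj, vc, vh, vr, vx, vy, vacc, vbest, varg} \<union> range (arr aseen) \<union> range (arr afun)"
  let ?Y = "{vj, vc, vh, vr, vx, vy} \<union> range (arr aseen) \<union> range (arr aup) \<union> range (arr alow)"
  have z: "?N * k \<le> ?z" "1 \<le> ?z"
  proof -
    have "1 * (?N * k * k) \<le> ?z" using Nk_mono(5) by (rule mult_le_mono1)
    then show "?N * k \<le> ?z" "1 \<le> ?z" using Nk_mono by linarith+
  qed
  have body: "wp (1400 * ?z) ?c (\<lambda>m' out'. ?I (Suc t) m' out' \<and> m' vt = Suc t \<and> m' vM = M) m' out'"
    if I: "?I t m' out'" and t: "m' vt = t" "m' vM = M" "t < M" for t m' out'
  proof -
    obtain fs u l where fs: "out' = out @ concat (map (value_table n) fs)" "par m'" "weights u l m'"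
      and inv: "invar t fs u l" using I by blast
    have le: "total u l \<le> 4 * (n choose k) * M" using invar_total_le[OF inv] t(3) by simp
    then have tot: "total u l * k ^ k \<le> V"
      using V_weight mult_le_mono1[OF le, of "k ^ k"] by linarith
    let ?m1 = "m'(vi := 0)"
    have fr1: "frame ?X m' ?m1" by (auto intro!: frame_upd)
    have par1: "par ?m1" by (rule par_frame[OF fs(2) fr1]) auto
    have w1: "weights u l ?m1" by (rule weights_frame[OF fs(3) fr1]) auto
    have last: "wp (500 * (?N * k) + 10) (update_prog ;; incr vt)
      (\<lambda>m' out'. ?I (Suc t) m' out' \<and> m' vt = Suc t \<and> m' vM = M) m2 out2"
      if pos: "\<exists>f. out2 = out' @ map f [1..<Suc n] \<and> fun_on n f m2 \<and>
        score k Ls u l f 0 \<le> score k Ls u l f n \<and> m2 vi = n \<and> frame ?X ?m1 m2" for m2 out2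
    proof -
      obtain f where f: "out2 = out' @ map f [1..<Suc n]" "fun_on n f m2"
        "score k Ls u l f 0 \<le> score k Ls u l f n" "m2 vi = n" and fr2: "frame ?X ?m1 m2"
        using pos by blast
      have par2: "par m2" by (rule par_frame[OF par1 fr2]) auto
      have w2: "weights u l m2" by (rule weights_frame[OF w1 fr2]) auto
      let ?fs = "fs @ [restrict f {1..n}]"
      have inv': "invar (Suc t) ?fs (new_up f u) (new_low f l)"
        using inv _ f(3) by (rule invar_next) (use f(2) in \<open>simp add: fun_on_def\<close>)
      have "total (new_up f u) (new_low f l) \<le> 4 * (n choose k) * M"
        using invar_total_le[OF inv'] t(3) by simp
      also have "\<dots> \<le> 4 * (n choose k) * M * k ^ k" using k1 by simp
      finally have tot': "total (new_up f u) (new_low f l) \<le> V" using V_weight by linarith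
      have tab: "out2 = out @ concat (map (value_table n) ?fs)"
      proof -
        \<comment> \<open>Outside of 1..n the function \<open>f\<close> is arbitrary. Restricting it
          keeps the table and yields a member of the extensional function space.\<close>
        have "value_table n (restrict f {1..n}) = map f [1..<Suc n]"
          unfolding value_table_def by (rule map_cong) (auto simp del: upt_Suc)
        then show ?thesis unfolding f(1) fs(1) by (simp del: upt_Suc)
      qed
      show ?thesis
      proof (rule wp_Seq, rule wp_conseq[OF wp_update[OF par2 f(4,2) w2 tot']])
        fix m3 out3
        assume h: "out3 = out2 \<and> weights (new_up f u) (new_low f l) m3 \<and> frame ?Y m2 m3"
        then have fr3: "frame ?Y m2 m3" by simp
        have m3t: "m3 vt = t" "m3 vM = M"
          using t by (simp_all add: frameD[OF fr3] frameD[OF fr2])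
        let ?m4 = "m3(vt := Suc t)"
        have "par m3" by (rule par_frame[OF par2 fr3]) auto
        then have "par ?m4" by (simp add: par_def)
        moreover have "weights (new_up f u) (new_low f l) ?m4" using h by (simp add: weights_def)
        ultimately have "?I (Suc t) ?m4 out3"
          using h tab inv' by blast
        then show "wp 10 (incr vt) (\<lambda>m' out'. ?I (Suc t) m' out' \<and> m' vt = Suc t \<and> m' vM = M) m3 out3"
          using m3t t MV by (intro wp_exec) (auto simp: expr_ok_def)
      qed
    qed
    have rest: "wp (800 * ?z + (500 * (?N * k) + 10)) (loop vi vn choose_prog ;; update_prog ;; incr vt)
      (\<lambda>m' out'. ?I (Suc t) m' out' \<and> m' vt = Suc t \<and> m' vM = M) ?m1 out'"
      by (rule wp_Seq, rule wp_conseq[OF wp_positions[OF par1 _ w1 tot]], simp, rule last)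
    have "max_cost (set_var vi (Const 0)) \<le> 10" by simp
    then have time: "max_cost (set_var vi (Const 0)) + (800 * ?z + (500 * (?N * k) + 10)) \<le> 1400 * ?z"
      using z by linarith
    show ?thesis
      by (rule wp_time[OF wp_Seq_exec time]) (use rest in \<open>simp add: expr_ok_def\<close>)
  qed
  have loop: "wp (M * (1400 * ?z + 6) + 6) (loop vt vM ?c)
    (\<lambda>m' out'. \<exists>fs. out' = out @ concat (map (value_table n) fs) \<and> family_ok fs) (m(vt := 0)) out"
  proof (rule wp_loop[where I = ?I])
    show "?I 0 (m(vt := 0)) out"
      using par w by (intro exI[of _ "[]"] exI[of _ "\<lambda>_. M"])
        (auto simp: par_def weights_def invar_def total_def)
    show "(m(vt := 0)) vM = M" using par by (simp add: par_def)
    show "\<exists>fs. out' = out @ concat (map (value_table n) fs) \<and> family_ok fs"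
      if "?I M m' out'" for m' out' using that unfolding family_ok_def by blast
  qed (rule body | simp)+
  have time: "max_cost (set_var vt (Const 0)) + (M * (1400 * ?z + 6) + 6) \<le> 1500 * (M * ?z)"
  proof -
    have "M * 1 \<le> M * ?z" using z(2) by (rule mult_le_mono2)
    moreover have "M * (1400 * ?z + 6) + 6 = 1400 * (M * ?z) + 6 * M + 6" by (simp add: algebra_simps)
    moreover have "max_cost (set_var vt (Const 0)) \<le> 10" by simp
    ultimately show ?thesis using M1 by linarith
  qed
  show ?thesis
    unfolding rounds_prog_def
    by (rule wp_time[OF wp_Seq_exec time]) (use loop in \<open>simp add: expr_ok_def\<close>)
qed

text \<open>A single weight is at most the total, so dividing by \<open>M\<close> bounds both trends
  of every subset by 4 (n choose k). The same T = p M then serves all subsets.\<close>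

lemma family_ok_balanced:
  assumes "family_ok fs" and \<delta>: "real E + 8 \<le> \<delta> * real E"
    and M: "(real E)\<^sup>2 * ln (4 * real (n choose k)) \<le> p * real M"
  shows "balanced_hash_family \<delta> n k (mset fs)" "length fs = M"
proof -
  obtain u l where inv: "invar M fs u l" using assms(1) by (auto simp: family_ok_def)
  then show len: "length fs = M" by (simp add: invar_def)
  define T where "T = p * real M"
  have "0 < T" using p_bounds M1 by (simp add: T_def)
  moreover have "T / \<delta> \<le> real (size (filter_mset (\<lambda>f. inj_on f S) (mset fs))) \<and>
      real (size (filter_mset (\<lambda>f. inj_on f S) (mset fs))) \<le> \<delta> * T"
    if S: "S \<subseteq> {1..n}" "card S = k" for S
  proof -
    have "S \<in> set ` {xs. decreasing n xs \<and> length xs = k}"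
      unfolding set_image_decreasing[where R = "\<lambda>c. c = k"] using S by simp
    then obtain j where j: "j < length Ls" "S = set (Ls ! j)"
      unfolding set_Ls[symmetric] by (auto simp: in_set_conv_nth)
    have "u j + l j \<le> total u l"
      unfolding total_def by (rule member_le_sum) (use j in auto)
    also have "\<dots> \<le> 4 * (n choose k) * M" using inv by (rule invar_total_le) simp
    finally have "real (u j + l j) \<le> real (4 * (n choose k) * M)" by (simp only: of_nat_le_iff)
    then have b: "real (u j) \<le> real M * (4 * real (n choose k))"
      "real (l j) \<le> real M * (4 * real (n choose k))" by (simp_all add: algebra_simps)
    have "real M * trend (1 / real E) p S fs \<le> real (u j)"
      "real M * trend (- 1 / real E) p S fs \<le> real (l j)"
      using inv j by (simp_all add: invar_def)
    then have "real M * trend (1 / real E) p S fs \<le> real M * (4 * real (n choose k))"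
      "real M * trend (- 1 / real E) p S fs \<le> real M * (4 * real (n choose k))"
      using b by linarith+
    then have trend: "trend (1 / real E) p S fs \<le> 4 * real (n choose k)"
      "trend (- 1 / real E) p S fs \<le> 4 * real (n choose k)"
      using M1 by (simp_all only: mult_le_cancel_left_pos of_nat_0_less_iff)
    have R: "1 \<le> 4 * real (n choose k)"
      using length_Ls_pos unfolding length_Ls by linarith
    have size: "size (filter_mset (\<lambda>f. inj_on f S) (mset fs)) = length (filter (\<lambda>f. inj_on f S) fs)"
      by (metis mset_filter size_mset)
    show ?thesis
      unfolding size T_def
      using trend_bounded_imp_balanced[OF E8 \<delta> _ p_bounds(2) R _ trend] M p_bounds(1) len by simp
  qed
  moreover have "\<forall>f \<in># mset fs. f \<in> {1..n} \<rightarrow>\<^sub>E {1..k}" using inv by (auto simp: invar_def)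
  ultimately show "balanced_hash_family \<delta> n k (mset fs)"
    unfolding balanced_hash_family_def by blast
qed

section \<open>Correctness of the enumeration of subsets\<close>

definition par0 :: "memory \<Rightarrow> bool" where
  "par0 m \<longleftrightarrow> m vn = n \<and> m vk = k \<and> m vb = base \<and> m vP = fact k \<and> m vq = k ^ k \<and>
    m vM = M \<and> m vD = k ^ k * E \<and> m vB = base ^ (k - 1)"

definition stored :: "nat list list \<Rightarrow> nat list list \<Rightarrow> memory \<Rightarrow> bool" where
  "stored es ls m \<longleftrightarrow> m vcnt = length es \<and> m vN = length ls \<and>
    (\<forall>j < length es. m (arr aent j) = code base (es ! j)) \<and>
    (\<forall>j < length ls. m (arr aleaf j) = code base (ls ! j) \<and>
       m (arr aup j) = M \<and> m (arr alow j) = M)"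

text \<open>The array in the middle of a round: \<open>Suc i\<close> has been tried on the first
  \<open>j\<close> entries that were present at the beginning of the round.\<close>

abbreviation ents_part :: "nat \<Rightarrow> nat \<Rightarrow> nat list list" where
  "ents_part i j \<equiv> ents k i @
     map ((#) (Suc i)) (filter (\<lambda>xs. Suc (length xs) < k) (take j (ents k i)))"

abbreviation leaves_part :: "nat \<Rightarrow> nat \<Rightarrow> nat list list" where
  "leaves_part i j \<equiv> leaves k i @
     map ((#) (Suc i)) (filter (\<lambda>xs. \<not> Suc (length xs) < k) (take j (ents k i)))"

lemma length_filter_take_le: "length (filter Q (take j xs)) \<le> length (filter Q xs)"
  by (metis append_take_drop_id filter_append le_add1 length_append)

lemma wp_gen_step:
  assumes par: "par0 m" and st: "stored (ents_part i j) (leaves_part i j) m"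
    and mi: "m vi = Suc i" "i < n" and mj: "m vj = j" "j < length (ents k i)"
    and mc: "m vcnt0 = c"
  shows "wp 100 gen_step (\<lambda>m' out'. out' = out \<and> par0 m' \<and>
    stored (ents_part i (Suc j)) (leaves_part i (Suc j)) m' \<and>
    m' vi = Suc i \<and> m' vj = Suc j \<and> m' vcnt0 = c) m out"
proof -
  define xs where "xs = ents k i ! j"
  have "xs \<in> set (ents k i)" using mj by (simp add: xs_def)
  then have xs: "set xs \<subseteq> {1..i}" "length xs < k" by (auto simp: set_ents[OF k1])
  have sub: "set (Suc i # xs) \<subseteq> {1..<base}" using xs mi(2) by (auto simp: base_def)
  have base1: "1 < base" using k1 kn by (simp add: base_def)
  \<comment> \<open>Entries are only appended, so position \<open>j\<close> still holds the list it
    held when the round began.\<close>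
  have "ents_part i j ! j = xs" using mj by (simp add: nth_append xs_def)
  then have mx: "m (arr aent j) = code base xs"
    using st mj unfolding stored_def by (metis length_append trans_less_add1)
  have cV: "code base xs * base + Suc i \<le> V"
  proof -
    have "code base (Suc i # xs) < base ^ length (Suc i # xs)" using sub by (rule code_less)
    also have "\<dots> \<le> base ^ k" using xs(2) base1 by (intro power_increasing) auto
    finally show ?thesis using V_pow by (simp add: base_def)
  qed
  have iff: "code base xs * base + Suc i < base ^ (k - 1) \<longleftrightarrow> Suc (length xs) < k"
    using code_less_iff[OF sub _ base1 k1] by simp
  have take: "take (Suc j) (ents k i) = take j (ents k i) @ [xs]"
    using mj by (simp add: take_Suc_conv_app_nth xs_def)
  have eP: "ents_part i (Suc j) = ents_part i j @ (if Suc (length xs) < k then [Suc i # xs] else [])"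
    "leaves_part i (Suc j) = leaves_part i j @ (if Suc (length xs) < k then [] else [Suc i # xs])"
    unfolding take by auto
  have "length (ents_part i (Suc j)) \<le> length (ents k (Suc i))"
    by (simp del: take_Suc add: length_filter_take_le)
  also have "\<dots> \<le> length (ents k n)" using mi(2) by (intro ents_mono) simp
  also have "\<dots> \<le> V" using length_ents_le[OF k1 kn] V_ents by linarith
  finally have eV: "length (ents_part i (Suc j)) \<le> V" .
  have "length (leaves_part i (Suc j)) \<le> length (leaves k (Suc i))"
    by (simp del: take_Suc add: length_filter_take_le)
  also have "\<dots> \<le> length (leaves k n)" using mi(2) by (intro leaves_mono) simp
  also have "\<dots> \<le> V" using length_Ls_V by (simp add: Ls_def)
  finally have lV: "length (leaves_part i (Suc j)) \<le> V" .
  define es where "es = ents_part i j"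
  define ls where "ls = leaves_part i j"
  have jV: "Suc j \<le> V" 
  proof -
    have "length (ents k i) \<le> length (ents k n)" using mi(2) by (intro ents_mono) simp
    then show ?thesis using mj(2) length_ents_le[OF k1 kn] V_ents by linarith
  qed
  have st': "stored es ls m" using st by (simp only: es_def ls_def)
  let ?c = "code base xs * base + Suc i"
  show ?thesis
    unfolding eP es_def[symmetric] ls_def[symmetric]
  proof (rule wp_exec)
    have p: "m vb = base" "m vB = base ^ (k - 1)" "m vM = M" "m vcnt = length es" "m vN = length ls"
      using par st' by (simp_all add: par0_def stored_def)
    show "exec_ok gen_step (\<lambda>m' out'. out' = out \<and> par0 m' \<and>
        stored (es @ (if Suc (length xs) < k then [Suc i # xs] else []))
          (ls @ (if Suc (length xs) < k then [] else [Suc i # xs])) m' \<and>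
        m' vi = Suc i \<and> m' vj = Suc j \<and> m' vcnt0 = c) m out"
    proof (cases "Suc (length xs) < k")
      case True
      let ?m = "m(vx := ?c, arr aent (length es) := ?c, vcnt := Suc (length es), vj := Suc j)"
      have "stored (es @ [Suc i # xs]) ls ?m"
        using st' by (auto simp: stored_def nth_append less_Suc_eq)
      moreover have "par0 ?m" using par by (simp add: par0_def)
      moreover have "Suc (length es) \<le> V" using eV True unfolding eP es_def[symmetric] by simp
      moreover have "?c < base ^ (k - 1)" using True iff by simp
      ultimately show ?thesis
        using True cV jV mi mj mc by (simp add: gen_step_def expr_ok_def p mx)
    next
      case False
      let ?m = "m(vx := ?c, arr aleaf (length ls) := ?c, arr aup (length ls) := M,
        arr alow (length ls) := M, vN := Suc (length ls), vj := Suc j)"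
      have "stored es (ls @ [Suc i # xs]) ?m"
        using st' by (auto simp: stored_def nth_append less_Suc_eq)
      moreover have "par0 ?m" using par by (simp add: par0_def)
      moreover have "Suc (length ls) \<le> V" using lV False unfolding eP ls_def[symmetric] by simp
      moreover have "\<not> ?c < base ^ (k - 1)" using False iff by simp
      ultimately show ?thesis
        using False cV jV mi mj mc MV by (simp add: gen_step_def expr_ok_def p mx)
    qed
  qed (simp add: gen_step_def)
qed

text \<open>Each of the n rounds scans at most as many entries as there are in the end, and
  \<open>length_ents_le\<close> bounds these.\<close>

lemma wp_gen:
  assumes par: "par0 m"
  shows "wp (200 * (n * (2 ^ k * length Ls))) gen_prog
    (\<lambda>m' out'. out' = out \<and> par m' \<and> weights (\<lambda>_. M) (\<lambda>_. M) m') m out"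
proof -
  define K where "K = 2 ^ k * length Ls"
  have K: "1 \<le> K" using length_Ls_pos by (simp add: K_def)
  let ?I = "\<lambda>i m' out'. out' = out \<and> par0 m' \<and> stored (ents k i) (leaves k i) m'"
  let ?body = "(incr vi ;; set_var vcnt0 (Var vcnt) ;; set_var vj (Const 0)) ;; loop vj vcnt0 gen_step"
  have nV: "n \<le> V" using n_less_V by simp
  have body: "wp (K * 106 + 50) ?body
      (\<lambda>m' out'. ?I (Suc i) m' out' \<and> m' vi = Suc i \<and> m' vn = n) m' out'"
    if I: "?I i m' out'" and i: "m' vi = i" "m' vn = n" "i < n" for i m' out'
  proof -
    define c where "c = length (ents k i)"
    have "c \<le> length (ents k n)" unfolding c_def using i(3) by (intro ents_mono) simp
    then have cK: "c \<le> K" using length_ents_le[OF k1 kn] by (simp add: K_def length_Ls)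
    then have cV: "c \<le> V" using V_ents by (simp add: K_def length_Ls)
    have mc: "m' vcnt = c" using I by (simp add: stored_def c_def)
    let ?m1 = "m'(vi := Suc i, vcnt0 := c, vj := 0)"
    have inner: "wp (c * (100 + 6) + 6) (loop vj vcnt0 gen_step)
      (\<lambda>m' out'. ?I (Suc i) m' out' \<and> m' vi = Suc i \<and> m' vn = n) ?m1 out"
    proof (rule wp_loop[where I = "\<lambda>j m' out'. out' = out \<and> par0 m' \<and>
        stored (ents_part i j) (leaves_part i j) m' \<and> m' vi = Suc i"])
      fix j m2 out2
      assume J: "out2 = out \<and> par0 m2 \<and> stored (ents_part i j) (leaves_part i j) m2 \<and> m2 vi = Suc i"
        and j: "m2 vj = j" "m2 vcnt0 = c" "j < c"
      then show "wp 100 gen_step (\<lambda>m' out'. (out' = out \<and> par0 m' \<and>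
          stored (ents_part i (Suc j)) (leaves_part i (Suc j)) m' \<and> m' vi = Suc i) \<and>
          m' vj = Suc j \<and> m' vcnt0 = c) m2 out2"
        using i(3) by (intro wp_conseq[OF wp_gen_step[of m2 i j c]]) (auto simp: c_def)
    next
      show "out = out \<and> par0 ?m1 \<and> stored (ents_part i 0) (leaves_part i 0) ?m1 \<and> ?m1 vi = Suc i"
        using I by (simp add: par0_def stored_def)
      fix m2 out2
      assume "out2 = out \<and> par0 m2 \<and> stored (ents_part i c) (leaves_part i c) m2 \<and> m2 vi = Suc i"
      then show "?I (Suc i) m2 out2 \<and> m2 vi = Suc i \<and> m2 vn = n"
        by (simp add: c_def par0_def)
    qed simp_all
    have "c * (100 + 6) \<le> K * 106" using cK by simp
    then have time: "max_cost (incr vi ;; set_var vcnt0 (Var vcnt) ;; set_var vj (Const 0)) +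
        (c * (100 + 6) + 6) \<le> K * 106 + 50" by simp
    show ?thesis
      by (rule wp_time[OF wp_Seq_exec time]) (use inner i I mc cV nV in \<open>simp add: expr_ok_def\<close>)
  qed
  let ?m0 = "m(arr aent 0 := 0, vcnt := 1, vN := 0, vi := 0)"
  have loop: "wp (n * ((K * 106 + 50) + 6) + 6) (loop vi vn ?body)
      (\<lambda>m' out'. out' = out \<and> par m' \<and> weights (\<lambda>_. M) (\<lambda>_. M) m') ?m0 out"
  proof (rule wp_loop[where I = ?I])
    show "?I 0 ?m0 out" using par by (simp add: par0_def stored_def)
    show "?m0 vn = n" using par by (simp add: par0_def)
    show "out' = out \<and> par m' \<and> weights (\<lambda>_. M) (\<lambda>_. M) m'" if "?I n m' out'" for m' out'
      using that by (simp add: par0_def stored_def par_def weights_def Ls_def)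
  qed (rule body | simp)+
  have time: "max_cost (Assign (Arr aent (Const 0)) (Const 0) ;; set_var vcnt (Const 1) ;;
      set_var vN (Const 0) ;; set_var vi (Const 0)) + (n * ((K * 106 + 50) + 6) + 6) \<le> 200 * (n * K)"
  proof -
    have "n * 1 \<le> n * K" using K by (rule mult_le_mono2)
    moreover have "n * ((K * 106 + 50) + 6) + 6 = 106 * (n * K) + 56 * n + 6" by (simp add: algebra_simps)
    moreover have "max_cost (Assign (Arr aent (Const 0)) (Const 0) ;; set_var vcnt (Const 1) ;;
      set_var vN (Const 0) ;; set_var vi (Const 0)) \<le> 30" by simp
    ultimately show ?thesis using Nk_mono(5) by linarith
  qed
  have "1 \<le> V" using n_less_V by simp
  then show ?thesis
    unfolding gen_prog_def K_def[symmetric]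
    by (intro wp_time[OF wp_Seq_exec time]) (use loop in \<open>simp add: expr_ok_def\<close>)
qed

end

section \<open>Computation of the parameters\<close>

locale hashing_setup = hashing +
  fixes a :: nat
  assumes E_le: "real E + 8 \<le> \<delta> * real E"
    and E_min: "\<And>e. 8 \<le> e \<Longrightarrow> e < E \<Longrightarrow> \<not> real e + 8 \<le> \<delta> * real e"
    and a_gt: "n < 2 ^ a" and a_min: "\<And>a'. a' < a \<Longrightarrow> 2 ^ a' \<le> n"
    and M_def: "M = k ^ k * E * E * (2 + k * a) div fact k + 1"
    and V_l: "2 + k * a \<le> V" and V_2n: "2 * n \<le> V"
begin

lemma E_le_V: "E \<le> V"
proof -
  have "1 * E \<le> k ^ k * E" using k1 by (intro mult_le_mono1) simp
  then show ?thesis using V_E by linarith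
qed

lemma wp_setup:
  "wp (40 * E + 100 * k + 60 * a + 300) setup_prog (\<lambda>m' out'. out' = [] \<and> par0 m')
    ((\<lambda>_. 0)(0 := n, 1 := k)) []"
proof -
  let ?in = "(\<lambda>_. 0)(0 := n, 1 := k) :: memory"
  define Pin where "Pin m \<longleftrightarrow> m vn = n \<and> m vk = k \<and> m vb = base" for m :: memory
  let ?Q = "\<lambda>m' out'. out' = ([] :: nat list) \<and> par0 m'"
  let ?c6 = "set_var vD (Op Times (Var vq) (Var vE)) ;;
     set_var vM (Op Plus (Op Divide (Op Times (Op Times (Var vD) (Var vE)) (Var vl)) (Var vP)) (Const 1))"
  let ?R5 = "\<lambda>m out. out = ([] :: nat list) \<and> Pin m \<and> m vE = E \<and> m vP = fact k \<and> m vq = k ^ k \<and>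
    m vB = base ^ (k - 1) \<and> m vl = 2 + k * a"
  \<comment> \<open>The stages are treated from the last to the first, because the precondition of
    the remaining stages is the postcondition of the one before.\<close>
  have s6: "wp 30 ?c6 ?Q m out" if "?R5 m out" for m out
  proof (rule wp_exec)
    show "exec_ok ?c6 ?Q m out"
      using that MV V_E M_def[symmetric] by (simp add: expr_ok_def Pin_def par0_def)
  qed simp
  let ?c5 = "set_var vx (Op Times (Const 2) (Var vx)) ;; set_var vl (Op Plus (Var vl) (Var vk))"
  let ?w5 = "While (Neg (Less (Var vn) (Var vx))) ?c5"
  let ?J5 = "\<lambda>p m out. \<exists>a'. p = a - a' \<and> a' \<le> a \<and> out = ([] :: nat list) \<and> Pin m \<and> m vE = E \<and> m vP = fact k \<and>
    m vq = k ^ k \<and> m vB = base ^ (k - 1) \<and> m vx = 2 ^ a' \<and> m vl = 2 + k * a'"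
  have s5: "wp (a * 30 + 10) ?w5 ?R5 m out" if J: "?J5 a m out" for m out
  proof (rule wp_time)
    let ?b = "Neg (Less (Var vn) (Var vx))"
    show "wp (a * (20 + test_cost ?b + 1) + test_cost ?b + 1) ?w5 ?R5 m out"
    proof (rule wp_While[where I = ?J5 and p = a])
      fix p m out
      assume "?J5 p m out" "test_val \<delta> m ?b"
      then obtain a' where a': "p = a - a'" "a' \<le> a" "out = []" "Pin m" "m vE = E" "m vP = fact k"
        "m vq = k ^ k" "m vB = base ^ (k - 1)" "m vx = 2 ^ a'" "m vl = 2 + k * a'" "2 ^ a' \<le> n"
        by (auto simp: Pin_def)
      \<comment> \<open>The test has passed, so 2^a' <= n < 2^a. It also keeps the doubled power
        within 2 n.\<close>
      have "a' < a" using a'(2,11) a_gt by (cases "a' = a") auto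
      then have "k * Suc a' \<le> k * a" by (intro mult_le_mono2) simp
      then have V: "2 * 2 ^ a' \<le> V" "2 + (k * a' + k) \<le> V" using a'(11) V_2n V_l by simp_all
      have "?J5 (a - Suc a') (m(vx := 2 * 2 ^ a', vl := 2 + k * Suc a')) out"
        using a' \<open>a' < a\<close> by (intro exI[of _ "Suc a'"]) (simp add: Pin_def)
      moreover have "a - Suc a' < p" using a' \<open>a' < a\<close> by simp
      ultimately have "\<exists>p'<p. ?J5 p' (m(vx := 2 * 2 ^ a', vl := 2 + k * Suc a')) out" by blast
      then show "wp 20 ?c5 (\<lambda>m' out'. \<exists>p'<p. ?J5 p' m' out') m out"
        using V a' by (intro wp_exec) (simp_all add: expr_ok_def Pin_def add_ac)
    next
      fix p m out
      assume "?J5 p m out" "\<not> test_val \<delta> m ?b"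
      then obtain a' where a': "a' \<le> a" "n < 2 ^ a'" "m vl = 2 + k * a'"
        and r: "out = ([] :: nat list) \<and> Pin m \<and> m vE = E \<and> m vP = fact k \<and> m vq = k ^ k \<and> m vB = base ^ (k - 1)"
        by (auto simp: Pin_def)
      have "a' = a" using a' a_min[of a'] by (cases "a' < a") auto
      then show "?R5 m out" using a' r by simp
    qed (use J in \<open>auto simp: expr_ok_def\<close>)
  qed simp
  let ?c4 = "set_var vB (Op Divide (Var vB) (Var vb)) ;; set_var vx (Const 1) ;; set_var vl (Const 2)"
  let ?R3 = "\<lambda>j m out. out = ([] :: nat list) \<and> Pin m \<and> m vE = E \<and> m vP = fact j \<and> m vq = k ^ j \<and> m vB = base ^ j"
  have t4: "wp (a * 30 + 60) (?c4 ;; ?w5 ;; ?c6) ?Q m out" if R: "?R3 k m out" for m out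
  proof (rule wp_time[OF wp_Seq_exec])
    have b: "base ^ k div base = base ^ (k - 1)"
    proof -
      have "0 < base" by (simp add: base_def)
      then show ?thesis using k1 by (cases k) simp_all
    qed
    have bV: "base ^ (k - 1) \<le> V"
    proof -
      have "base ^ (k - 1) \<le> base ^ k" by (intro power_increasing) (auto simp: base_def)
      then show ?thesis using V_pow by (simp add: base_def)
    qed
    let ?m = "m(vB := base ^ (k - 1), vx := 1, vl := 2)"
    have "?J5 a ?m out" using R by (intro exI[of _ 0]) (simp add: Pin_def)
    then have "wp (a * 30 + 10 + 30) (?w5 ;; ?c6) ?Q ?m out"
      by (intro wp_Seq) (rule wp_conseq[OF s5 s6])
    moreover have "2 \<le> V" using V_ge by simp
    ultimately show "exec_ok ?c4 (wp (a * 30 + 10 + 30) (?w5 ;; ?c6) ?Q) m out"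
      using R b bV by (simp add: expr_ok_def Pin_def)
  qed simp
  let ?c3 = "incr vj ;; set_var vP (Op Times (Var vP) (Var vj)) ;;
        set_var vq (Op Times (Var vq) (Var vk)) ;; set_var vB (Op Times (Var vB) (Var vb))"
  have s3: "wp (k * (30 + 6) + 6) (loop vj vk ?c3) (?R3 k) m out" if R: "?R3 0 m out" "m vj = 0" for m out
  proof (rule wp_loop[where I = ?R3])
    fix j m out
    assume R: "?R3 j m out" and j: "m vj = j" "m vk = k" "j < k"
    have V: "fact (Suc j) \<le> V" "k ^ Suc j \<le> V" "base ^ Suc j \<le> V" "Suc j \<le> V"
    proof -
      have "(fact (Suc j) :: nat) \<le> fact k" using j by (intro fact_mono) simp
      also have "\<dots> \<le> k ^ k" using fact_mult_power_le[of 0 k] by simp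
      finally show "fact (Suc j) \<le> V" using k_pow_V by linarith
      have "k ^ Suc j \<le> k ^ k" using j k1 by (intro power_increasing) auto
      then show "k ^ Suc j \<le> V" using k_pow_V by linarith
      have "base ^ Suc j \<le> base ^ k" using j by (intro power_increasing) (auto simp: base_def)
      then show "base ^ Suc j \<le> V" using V_pow by (simp add: base_def)
      show "Suc j \<le> V" using j k_le_V by simp
    qed
    let ?m = "m(vj := Suc j, vP := fact (Suc j), vq := k ^ Suc j, vB := base ^ Suc j)"
    have "?R3 (Suc j) ?m out \<and> ?m vj = Suc j \<and> ?m vk = k" using R j by (simp add: Pin_def)
    then show "wp 30 ?c3 (\<lambda>m' out'. ?R3 (Suc j) m' out' \<and> m' vj = Suc j \<and> m' vk = k) m out"
      using R j V by (intro wp_exec) (simp_all add: expr_ok_def Pin_def mult_ac)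
  qed (use R in \<open>auto simp: Pin_def\<close>)
  let ?c2 = "set_var vP (Const 1) ;; set_var vq (Const 1) ;; set_var vB (Const 1) ;; set_var vj (Const 0)"
  let ?t3 = "k * (30 + 6) + 6 + (a * 30 + 60)"
  have t2: "wp (k * 36 + a * 30 + 100) (?c2 ;; loop vj vk ?c3 ;; ?c4 ;; ?w5 ;; ?c6) ?Q m out"
    if R: "out = ([] :: nat list) \<and> Pin m \<and> m vE = E" for m out
  proof (rule wp_time[OF wp_Seq_exec])
    let ?m = "m(vP := 1, vq := 1, vB := 1, vj := 0)"
    have "?R3 0 ?m out" "?m vj = 0" using R by (simp_all add: Pin_def)
    then have "wp ?t3 (loop vj vk ?c3 ;; ?c4 ;; ?w5 ;; ?c6) ?Q ?m out"
      by (intro wp_Seq) (rule wp_conseq[OF s3 t4])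
    then show "exec_ok ?c2 (wp ?t3 (loop vj vk ?c3 ;; ?c4 ;; ?w5 ;; ?c6) ?Q) m out"
      using V_ge by (simp add: expr_ok_def)
  qed simp
  let ?b1 = "Neg (LeDelta (Op Plus (Var vE) (Const 8)) (Var vE))"
  let ?J1 = "\<lambda>p m out. p = E - m vE \<and> 8 \<le> m vE \<and> m vE \<le> E \<and> out = ([] :: nat list) \<and> Pin m"
  let ?R1 = "\<lambda>m out. out = ([] :: nat list) \<and> Pin m \<and> m vE = E"
  have s1: "wp (E * 30 + 30) (While ?b1 (incr vE)) ?R1 m out"
    if J: "?J1 (E - 8) m out" for m out
  proof (rule wp_time)
    show "wp (E * (10 + test_cost ?b1 + 1) + test_cost ?b1 + 1) (While ?b1 (incr vE)) ?R1 m out"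
    proof (rule wp_While[where I = ?J1 and p = "E - 8"])
      fix p m out
      assume J: "?J1 p m out" and t: "test_val \<delta> m ?b1"
      have "m vE \<noteq> E" using t E_le by auto
      then show "wp 10 (incr vE) (\<lambda>m' out'. \<exists>p'<p. ?J1 p' m' out') m out"
        using J E_le_V by (intro wp_exec) (auto simp: expr_ok_def Pin_def)
    next
      fix p m out
      assume J: "?J1 p m out" and t: "\<not> test_val \<delta> m ?b1"
      then show "?R1 m out" using E_min[of "m vE"] by (cases "m vE < E") auto
    qed (use J in \<open>auto simp: expr_ok_def\<close>)
  qed simp
  let ?c0 = "set_var vn (Var 0) ;; set_var vk (Var 1) ;; set_var vb (Op Plus (Var 0) (Const 1)) ;;
      set_var vE (Const 8)"
  let ?rest = "While ?b1 (incr vE) ;; ?c2 ;; loop vj vk ?c3 ;; ?c4 ;; ?w5 ;; ?c6"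
  let ?t1 = "E * 30 + 30 + (k * 36 + a * 30 + 100)"
  show ?thesis
    unfolding setup_prog_def
  proof (rule wp_time[OF wp_Seq_exec])
    let ?m = "?in(vn := n, vk := k, vb := base, vE := 8)"
    have "?J1 (E - 8) ?m []" using E8 by (simp add: Pin_def)
    then have "wp ?t1 ?rest ?Q ?m []"
      by (intro wp_Seq) (rule wp_conseq[OF s1 t2])
    then show "exec_ok ?c0 (wp ?t1 ?rest ?Q) ?in []"
      using V_ge n_less_V k_le_V by (simp add: expr_ok_def base_def)
  qed simp
qed

lemma wp_balanced_prog:
  "wp (40 * E + 100 * k + 60 * a + 300 +
      (200 * (n * (2 ^ k * length Ls)) + 1500 * (M * (n * (length Ls * k * k))))) balanced_prog
    (\<lambda>m' out'. \<exists>fs. out' = concat (map (value_table n) fs) \<and> family_ok fs)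
    ((\<lambda>_. 0)(0 := n, 1 := k)) []"
proof -
  have rounds: "wp (1500 * (M * (n * (length Ls * k * k)))) rounds_prog
      (\<lambda>m' out'. \<exists>fs. out' = concat (map (value_table n) fs) \<and> family_ok fs) m out"
    if "out = [] \<and> par m \<and> weights (\<lambda>_. M) (\<lambda>_. M) m" for m out
    using that wp_rounds[of m "[]"] by simp
  have rest: "wp (200 * (n * (2 ^ k * length Ls)) + 1500 * (M * (n * (length Ls * k * k))))
      (gen_prog ;; rounds_prog)
      (\<lambda>m' out'. \<exists>fs. out' = concat (map (value_table n) fs) \<and> family_ok fs) m out"
    if "out = [] \<and> par0 m" for m out
    using that by (intro wp_Seq wp_conseq[OF wp_gen rounds]) auto
  show ?thesis
    unfolding balanced_prog_def by (rule wp_Seq, rule wp_conseq[OF wp_setup], rule rest)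
qed

end

section \<open>Choice of the parameters\<close>

text \<open>\<open>E\<close> is the least number from 8 on with 8 <= (\<delta> - 1) E. If it exceeds
  8, minimality gives (E - 1) (\<delta> - 1) < 8, hence E (\<delta> - 1) < 9 because \<delta> - 1 <=
  1; if it is 8, the bound holds because \<delta> <= 2. The last clause identifies it as the point
  where the linear search stops.\<close>

lemma ex_resolution:
  assumes "1 < \<delta>" "\<delta> \<le> (2 :: real)"
  obtains E :: nat where "8 \<le> E" "real E + 8 \<le> \<delta> * real E" "real E \<le> 9 / (\<delta> - 1)"
    "\<And>e. 8 \<le> e \<Longrightarrow> e < E \<Longrightarrow> \<not> real e + 8 \<le> \<delta> * real e"
proof -
  let ?P = "\<lambda>e :: nat. 8 \<le> e \<and> real e + 8 \<le> \<delta> * real e"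
  define E where "E = (LEAST e. ?P e)"
  have d: "0 < \<delta> - 1" "\<delta> - 1 \<le> 1" using assms by auto
  obtain e :: nat where e: "8 / (\<delta> - 1) \<le> real e" using real_arch_simple by blast
  have "?P e"
  proof -
    have "8 \<le> real e * (\<delta> - 1)" using e d by (simp add: divide_le_eq)
    moreover have "8 \<le> 8 / (\<delta> - 1)" using d by (simp add: le_divide_eq)
    then have "8 \<le> real e" using e by linarith
    ultimately show ?thesis by (simp add: algebra_simps)
  qed
  then have P: "?P E" unfolding E_def by (rule LeastI)
  have min: "\<not> ?P e" if "e < E" for e using that unfolding E_def by (rule not_less_Least)
  have "real E \<le> 9 / (\<delta> - 1)"
  proof (cases "E = 8")
    case True
    then show ?thesis using d by (simp add: le_divide_eq)
  next
    case False
    then have e: "8 \<le> E - 1" "E - 1 < E" "real (E - 1) = real E - 1" using P by auto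
    with min[OF e(2)] have "(real E - 1) * (\<delta> - 1) < 8" by (simp add: algebra_simps)
    then have "real E * (\<delta> - 1) \<le> 9" using d by (simp add: algebra_simps)
    then show ?thesis using d by (simp add: le_divide_eq)
  qed
  with P min show thesis by (intro that) auto
qed

lemma ex_binary_length:
  fixes n :: nat
  assumes "1 \<le> n"
  obtains a :: nat where "n < 2 ^ a" "2 ^ a \<le> 2 * n" "\<And>a'. a' < a \<Longrightarrow> 2 ^ a' \<le> n"
proof -
  define a where "a = (LEAST a. n < 2 ^ a)"
  have lt: "n < 2 ^ a" unfolding a_def by (rule LeastI[of _ n]) (rule less_exp)
  have min: "2 ^ a' \<le> n" if "a' < a" for a'
    using not_less_Least[of a' "\<lambda>a. n < 2 ^ a"] that unfolding a_def by simp
  have "2 ^ a \<le> 2 * n"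
  proof (cases a)
    case 0
    then show ?thesis using lt assms by simp
  next
    case (Suc b)
    then show ?thesis using min[of b] by simp
  qed
  with lt min show thesis by (intro that) auto
qed

lemma log_pos_ge: "1 \<le> log_pos n" "log 2 (real n) \<le> log_pos n"
  by (simp_all add: log_pos_def)

text \<open>The 648 is 2 * 9^2 * 4: a factor 2 for the summand 1 in the number of rounds, 9 /
  (\<delta> - 1) as bound on E, and 4 k \<open>log_pos n\<close> as bound on 2 + k a. The word
  length is at most 64 log V + 1 with log V <= 19 + 10 k log n + 2 log (1 / (\<delta> - 1)), all
  logarithms binary, whence 1300. In the time constant the term 1500 * 648 dominates.\<close>

lemma balanced_prog_computes:
  assumes k1: "1 \<le> k" and kn: "k \<le> n" and d1: "1 < \<delta>" and d2: "\<delta> \<le> 2"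
  shows "\<exists>fs w. balanced_hash_family \<delta> n k (mset fs) \<and>
    real (length fs) \<le> 648 * (exp (real k) * sqrt (real k) * log_pos n / (\<delta> - 1)\<^sup>2) \<and>
    admissible_word_length 1300 n k \<delta> w \<and>
    outputs_within \<delta> w balanced_prog n k
      (1000000 * (real (n choose k) *
        (exp (real k) * real k ^ 3 * real n * log_pos n / (\<delta> - 1)\<^sup>2)))
      (concat (map (value_table n) fs))"
proof -
  have n1: "1 \<le> n" using k1 kn by simp
  obtain E where E: "8 \<le> E" "real E + 8 \<le> \<delta> * real E" "real E \<le> 9 / (\<delta> - 1)"
    and E_min: "\<And>e. 8 \<le> e \<Longrightarrow> e < E \<Longrightarrow> \<not> real e + 8 \<le> \<delta> * real e"
    using ex_resolution[OF d1 d2] by blast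
  obtain a where a: "n < 2 ^ a" "2 ^ a \<le> 2 * n" and a_min: "\<And>a'. a' < a \<Longrightarrow> 2 ^ a' \<le> n"
    using ex_binary_length[OF n1] by blast
  define l where "l = 2 + k * a"
  define M where M_eq: "M = k ^ k * E * E * l div fact k + 1"
  define N where "N = n choose k"
  \<comment> \<open>\<open>B\<close> dominates n + 1, k^k, 2^k and (n choose k), so all size
    conditions reduce to monomials in \<open>B\<close> and \<open>E\<close>. The largest, 4 (n
    choose k) M k^k, is at most 20 B^5 E^2.\<close>
  define B where "B = (n + 1) ^ k"
  define V where "V = 64 * B ^ 5 * E\<^sup>2"
  have a2n: "a \<le> 2 * n" using a(2) less_exp[of a] by linarith
  have nB: "n + 1 \<le> B"
  proof -
    have "(n + 1) ^ 1 \<le> (n + 1) ^ k" using k1 by (intro power_increasing) auto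
    then show ?thesis by (simp add: B_def)
  qed
  have kB: "k ^ k \<le> B" unfolding B_def using kn by (intro power_mono) auto
  have NB: "N \<le> B"
  proof -
    have "N \<le> n ^ k" unfolding N_def using kn by (rule binomial_le_pow)
    also have "\<dots> \<le> B" unfolding B_def by (intro power_mono) auto
    finally show ?thesis .
  qed
  have twoB: "2 ^ k \<le> B" unfolding B_def using n1 by (intro power_mono) auto
  have B1: "1 \<le> B" using nB by simp
  have N1: "1 \<le> N" using kn by (simp add: N_def Suc_le_eq zero_less_binomial_iff)
  have lB: "l \<le> 4 * B\<^sup>2"
  proof -
    have "k * a \<le> B * (2 * B)" using kn a2n nB by (intro mult_le_mono) auto
    then have "k * a \<le> 2 * (B * B)" by simp
    moreover have "1 * 1 \<le> B * B" using B1 by (intro mult_le_mono) auto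
    ultimately show ?thesis unfolding l_def power2_eq_square by linarith
  qed
  have MB: "M \<le> 5 * B ^ 3 * E\<^sup>2"
  proof -
    have "k ^ k * E * E * l div fact k \<le> k ^ k * E * E * l" by simp
    also have "\<dots> \<le> B * E * E * (4 * B\<^sup>2)" using kB lB by (intro mult_le_mono) auto
    also have "\<dots> = 4 * (B ^ 3 * E\<^sup>2)" by (simp add: power2_eq_square power3_eq_cube)
    finally have "M \<le> 4 * (B ^ 3 * E\<^sup>2) + 1" by (simp add: M_eq)
    moreover have "1 * 1 \<le> B ^ 3 * E\<^sup>2" using B1 E(1) by (intro mult_le_mono) auto
    ultimately have "M \<le> 5 * (B ^ 3 * E\<^sup>2)" by linarith
    then show ?thesis by (simp only: mult.assoc)
  qed
  have V_mono: "c * B ^ i * E ^ j \<le> V" if "c \<le> 64" "i \<le> 5" "j \<le> 2" for c i j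
    unfolding V_def using that B1 E(1) by (intro mult_le_mono power_increasing) auto
  \<comment> \<open>Admissibility bounds the word length from above, so the least possible one is
    taken.\<close>
  define w where "w = (LEAST w. V ^ 64 < 2 ^ w)"
  have Vw: "V ^ 64 < 2 ^ w" unfolding w_def by (rule LeastI[of _ "V ^ 64"]) (rule less_exp)
  interpret hashing_setup \<delta> w V n k E M a
  proof
    show "64 \<le> V" using V_mono[of 64 0 0] by simp
    show "V ^ 64 < 2 ^ w" by (rule Vw)
    show "(n + 1) ^ k \<le> V" using V_mono[of 1 1 0] by (simp add: B_def)
    have "k ^ k * E \<le> B * E" using kB by (rule mult_le_mono1)
    also have "\<dots> \<le> V" using V_mono[of 1 1 1] by simp
    finally show "k ^ k * E \<le> V" .
    have "4 * N * M * k ^ k \<le> 4 * B * (5 * B ^ 3 * E\<^sup>2) * B"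
      using NB MB kB by (intro mult_le_mono) auto
    also have "\<dots> = 20 * (B * B ^ 3 * B) * E ^ 2" by simp
    also have "B * B ^ 3 * B = B ^ 5" by (simp add: eval_nat_numeral mult_ac)
    also have "20 * B ^ 5 * E ^ 2 \<le> V" by (rule V_mono) auto
    finally show "4 * (n choose k) * M * k ^ k \<le> V" by (simp add: N_def)
    have "2 ^ k * N \<le> B * B" using twoB NB by (rule mult_le_mono)
    also have "\<dots> \<le> V" using V_mono[of 1 2 0] by (simp add: power2_eq_square)
    finally show "2 ^ k * (n choose k) \<le> V" by (simp add: N_def)
    show "2 + k * a \<le> V" using lB V_mono[of 4 2 0] by (simp add: l_def)
    show "2 * n \<le> V" using nB V_mono[of 2 1 0] by simp
    show "M = k ^ k * E * E * (2 + k * a) div fact k + 1" by (simp add: M_eq l_def)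
    show "1 \<le> M" by (simp add: M_eq)
  qed (use k1 kn E E_min a a_min in auto)
  have pM: "(real E)\<^sup>2 * real l \<le> p * real M"
  proof -
    have "real (k ^ k * E * E * l) / real (fact k) < real (k ^ k * E * E * l div fact k) + 1"
      by (metis floor_divide_of_nat_eq of_int_of_nat_eq real_of_int_floor_add_one_gt)
    then have "real (k ^ k * E * E * l) / real (fact k) \<le> real M" by (simp add: M_eq)
    then have "p * (real (k ^ k * E * E * l) / real (fact k)) \<le> p * real M"
      using p_bounds(1) by (intro mult_left_mono) auto
    moreover have "p * (real (k ^ k * E * E * l) / real (fact k)) = (real E)\<^sup>2 * real l"
      using k1 by (simp add: p_def power2_eq_square)
    ultimately show ?thesis by simp
  qed
  \<comment> \<open>(n choose k) <= n^k <= 2^(k a) gives 4 (n choose k) <= 2^l, and ln 2 < 1 passes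
    to the natural logarithm.\<close>
  have lnN: "ln (4 * real N) \<le> real l"
  proof -
    have "N \<le> n ^ k" unfolding N_def using kn by (rule binomial_le_pow)
    also have "\<dots> \<le> (2 ^ a) ^ k" using a(1) by (intro power_mono) auto
    finally have "4 * N \<le> 2 ^ l" by (simp add: l_def power_add power_mult[symmetric] mult.commute)
    then have "real (4 * N) \<le> real (2 ^ l)" by (simp only: of_nat_le_iff)
    then have "ln (4 * real N) \<le> ln (2 ^ l)" using N1 by (subst ln_le_cancel_iff) auto
    also have "\<dots> = real l * ln 2" by (simp add: ln_realpow)
    also have "\<dots> \<le> real l * 1" using ln_2_less_1 by (intro mult_left_mono) auto
    finally show ?thesis by simp
  qed
  have M_cond: "(real E)\<^sup>2 * ln (4 * real (n choose k)) \<le> p * real M"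
    using mult_left_mono[OF lnN, of "(real E)\<^sup>2"] pM by (simp add: N_def)
  define d where "d = \<delta> - 1"
  have d: "0 < d" "d \<le> 1" using d1 d2 by (auto simp: d_def)
  have Ed: "real E \<le> 9 / d" using E(3) by (simp add: d_def)
  have lP: "1 \<le> log_pos n" "log 2 (real n) \<le> log_pos n" by (rule log_pos_ge)+
  have al: "real a \<le> 1 + log 2 (real n)"
  proof -
    have "real (2 ^ a) \<le> real (2 * n)" using a(2) by (simp only: of_nat_le_iff)
    then have "log 2 (2 ^ a) \<le> log 2 (2 * real n)" using n1 by (subst log_le_cancel_iff) auto
    then show ?thesis using n1 by (simp add: log_mult log_nat_power)
  qed
  have l_le: "real l \<le> 4 * (real k * log_pos n)"
  proof -
    have "real k * real a \<le> real k * (2 * log_pos n)"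
      using al lP by (intro mult_left_mono) auto
    moreover have "1 * 1 \<le> real k * log_pos n" using k1 lP(1) by (intro mult_mono) auto
    ultimately show ?thesis by (simp add: l_def)
  qed
  have M_le: "real M \<le> 648 * (exp (real k) * sqrt (real k) * log_pos n / d\<^sup>2)"
  proof -
    let ?r = "real k ^ k / fact k"
    have r1: "1 \<le> ?r"
      using p_bounds k1 by (simp add: p_def field_simps)
    \<comment> \<open>The main term of \<open>M\<close> is at least 1, so doubling it absorbs the
      summand 1.\<close>
    have "1 * (1 * 1) \<le> ?r * ((real E)\<^sup>2 * real l)"
      using r1 E(1) by (intro mult_mono) (auto simp: l_def)
    moreover have "real M \<le> ?r * ((real E)\<^sup>2 * real l) + 1"
    proof -
      have "real (k ^ k * E * E * l div fact k) \<le> real (k ^ k * E * E * l) / real (fact k)"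
        by (rule of_nat_div_le_of_nat)
      then show ?thesis by (simp add: M_eq power2_eq_square mult_ac)
    qed
    ultimately have "real M \<le> 2 * (?r * ((real E)\<^sup>2 * real l))" by linarith
    also have "\<dots> \<le> 2 * (exp (real k) / sqrt (real k) * ((9 / d)\<^sup>2 * (4 * (real k * log_pos n))))"
      using power_div_fact_le[OF k1] Ed l_le lP(1)
      by (intro mult_left_mono mult_mono power_mono) auto
    also have "\<dots> = 648 * (exp (real k) * (real k / sqrt (real k)) * log_pos n / d\<^sup>2)"
      by (simp add: power_divide)
    also have "real k / sqrt (real k) = sqrt (real k)" by (rule real_div_sqrt) simp
    finally show ?thesis .
  qed
  let ?t = "40 * E + 100 * k + 60 * a + 300 +
      (200 * (n * (2 ^ k * length Ls)) + 1500 * (M * (n * (length Ls * k * k))))"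
  have bin: "bounded_by ((\<lambda>_. 0)(0 := n, 1 := k))"
    using n_less_V k_le_V by (auto simp: bounded_by_def)
  obtain t m fs where run: "t \<le> ?t"
    "run \<delta> w balanced_prog ((\<lambda>_. 0)(0 := n, 1 := k), []) t (m, concat (map (value_table n) fs))"
    and ok: "family_ok fs"
    using wp_balanced_prog bin unfolding wp_def by blast
  have bal: "balanced_hash_family \<delta> n k (mset fs)" and len: "length fs = M"
    using family_ok_balanced[OF ok E(2) M_cond] by blast+
  have time: "real ?t \<le> 1000000 * (real N * (exp (real k) * real k ^ 3 * real n * log_pos n / d\<^sup>2))"
  proof -
    define \<Phi> where "\<Phi> = exp (real k) * log_pos n / d\<^sup>2"
    \<comment> \<open>The claimed time bound without its constant. Each summand of the running time
      is compared with it separately.\<close>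
    define \<Psi> where "\<Psi> = real N * real k ^ 3 * real n * \<Phi>"
    have dd: "1 / d \<le> 1 / d\<^sup>2" "1 \<le> 1 / d"
      using d mult_left_mono[OF d(2), of d] by (auto simp: field_simps power2_eq_square)
    have el: "1 * 1 \<le> exp (real k) * log_pos n" using lP(1) by (intro mult_mono) auto
    have \<Phi>d: "1 / d \<le> \<Phi>"
    proof -
      have "1 / d\<^sup>2 \<le> (exp (real k) * log_pos n) / d\<^sup>2"
        using el by (intro divide_right_mono) auto
      then show ?thesis using dd by (simp add: \<Phi>_def)
    qed
    have \<Phi>1: "1 \<le> \<Phi>" using \<Phi>d dd by linarith
    have \<Phi>e: "exp (real k) \<le> \<Phi>"
    proof -
      have "exp (real k) * 1 \<le> exp (real k) * (log_pos n / d\<^sup>2)"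
      proof (rule mult_left_mono)
        have "1 * 1 \<le> log_pos n * (1 / d\<^sup>2)" using lP(1) dd by (intro mult_mono) auto
        then show "1 \<le> log_pos n / d\<^sup>2" by simp
      qed simp
      then show ?thesis by (simp add: \<Phi>_def)
    qed
    have k3: "1 \<le> real k ^ 3" using k1 by simp
    have n_le: "real n * x \<le> real N * real k ^ 3 * real n * x" if "0 \<le> x" for x
    proof -
      have "1 * 1 \<le> real N * real k ^ 3" using N1 k3 by (intro mult_mono) auto
      then have "1 * (real n * x) \<le> (real N * real k ^ 3) * (real n * x)"
        using that by (intro mult_right_mono) auto
      then show ?thesis by (simp add: mult.assoc)
    qed
    have n\<Phi>: "real n * \<Phi> \<le> \<Psi>" unfolding \<Psi>_def using \<Phi>1 by (intro n_le) simp
    have n\<Psi>: "real n \<le> \<Psi>"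
      using n\<Phi> mult_left_mono[OF \<Phi>1, of "real n"] by simp
    have E\<Psi>: "real E \<le> 9 * \<Psi>"
    proof -
      have "1 * \<Phi> \<le> real n * \<Phi>" using n1 \<Phi>1 by (intro mult_right_mono) auto
      then show ?thesis using Ed \<Phi>d n\<Phi> by simp
    qed
    have one\<Psi>: "1 \<le> \<Psi>" using n\<Psi> n1 by linarith
    have k\<Psi>: "real k \<le> \<Psi>" using n\<Psi> kn by linarith
    have a\<Psi>: "real a \<le> 2 * \<Psi>"
    proof -
      have "real a \<le> 2 * real n" using a2n by linarith
      then show ?thesis using n\<Psi> by linarith
    qed
    have gen: "real (n * (2 ^ k * N)) \<le> \<Psi>"
    proof -
      have "(2 :: real) ^ k \<le> exp 1 ^ k" using exp_ge_add_one_self[of 1] by (intro power_mono) auto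
      also have "\<dots> = exp (real k)" by (simp add: exp_of_nat_mult[symmetric])
      finally have "2 ^ k \<le> \<Phi>" using \<Phi>e by linarith
      then have "real n * (real N * 2 ^ k) \<le> real n * (real N * \<Phi>)"
        by (intro mult_left_mono) auto
      moreover have "real n * (real N * \<Phi>) * 1 \<le> real n * (real N * \<Phi>) * real k ^ 3"
        using k3 \<Phi>1 by (intro mult_left_mono) auto
      ultimately show ?thesis by (simp add: \<Psi>_def mult_ac)
    qed
    have main: "real (M * (n * (N * k * k))) \<le> 648 * \<Psi>"
    proof -
      \<comment> \<open>Together with the k^2 of the nested loops this makes the exponent of k equal
        to 3.\<close>
      have "sqrt (real k) \<le> real k" using k1 by (intro real_le_lsqrt) (auto simp: power2_eq_square)
      then have "exp (real k) * sqrt (real k) * log_pos n / d\<^sup>2 \<le> exp (real k) * real k * log_pos n / d\<^sup>2"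
        using lP(1) by (intro divide_right_mono mult_right_mono mult_left_mono) auto
      then have "real M \<le> 648 * (exp (real k) * real k * log_pos n / d\<^sup>2)" using M_le by linarith
      then have "real M \<le> 648 * (real k * \<Phi>)" by (simp add: \<Phi>_def mult_ac)
      then have "real M * (real n * (real N * real k * real k)) \<le>
          648 * (real k * \<Phi>) * (real n * (real N * real k * real k))"
        by (intro mult_right_mono) auto
      then show ?thesis by (simp add: \<Psi>_def power3_eq_cube mult_ac)
    qed
    have "real ?t = 40 * real E + 100 * real k + 60 * real a + 300 +
        (200 * real (n * (2 ^ k * N)) + 1500 * real (M * (n * (N * k * k))))"
      unfolding length_Ls N_def[symmetric] by simp
    also have "\<dots> \<le> 1000000 * \<Psi>" using E\<Psi> k\<Psi> a\<Psi> one\<Psi> gen main by linarith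
    also have "\<Psi> = real N * (exp (real k) * real k ^ 3 * real n * log_pos n / d\<^sup>2)"
      by (simp add: \<Psi>_def \<Phi>_def)
    finally show ?thesis .
  qed
  have word: "admissible_word_length 1300 n k \<delta> w"
  proof -
    define L where "L = log 2 (1 / d)"
    define K where "K = real k * log 2 (real n)"
    have L0: "0 \<le> L" using d by (simp add: L_def)
    have K0: "0 \<le> K" using n1 by (simp add: K_def)
    have w1: "real w \<le> 64 * log 2 (real V) + 1"
    proof (cases w)
      case (Suc v)
      have "\<not> V ^ 64 < 2 ^ v" using not_less_Least[of v "\<lambda>w. V ^ 64 < 2 ^ w"] Suc by (simp add: w_def)
      then have "real (2 ^ v) \<le> real (V ^ 64)" by (simp only: of_nat_le_iff not_less)
      then have "log 2 (2 ^ v) \<le> log 2 (real V ^ 64)" using V_mono[of 1 0 0] by (subst log_le_cancel_iff) auto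
      then show ?thesis using Suc V_mono[of 1 0 0] by (simp add: log_nat_power)
    qed (use V_mono[of 1 0 0] in simp)
    have logB: "log 2 (real B) \<le> 1 + 2 * K"
    \<comment> \<open>For n >= 2 one has n + 1 <= n^2. At n = 1 the logarithm of n vanishes but
      \<open>B\<close> is 2, which is covered by the summand 1.\<close>
    proof (cases "n = 1")
      case True
      then have "k = 1" using k1 kn by simp
      then show ?thesis using True K0 by (simp add: B_def)
    next
      case False
      then have "log 2 (real (n + 1)) \<le> log 2 (real n ^ 2)"
        using n1 by (subst log_le_cancel_iff) (auto simp: power2_eq_square intro: order_trans[of _ "2 * real n"])
      also have "\<dots> = 2 * log 2 (real n)" using n1 by (simp add: log_nat_power)
      finally have "real k * log 2 (real (n + 1)) \<le> real k * (2 * log 2 (real n))"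
        by (intro mult_left_mono) auto
      moreover have "log 2 (real B) = real k * log 2 (real (n + 1))"
        unfolding B_def of_nat_power by (rule log_nat_power) simp
      ultimately show ?thesis by (simp add: K_def)
    qed
    have logE: "log 2 (real E) \<le> 4 + L"
    proof -
      have "log 2 (real E) \<le> log 2 (16 * (1 / d))"
      proof (subst log_le_cancel_iff)
        have "9 / d \<le> 16 * (1 / d)" using d by (simp add: divide_right_mono)
        then show "real E \<le> 16 * (1 / d)" using Ed by linarith
      qed (use E(1) d in auto)
      also have "\<dots> = log 2 16 + L" unfolding L_def by (subst log_mult) (use d in auto)
      also have "log 2 16 = (4 :: real)" using log_nat_power[of 2 2 4] by simp
      finally show ?thesis .
    qed
    have "log 2 (real V) = 6 + (5 * log 2 (real B) + 2 * log 2 (real E))"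
    proof -
      have "log 2 64 = (6 :: real)" using log_nat_power[of 2 2 6] by simp
      then show ?thesis
        unfolding V_def of_nat_mult of_nat_power using B1 E(1) by (simp add: log_mult log_nat_power)
    qed
    then have "log 2 (real V) \<le> 19 + 10 * K + 2 * L" using logB logE by linarith
    moreover have "x \<le> 1300 * (1 + K + L)" if "y \<le> 19 + 10 * K + 2 * L" "x \<le> 64 * y + 1" for x y :: real
    proof -
      have "x \<le> 1217 + 640 * K + 128 * L" using that by linarith
      also have "\<dots> \<le> 1300 + 1300 * K + 1300 * L" using L0 K0 by linarith
      finally show ?thesis by (simp add: distrib_left)
    qed
    ultimately have "real w \<le> 1300 * (1 + K + L)" using w1 by blast
    then show ?thesis by (simp add: admissible_word_length_def K_def L_def d_def)
  qed
  have out: "outputs_within \<delta> w balanced_prog n k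
      (1000000 * (real (n choose k) *
        (exp (real k) * real k ^ 3 * real n * log_pos n / (\<delta> - 1)\<^sup>2)))
      (concat (map (value_table n) fs))"
  proof -
    have "real t \<le> real ?t" using run(1) by (simp only: of_nat_le_iff)
    then show ?thesis
      unfolding outputs_within_def using run(2) time unfolding N_def d_def by (meson order_trans)
  qed
  show ?thesis
    using bal len M_le word out unfolding d_def by blast
qed

theorem theorem4:
  "\<exists>(P::prog) (A::real) (C::real) (c::nat) (D::real).
     \<forall>(n::nat) (k::nat) (\<delta>::real). 1 \<le> k \<and> k \<le> n \<and> 1 < \<delta> \<and> \<delta> \<le> 2 \<longrightarrow>
       (\<exists>(fs::(nat \<Rightarrow> nat) list) (w::nat).
          balanced_hash_family \<delta> n k (mset fs) \<and>
          real (length fs) \<le> A * (exp (real k) * sqrt (real k) * log_pos n / (\<delta> - 1)\<^sup>2) \<and>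
          admissible_word_length D n k \<delta> w \<and>
          outputs_within \<delta> w P n k
            (C * (real (n choose k) *
                  (exp (real k) * real k ^ c * real n * log_pos n / (\<delta> - 1)\<^sup>2)))
            (concat (map (value_table n) fs)))"
  by (rule exI[of _ balanced_prog], rule exI[of _ 648], rule exI[of _ 1000000],
      rule exI[of _ 3], rule exI[of _ 1300]) (blast intro: balanced_prog_computes)

end
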